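(* Consider the stochastic generalized sorting problem on $n$ vertices with edge probability $p$ (defined in the context). The algorithm StochasticSort (defined in the context) always returns the correct true ordering $x_1 \prec x_2 \prec \cdots \prec x_n$, and the expected number of comparisons (edge queries) it makes is $O(n \log (pn))$, where the expectation is over the random generation of the stochastic edges and the internal randomness of the algorithm.
   Context: Stochastic generalized sorting: there are $n$ vertices $V$ with an unknown true order $x_1 \prec x_2 \prec \cdots \prec x_n$. The undirected graph $G=(V,E)$ is given to the algorithm: each pair $(x_i,x_{i+1})$ ("deterministic pair") is an edge, and every other pair ("stochastic pair") is an edge independently with probability $p$. A query (comparison) of an edge $(u,v)\in E$ reveals which of $u,v$ comes first; only edges of $E$ may be queried. When $x_1,\dots,x_\ell$ have been discovered, the rank of an undiscovered vertex $v = x_{\ell+r}$ is $r(v)=r$. Edge sets: let $q=\Theta(\log(pn))$ be a positive integer depending only on $n,p$, and let $\alpha\in[1,2]$ be the unique positive solution of $\prod_{i=1}^q (1-\alpha p/2^i) = 1-p$. For each edge $e\in E$ independently, draw $(X_1,\dots,X_q)$ with the $X_i$ independent Bernoulli$(\alpha p/2^i)$, conditioned on at least one $X_i$ equal to $1$, and put $e\in E_i$ iff $X_i=1$ (so $\bigcup_i E_i = E$). Algorithm StochasticSort: fix a sufficiently large constant $c$ and let $s_i=2^i/p$. Levels $L_1\subseteq L_2\subseteq\cdots\subseteq L_{q+c}$ are sets of undiscovered vertices; $L_{q+1},\dots,L_{q+c}$ always contain all undiscovered vertices. Rule for building $L_i$ from $L_{i+1}$ (using the current $L_{i+c}$): a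 vertex $v\in L_{i+1}$ is excluded from $L_i$ ("blocked by the edge $(u,v)$") iff there is $u\in L_{i+c}$ with $(u,v)\in E_i$ and $u\prec v$, which is determined by querying the edges of $E_i$ from $v$ to $L_{i+c}$; otherwise $v\in L_i$. Initially all levels are built top-down ($L_q$ down to $L_1$) by this rule. The first vertex $x_1$ is found by: query an arbitrary edge $(u,v)$, set $v_0$ to the earlier and $S=\{$the later$\}$; while some edge $(u,v_0)\in E$ has $u\notin S$, query it: if $u\prec v_0$ add $v_0$ to $S$ and set $v_0\leftarrow u$, else add $u$ to $S$; finally output $v_0$. After each discovery of $x_\ell$: (1) remove $x_\ell$ from all levels; (2) incremental updates: for each $v$ currently blocked by an edge $(x_\ell,v)$, say $v\in L_{j+1}\setminus L_j$, repeatedly apply the rule: if there is no $u\in L_{j+c}$ with $(u,v)\in E_j$ and $u\prec v$, add $v$ to $L_j$ and continue with $j-1$, stopping when $v\in L_1$ or $v$ is blocked by a new edge; (3) for every $i$ such that $\ell$ is a multiple of $s_i/32$, rebuild $L_i,L_{i-1},\dots,L_1$ in that order from scratch by the rule (using the current levels and redetermining all blockings). Then $x_{\ell+1}$ is found as follows: let $C=\{v\in L_1: (x_\ell,v)\in E\}$; for $i=1,2,\dots$, query all edges of $E$ between $L_i$ and the remaining vertices of $C$, removing $v$ from $C$ whenever an edge $(u,v)$ with $u\prec v$ is found; once $|C|=1$ its element is declared $x_{\ell+1}$. This discovers $x_1,\dots,x_{n/2}$; the vertices $x_n,x_{n-1},\dots,x_{n/2+1}$ are discovered by the symmetric procedure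 with the order reversed.
   Formalization: The lower constant hidden in q = Θ(log(pn)) is taken sufficiently large (for small constants the bound fails), and "ℓ is a multiple of s_i/32", which may never hold when s_i/32 is not an integer, is read as "a multiple of s_i/32 lies in (ℓ−1, ℓ]". *)

theory Defs
  imports "HOL-Probability.Probability" "HOL-Probability.Product_PMF"
begin

text \<open>
  Deterministic comparison algorithms are decision trees: their only access to the true
  order is through Query nodes. The answer to Query u v is true iff u precedes v.
\<close>

datatype 'a comp = Return 'a | Query nat nat "bool \<Rightarrow> 'a comp"

primrec bind_comp :: "'a comp \<Rightarrow> ('a \<Rightarrow> 'b comp) \<Rightarrow> 'b comp" where
  "bind_comp (Return x) f = f x"
| "bind_comp (Query u v k) f = Query u v (\<lambda>b. bind_comp (k b) f)"

adhoc_overloading Monad_Syntax.bind \<rightleftharpoons> bind_comp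

text \<open>Result together with the number of queries, repeated queries being counted each time.\<close>

primrec run :: "(nat \<Rightarrow> nat \<Rightarrow> bool) \<Rightarrow> 'a comp \<Rightarrow> 'a \<times> nat" where
  "run ans (Return x) = (x, 0)"
| "run ans (Query u v k) = map_prod id Suc (run ans (k (ans u v)))"

text \<open>Swapping the arguments of a query is asking about the reversed order.\<close>

primrec reversed :: "'a comp \<Rightarrow> 'a comp" where
  "reversed (Return x) = Return x"
| "reversed (Query u v k) = Query v u (\<lambda>b. reversed (k b))"

primrec for_each :: "'a list \<Rightarrow> ('a \<Rightarrow> 's \<Rightarrow> 's comp) \<Rightarrow> 's \<Rightarrow> 's comp" where
  "for_each [] f s = Return s"
| "for_each (x # xs) f s = f x s \<bind> for_each xs f"


section \<open>The algorithm\<close>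

text \<open>
  The vertices are \<^term>\<open>{..<n::nat}\<close>; edges are two-element sets of vertices; Es i is the
  edge set $E_i$. In a state, lev i is the level $L_i$, and blk v is the set of all u such
  that v is currently blocked by the edge (u, v). The levels with index above q all consist of
  all undiscovered vertices.
\<close>

record state =
  lev :: "nat \<Rightarrow> nat set"
  blk :: "nat \<Rightarrow> nat set"

definition s_param :: "real \<Rightarrow> nat \<Rightarrow> real" where
  "s_param p i = 2 ^ i / p"

primrec earlier :: "nat \<Rightarrow> nat list \<Rightarrow> nat set comp" where
  "earlier v [] = Return {}"
| "earlier v (u # us) =
     Query u v (\<lambda>b. do { B \<leftarrow> earlier v us; Return (if b then insert u B else B) })"

definition blockers :: "nat \<Rightarrow> (nat \<Rightarrow> nat set set) \<Rightarrow> nat \<Rightarrow> nat \<Rightarrow> state \<Rightarrow> nat set comp" where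
  "blockers c Es i v s = earlier v (sorted_list_of_set {u \<in> lev s (i + c). {u, v} \<in> Es i})"

definition enter :: "nat \<Rightarrow> nat \<Rightarrow> state \<Rightarrow> state" where
  "enter i v s = s\<lparr>lev := (lev s)(i := insert v (lev s i)), blk := (blk s)(v := {})\<rparr>"

definition block :: "nat \<Rightarrow> nat set \<Rightarrow> state \<Rightarrow> state" where
  "block v B s = s\<lparr>blk := (blk s)(v := B)\<rparr>"

definition build_level :: "nat \<Rightarrow> (nat \<Rightarrow> nat set set) \<Rightarrow> nat \<Rightarrow> state \<Rightarrow> state comp" where
  "build_level c Es i s =
     for_each (sorted_list_of_set (lev s (i + 1)))
       (\<lambda>v s. do {
          B \<leftarrow> blockers c Es i v s;
          Return (if B = {} then enter i v s else block v B s) })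
       (s\<lparr>lev := (lev s)(i := {})\<rparr>)"

definition build_down :: "nat \<Rightarrow> (nat \<Rightarrow> nat set set) \<Rightarrow> nat \<Rightarrow> state \<Rightarrow> state comp" where
  "build_down c Es i s = for_each (rev [1..<i + 1]) (build_level c Es) s"

definition initial_state :: "nat \<Rightarrow> nat \<Rightarrow> state" where
  "initial_state n q = \<lparr>lev = (\<lambda>i. if i > q then {..<n} else {}), blk = (\<lambda>_. {})\<rparr>"

definition remove_vertex :: "nat \<Rightarrow> state \<Rightarrow> state" where
  "remove_vertex x s = s\<lparr>lev := (\<lambda>i. lev s i - {x})\<rparr>"

primrec promote :: "nat \<Rightarrow> (nat \<Rightarrow> nat set set) \<Rightarrow> nat \<Rightarrow> nat \<Rightarrow> state \<Rightarrow> state comp" where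
  "promote c Es v 0 s = Return s"
| "promote c Es v (Suc j) s = do {
     B \<leftarrow> blockers c Es (Suc j) v s;
     if B = {} then promote c Es v j (enter (Suc j) v s) else Return (block v B s) }"

definition incremental_updates ::
    "nat \<Rightarrow> nat \<Rightarrow> (nat \<Rightarrow> nat set set) \<Rightarrow> nat \<Rightarrow> state \<Rightarrow> state comp" where
  "incremental_updates q c Es x s =
     for_each (sorted_list_of_set {v \<in> lev s (q + 1). x \<in> blk s v})
       (\<lambda>v s. promote c Es v (THE j. 1 \<le> j \<and> v \<in> lev s (j + 1) - lev s j) s) s"

text \<open>
  As $s_i / 32$ need not be an integer, ``l is a multiple of $s_i / 32$'' is read as ``a multiple
  of $s_i / 32$ is reached in step l'', that is, lies in the interval $(l - 1, l]$. If $s_i / 32$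
  or its reciprocal is an integer, this says literally that l is a multiple of $s_i / 32$.
\<close>

definition rebuild_due :: "real \<Rightarrow> nat \<Rightarrow> nat \<Rightarrow> bool" where
  "rebuild_due p l i \<longleftrightarrow>
     (\<exists>m::nat. real l - 1 < real m * (s_param p i / 32) \<and> real m * (s_param p i / 32) \<le> real l)"

definition after_discovery ::
    "real \<Rightarrow> nat \<Rightarrow> nat \<Rightarrow> (nat \<Rightarrow> nat set set) \<Rightarrow> nat \<Rightarrow> nat \<Rightarrow> state \<Rightarrow> state comp" where
  "after_discovery p q c Es l x s = do {
     s \<leftarrow> incremental_updates q c Es x (remove_vertex x s);
     for_each (rev [1..<q + 1])
       (\<lambda>i s. if rebuild_due p l i then build_down c Es i s else Return s) s }"

text \<open>
  The function pick makes the arbitrary choices. Every round of the while loop adds a vertex to S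
  and never adds the current candidate, so n rounds exhaust it.
\<close>

definition find_first ::
    "((nat \<times> nat) set \<Rightarrow> nat \<times> nat) \<Rightarrow> nat \<Rightarrow> nat set set \<Rightarrow> nat comp" where
  "find_first pick n E =
     (let (u, v) = pick {(u, v). {u, v} \<in> E} in
      Query u v (\<lambda>b. do {
        (v0, S) \<leftarrow> for_each [0..<n]
          (\<lambda>_ (v0, S).
             let F = {(u, v). v = v0 \<and> {u, v} \<in> E \<and> u \<notin> S} in
             if F = {} then Return (v0, S)
             else let u = fst (pick F) in
               Query u v0 (\<lambda>b. Return (if b then (u, insert v0 S) else (v0, insert u S))))
          (if b then (u, {v}) else (v, {u}));
        Return v0 }))"

text \<open>
  One round: all edges between L and C are queried, each of them once (C is contained in L, so an
  edge with both endpoints in C would otherwise occur in both orientations).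
\<close>

definition eliminate :: "nat set set \<Rightarrow> nat set \<Rightarrow> nat set \<Rightarrow> nat set comp" where
  "eliminate E L C =
     for_each [(u, v). v \<leftarrow> sorted_list_of_set C, u \<leftarrow> sorted_list_of_set L,
                       {u, v} \<in> E \<and> (u \<in> C \<longrightarrow> u < v)]
       (\<lambda>(u, v) C. Query u v (\<lambda>b. Return (C - {if b then v else u}))) C"

definition find_next :: "nat \<Rightarrow> nat \<Rightarrow> nat set set \<Rightarrow> nat \<Rightarrow> state \<Rightarrow> nat comp" where
  "find_next q c E x s = do {
     C \<leftarrow> for_each [1..<q + c + 1]
       (\<lambda>i C. if card C = 1 then Return C else eliminate E (lev s i) C)
       {v \<in> lev s 1. {x, v} \<in> E};
     Return (the_elem C) }"

text \<open>Discovers the first m vertices, for m > 0.\<close>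

definition discover ::
    "((nat \<times> nat) set \<Rightarrow> nat \<times> nat) \<Rightarrow> nat \<Rightarrow> real \<Rightarrow> nat \<Rightarrow> nat \<Rightarrow> nat set set \<Rightarrow>
     (nat \<Rightarrow> nat set set) \<Rightarrow> nat \<Rightarrow> nat list comp" where
  "discover pick n p q c E Es m = do {
     s \<leftarrow> build_down c Es q (initial_state n q);
     x \<leftarrow> find_first pick n E;
     (ys, s) \<leftarrow> for_each [1..<m]
       (\<lambda>l (ys, s). do {
          s \<leftarrow> after_discovery p q c Es l (last ys) s;
          y \<leftarrow> find_next q c E (last ys) s;
          Return (ys @ [y], s) })
       ([x], s);
     Return ys }"

definition sort_with ::
    "((nat \<times> nat) set \<Rightarrow> nat \<times> nat) \<Rightarrow> nat \<Rightarrow> real \<Rightarrow> nat \<Rightarrow> nat \<Rightarrow> nat set set \<Rightarrow>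
     (nat \<Rightarrow> nat set set) \<Rightarrow> nat list comp" where
  "sort_with pick n p q c E Es = do {
     ys \<leftarrow> discover pick n p q c E Es (n div 2);
     zs \<leftarrow> reversed (discover pick n p q c E Es (n - n div 2));
     Return (ys @ rev zs) }"

definition alpha :: "real \<Rightarrow> nat \<Rightarrow> real" where
  "alpha p q = (THE a. 1 \<le> a \<and> a \<le> 2 \<and> (\<Prod>i=1..q. 1 - a * p / 2 ^ i) = 1 - p)"

definition label_pmf :: "real \<Rightarrow> nat \<Rightarrow> (nat \<Rightarrow> bool) pmf" where
  "label_pmf p q =
     cond_pmf (Pi_pmf {1..q} False (\<lambda>i. bernoulli_pmf (alpha p q * p / 2 ^ i)))
       {X. \<exists>i\<in>{1..q}. X i}"

definition stochastic_sort ::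
    "((nat \<times> nat) set \<Rightarrow> nat \<times> nat) \<Rightarrow> nat \<Rightarrow> real \<Rightarrow> nat \<Rightarrow> nat \<Rightarrow> nat set set \<Rightarrow>
     nat list comp pmf" where
  "stochastic_sort pick n p q c E =
     map_pmf (\<lambda>X. sort_with pick n p q c E (\<lambda>i. {e \<in> E. X e i}))
       (Pi_pmf E (\<lambda>_. False) (\<lambda>_. label_pmf p q))"


section \<open>The stochastic generalized sorting problem\<close>

text \<open>The list xs is the true order of the vertices \<^term>\<open>{..<length xs}\<close>.\<close>

definition precedes :: "nat list \<Rightarrow> nat \<Rightarrow> nat \<Rightarrow> bool" where
  "precedes xs u v \<longleftrightarrow> (\<exists>i j. i < j \<and> j < length xs \<and> xs ! i = u \<and> xs ! j = v)"

definition deterministic_pairs :: "nat list \<Rightarrow> nat set set" where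
  "deterministic_pairs xs = {{xs ! i, xs ! (i + 1)} | i. i + 1 < length xs}"

definition stochastic_pairs :: "nat list \<Rightarrow> nat set set" where
  "stochastic_pairs xs = {e. e \<subseteq> set xs \<and> card e = 2} - deterministic_pairs xs"

definition graph_pmf :: "real \<Rightarrow> nat list \<Rightarrow> nat set set pmf" where
  "graph_pmf p xs =
     map_pmf (\<lambda>b. deterministic_pairs xs \<union> {e \<in> stochastic_pairs xs. b e})
       (Pi_pmf (stochastic_pairs xs) False (\<lambda>_. bernoulli_pmf p))"

text \<open>Only edges may be queried: a query of a non-edge is uninformative.\<close>

definition answer :: "nat list \<Rightarrow> nat set set \<Rightarrow> nat \<Rightarrow> nat \<Rightarrow> bool" where
  "answer xs E u v \<longleftrightarrow> {u, v} \<in> E \<and> precedes xs u v"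

text \<open>Joint distribution of the output and the number of comparisons.\<close>

definition sorting_experiment ::
    "((nat \<times> nat) set \<Rightarrow> nat \<times> nat) \<Rightarrow> real \<Rightarrow> nat \<Rightarrow> nat \<Rightarrow> nat list \<Rightarrow> (nat list \<times> nat) pmf" where
  "sorting_experiment pick p q c xs = do {
     E \<leftarrow> graph_pmf p xs;
     A \<leftarrow> stochastic_sort pick (length xs) p q c E;
     return_pmf (run (answer xs E) A) }"

end

theory Submission
  imports Defs
begin

text \<open>
  Positions in the true order serve as vertex names. Two one-sided descriptions of the levels
  replace the adaptive sets $L_h$. A vertex without $E_j$-edges, j at least h, to earlier
  vertices discovered after time t (it is called robust) lies in $L_h$ at all times from t on, since
  a blocker is always undiscovered. Conversely, a member of $L_h$ has no $E_j$-edge, j at least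
  h, to an earlier robust vertex; this defines a superset of $L_h$ in closed form, which depends
  on the edges in $E_j$ with j at least h only. All costs are bounded in terms of these supersets,
  so the expected cost is a sum of probabilities of conjunctions of events about disjoint sets of
  pairs.

  A vertex of rank d belongs to the superset of $L_h$ with probability at most $(20 s_h / d)^3$: for
  every j from h on with $19 s_j$ at most d it avoids $E_j$-edges to the robust vertices with
  rank between $8 s_j$ and $16 s_j$, which has probability at most 1/8; the windows are disjoint, so
  these events are independent. Hence the first two moments of the size of $L_h$ are
  $O(s_h)$ and $O(s_h^2)$. This gives expected cost $O(s_i)$ for a rebuild of $L_i$, $O(1)$ for
  the incremental updates in $E_i$ after one discovery, and $O(1)$ for the i-th round of the search for
  the next vertex.
\<close>

section \<open>Results and costs of comparison algorithms\<close>

text \<open>The obstacle is adaptivity. Membership in a level depends on checks made at earlier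
  times against other levels, so conditioning on a level would destroy the independence of the
  edges. The closed form avoids conditioning; its price is that a blocker in \<open>E_j\<close> only
  counts if it is robust for level j + c, and c at least 8 is what makes robustness of a typical
  blocker at least as likely as not. Labels of a stochastic pair are independent only because the
  edge coin and the conditioned label vector merge into an unconditioned vector, which is the role
  of \<alpha>. Neighbours in the true order always form an edge, so they gain no factor p and are
  split off in every sum. Decay with exponent 3 is what the second moment needs: the sum of d *
  (1/d)^2 diverges, that of d * (1/d)^3 does not. In the search for the next vertex the plain moment
  bound grows like 4^i. Rivals of rank above \<open>s_i / 32\<close> are met by an exponentially
  small probability of having no robust earlier neighbour. For closer rivals the direct predecessor
  must fail to be robust, which gains 2^(-i), and a sum over one vertex instead of the second moment
  loses only 2^i.\<close>

abbreviation result :: "(nat \<Rightarrow> nat \<Rightarrow> bool) \<Rightarrow> 'a comp \<Rightarrow> 'a" where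
  "result ans A \<equiv> fst (run ans A)"

abbreviation cost :: "(nat \<Rightarrow> nat \<Rightarrow> bool) \<Rightarrow> 'a comp \<Rightarrow> nat" where
  "cost ans A \<equiv> snd (run ans A)"

lemma run_bind:
  "run ans (bind_comp A f) =
     (result ans (f (result ans A)), cost ans A + cost ans (f (result ans A)))"
  by (induction A) (auto simp: map_prod_def split: prod.splits)

lemma run_reversed: "run ans (reversed A) = run (\<lambda>u v. ans v u) A"
  by (induction A) auto

lemma for_each_append:
  "result ans (for_each (xs @ ys) f s) = result ans (for_each ys f (result ans (for_each xs f s)))"
  "cost ans (for_each (xs @ ys) f s) =
     cost ans (for_each xs f s) + cost ans (for_each ys f (result ans (for_each xs f s)))"
  by (induction xs arbitrary: s) (auto simp: run_bind)

text \<open>The invariant sees the prefix already processed, and a step may use how the list splits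
  at the current element. This yields freshness of the element in a distinct list and its index in
  an \<open>upt\<close> list.\<close>

lemma for_each_invariant:
  assumes "\<And>ys y zs s. xs = ys @ y # zs \<Longrightarrow> I ys s \<Longrightarrow>
      I (ys @ [y]) (result ans (f y s)) \<and> cost ans (f y s) \<le> g y"
    and "I [] s"
  shows "I xs (result ans (for_each xs f s)) \<and> cost ans (for_each xs f s) \<le> sum_list (map g xs)"
proof -
  have "\<exists>zs. xs = us @ zs \<Longrightarrow>
    I us (result ans (for_each us f s)) \<and> cost ans (for_each us f s) \<le> sum_list (map g us)" for us
  proof (induction us rule: rev_induct)
    case Nil
    then show ?case using assms(2) by simp
  next
    case (snoc y us)
    from snoc.prems obtain zs where zs: "xs = us @ y # zs" by auto
    with snoc.IH have IH: "I us (result ans (for_each us f s))"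
      "cost ans (for_each us f s) \<le> sum_list (map g us)" by auto
    from assms(1)[OF zs IH(1)] IH(2) show ?case
      by (simp add: for_each_append run_bind)
  qed
  then show ?thesis by auto
qed

lemma run_earlier: "run ans (earlier v us) = ({u \<in> set us. ans u v}, length us)"
  by (induction us) (auto simp: run_bind)

definition all_edges :: "nat \<Rightarrow> (nat \<Rightarrow> nat set set) \<Rightarrow> nat \<Rightarrow> nat \<Rightarrow> state \<Rightarrow> nat set" where
  "all_edges c Es i v s = {u \<in> lev s (i + c). {u, v} \<in> Es i}"

lemma run_blockers:
  assumes "finite (lev s (i + c))"
  shows "run ans (blockers c Es i v s) =
    ({u \<in> all_edges c Es i v s. ans u v}, card (all_edges c Es i v s))"
  using assms by (simp add: blockers_def run_earlier all_edges_def)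

lemma run_eliminate_list:
  "run ans (for_each ps (\<lambda>(u, v) C. Query u v (\<lambda>b. Return (C - {if b then v else u}))) C) =
     (C - (\<lambda>(u, v). if ans u v then v else u) ` set ps, length ps)"
  by (induction ps arbitrary: C) (auto simp: run_bind)

lemma sum_list_length_if:
  "(\<Sum>u\<leftarrow>us. length (if P u then [f u] else [])) = length (filter P us)"
  by (induction us) auto

text \<open>The pairs queried in a round are fixed before the round starts, so its outcome is one
  set difference with all losers, including losers outside C. The cost bound drops the orientation
  condition and may count an edge inside C twice.\<close>

lemma run_eliminate:
  assumes "finite C" "finite L"
  shows "result ans (eliminate E L C) =
      C - (\<lambda>(u, v). if ans u v then v else u) `
        {(u, v). v \<in> C \<and> u \<in> L \<and> {u, v} \<in> E \<and> (u \<in> C \<longrightarrow> u < v)}"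
    and "cost ans (eliminate E L C) \<le> (\<Sum>v\<in>C. card {u \<in> L. {u, v} \<in> E})"
proof -
  let ?l = "[(u, v). v \<leftarrow> sorted_list_of_set C, u \<leftarrow> sorted_list_of_set L,
                       {u, v} \<in> E \<and> (u \<in> C \<longrightarrow> u < v)]"
  have "set ?l = {(u, v). v \<in> C \<and> u \<in> L \<and> {u, v} \<in> E \<and> (u \<in> C \<longrightarrow> u < v)}"
    using assms by auto
  then show "result ans (eliminate E L C) =
      C - (\<lambda>(u, v). if ans u v then v else u) `
        {(u, v). v \<in> C \<and> u \<in> L \<and> {u, v} \<in> E \<and> (u \<in> C \<longrightarrow> u < v)}"
    by (simp only: eliminate_def run_eliminate_list fst_conv)
  have "cost ans (eliminate E L C) = length ?l"
    by (simp only: eliminate_def run_eliminate_list snd_conv)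
  also have "\<dots> = (\<Sum>v\<leftarrow>sorted_list_of_set C. length (filter (\<lambda>u. {u, v} \<in> E \<and> (u \<in> C \<longrightarrow> u < v)) (sorted_list_of_set L)))"
    by (simp only: length_concat map_map o_def sum_list_length_if)
  also have "\<dots> \<le> (\<Sum>v\<leftarrow>sorted_list_of_set C. card {u \<in> L. {u, v} \<in> E})"
  proof (rule sum_list_mono)
    fix v
    have "length (filter (\<lambda>u. {u, v} \<in> E \<and> (u \<in> C \<longrightarrow> u < v)) (sorted_list_of_set L))
      = card (set (filter (\<lambda>u. {u, v} \<in> E \<and> (u \<in> C \<longrightarrow> u < v)) (sorted_list_of_set L)))"
      by (rule distinct_card[symmetric]) simp
    also have "\<dots> \<le> card {u \<in> L. {u, v} \<in> E}"
      by (rule card_mono) (use assms in auto)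
    finally show "length (filter (\<lambda>u. {u, v} \<in> E \<and> (u \<in> C \<longrightarrow> u < v)) (sorted_list_of_set L))
      \<le> card {u \<in> L. {u, v} \<in> E}" .
  qed
  also have "\<dots> = (\<Sum>v\<in>C. card {u \<in> L. {u, v} \<in> E})"
    using assms by (simp add: sum_list_distinct_conv_sum_set)
  finally show "cost ans (eliminate E L C) \<le> (\<Sum>v\<in>C. card {u \<in> L. {u, v} \<in> E})" .
qed

section \<open>Vertices that are certain or possible members of a level\<close>

text \<open>
  Vertices are identified with their position in the true order (counted from 0), so that the
  undiscovered vertices after l discoveries are the positions from l on; r m k j says that the
  pair of positions m and k is in $E_j$. A blocker is always undiscovered, so a vertex that is
  robust for h and t belongs to $L_h$ at all times from t until its discovery. Conversely the
  members of $L_h$ at time l were not blocked by a robust vertex when they were checked last,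
  where T j is a lower bound for the time of the last rebuild of $L_j$.
\<close>

definition robust :: "nat \<Rightarrow> (nat \<Rightarrow> nat \<Rightarrow> nat \<Rightarrow> bool) \<Rightarrow> nat \<Rightarrow> nat \<Rightarrow> nat \<Rightarrow> bool" where
  "robust q r h t k \<longleftrightarrow> (\<forall>m j. t \<le> m \<and> m < k \<and> h \<le> j \<and> j \<le> q \<longrightarrow> \<not> r m k j)"

text \<open>The closed-form superset of \<open>L_h\<close>. A blocker in \<open>E_j\<close> is
  sought in \<open>L_(j+c)\<close>, hence the level j + c; the last check against \<open>E_j\<close>
  took place at time T j or later, and a vertex robust from T j on was in \<open>L_(j+c)\<close> at
  that moment.\<close>

definition candidates ::
    "nat \<Rightarrow> nat \<Rightarrow> nat \<Rightarrow> (nat \<Rightarrow> nat \<Rightarrow> nat \<Rightarrow> bool) \<Rightarrow> nat \<Rightarrow> (nat \<Rightarrow> nat) \<Rightarrow> nat \<Rightarrow> nat set" where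
  "candidates n q c r l T h = {k \<in> {l..<n}. \<forall>j k'. h \<le> j \<and> j \<le> q \<and> l \<le> k' \<and> k' < k \<and> r k' k j
      \<longrightarrow> \<not> robust q r (j + c) (T j) k'}"

lemma robust_mono: "robust q r h t k \<Longrightarrow> t \<le> t' \<Longrightarrow> robust q r h t' k"
  unfolding robust_def by (meson le_trans)

lemma candidates_antimono_time:
  assumes "\<And>j. T j \<le> T' j"
  shows "candidates n q c r l T' h \<subseteq> candidates n q c r l T h"
  using robust_mono assms unfolding candidates_def by blast

lemma candidates_cong:
  assumes "\<And>j. h \<le> j \<Longrightarrow> j \<le> q \<Longrightarrow> T j = T' j"
  shows "candidates n q c r l T' h = candidates n q c r l T h"
  using assms unfolding candidates_def by auto

lemma candidates_mono_level:
  "h \<le> h' \<Longrightarrow> candidates n q c r l T h \<subseteq> candidates n q c r l T h'"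
  unfolding candidates_def by auto

lemma candidates_subset: "candidates n q c r l T h \<subseteq> {l..<n}"
  unfolding candidates_def by auto

lemma candidates_beyond: "q < h \<Longrightarrow> candidates n q c r l T h = {l..<n}"
  unfolding candidates_def by auto

text \<open>Time 0 stands for the initial build.\<close>

primrec last_rebuild :: "real \<Rightarrow> nat \<Rightarrow> nat \<Rightarrow> nat" where
  "last_rebuild p 0 j = 0"
| "last_rebuild p (Suc l) j = (if rebuild_due p (Suc l) j then Suc l else last_rebuild p l j)"

lemma last_rebuild_le: "last_rebuild p l j \<le> l"
  by (induction l) auto

lemma no_rebuild_since:
  assumes "0 < p" and "real (last_rebuild p l j) < real m * (s_param p j / 32)"
    "real m * (s_param p j / 32) \<le> real l"
  shows False
  using assms(2-)
proof (induction l)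
  case 0
  then show ?case by simp
next
  case (Suc l)
  show ?case
  proof (cases "rebuild_due p (Suc l) j")
    case True
    with Suc.prems show ?thesis by simp
  next
    case False
    then have "\<not> (real l < real m * (s_param p j / 32))"
      using Suc.prems unfolding rebuild_due_def by auto
    with Suc False show ?thesis by simp
  qed
qed

text \<open>The first multiple of \<open>s_j / 32\<close> strictly after the last rebuild exceeds it
  by at most \<open>s_j / 32\<close>. Were it at most l, it would have triggered another
  rebuild.\<close>

lemma last_rebuild_recent:
  assumes "0 < p"
  shows "real l < real (last_rebuild p l j) + s_param p j / 32"
proof (rule ccontr)
  let ?t = "real (last_rebuild p l j)" and ?s = "s_param p j / 32"
  assume *: "\<not> real l < ?t + ?s"
  have s: "?s > 0" using assms by (simp add: s_param_def)
  define m where "m = nat (\<lfloor>?t / ?s\<rfloor> + 1)"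
  have "0 \<le> \<lfloor>?t / ?s\<rfloor>" using s by (simp only: zero_le_floor) simp
  then have m: "real m = of_int \<lfloor>?t / ?s\<rfloor> + 1" unfolding m_def by simp
  have "?t / ?s < real m" "real m \<le> ?t / ?s + 1" unfolding m by linarith+
  then have "?t < real m * ?s" "real m * ?s \<le> ?t + ?s"
    using s by (simp_all only: pos_divide_less_eq) (simp add: field_simps)
  then show False using no_rebuild_since[OF assms, of l j m] * by linarith
qed

section \<open>The execution of the algorithm\<close>

locale sorting_instance =
  fixes xs :: "nat list" and n q c :: nat and E :: "nat set set" and Es :: "nat \<Rightarrow> nat set set"
  assumes distinct_xs: "distinct xs" and set_xs: "set xs = {..<n}"
    and deterministic_edges: "deterministic_pairs xs \<subseteq> E"
    and edges_pairs: "E \<subseteq> {e. e \<subseteq> {..<n} \<and> card e = 2}"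
    and Es_edges: "Es i \<subseteq> E"
    and c_pos: "1 \<le> c" and q_pos: "1 \<le> q" and n_ge_2: "2 \<le> n"
begin

abbreviation "ans \<equiv> answer xs E"

definition r :: "nat \<Rightarrow> nat \<Rightarrow> nat \<Rightarrow> bool" where
  "r m k j \<longleftrightarrow> m < n \<and> k < n \<and> {xs ! m, xs ! k} \<in> Es j"

definition e :: "nat \<Rightarrow> nat \<Rightarrow> bool" where
  "e m k \<longleftrightarrow> m < n \<and> k < n \<and> {xs ! m, xs ! k} \<in> E"

definition undiscovered :: "nat \<Rightarrow> nat set" where
  "undiscovered l = (!) xs ` {l..<n}"

definition cand :: "nat \<Rightarrow> (nat \<Rightarrow> nat) \<Rightarrow> nat \<Rightarrow> nat set" where
  "cand l T h = (!) xs ` candidates n q c r l T h"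

section \<open>Vertices, positions, and levels as sets of candidates\<close>

lemma length_xs: "length xs = n"
  using distinct_card[OF distinct_xs] set_xs by simp

lemma nth_eq: "a < n \<Longrightarrow> b < n \<Longrightarrow> xs ! a = xs ! b \<longleftrightarrow> a = b"
  using distinct_xs length_xs by (simp add: nth_eq_iff_index_eq)

lemma inj_nth: "A \<subseteq> {..<n} \<Longrightarrow> inj_on ((!) xs) A"
  by (auto intro!: inj_onI simp: nth_eq subset_iff)

lemma precedes_nth: "a < n \<Longrightarrow> b < n \<Longrightarrow> precedes xs (xs ! a) (xs ! b) \<longleftrightarrow> a < b"
  unfolding precedes_def length_xs using nth_eq by (metis order.strict_trans)

lemma precedesE:
  assumes "precedes xs u v"
  obtains a b where "a < b" "b < n" "u = xs ! a" "v = xs ! b"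
  using assms unfolding precedes_def length_xs by blast

lemma nth_in_undiscovered: "xs ! k \<in> undiscovered l \<longleftrightarrow> l \<le> k" if "k < n"
  using that nth_eq unfolding undiscovered_def by auto

lemma undiscovered_subset: "undiscovered l \<subseteq> {..<n}"
  using set_xs length_xs unfolding undiscovered_def by force

lemma undiscovered_0: "undiscovered 0 = {..<n}"
  unfolding undiscovered_def set_xs[symmetric] by (auto simp: set_conv_nth length_xs)

lemma undiscovered_Suc: "l < n \<Longrightarrow> undiscovered (Suc l) = undiscovered l - {xs ! l}"
  unfolding undiscovered_def using nth_eq by (force simp: Suc_le_eq order_le_less)

lemma cand_subset: "cand l T h \<subseteq> undiscovered l"
  using candidates_subset unfolding cand_def undiscovered_def by blast

lemma finite_undiscovered: "finite (undiscovered l)"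
  using undiscovered_subset finite_subset by blast

lemma finite_cand: "finite (cand l T h)"
  by (rule finite_subset[OF cand_subset finite_undiscovered])

lemma nth_in_cand: "k < n \<Longrightarrow> xs ! k \<in> cand l T h \<longleftrightarrow> k \<in> candidates n q c r l T h"
  using nth_eq candidates_subset[of n q c r l T h] unfolding cand_def by (auto simp: subset_iff)

lemma edge_not_singleton: "{v} \<notin> E" "{v} \<notin> Es i"
proof -
  show *: "{v} \<notin> E" using edges_pairs by auto
  then show "{v} \<notin> Es i" using Es_edges by blast
qed

lemma edge_in_range: "{u, v} \<in> E \<Longrightarrow> u < n \<and> v < n \<and> u \<noteq> v"
  using edges_pairs edge_not_singleton by (auto simp: insert_commute)

lemma consecutive_edge: "Suc a < n \<Longrightarrow> {xs ! a, xs ! Suc a} \<in> E"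
  using deterministic_edges unfolding deterministic_pairs_def length_xs by auto

definition blocking :: "nat \<Rightarrow> nat \<Rightarrow> state \<Rightarrow> nat set" where
  "blocking i v s = {u \<in> all_edges c Es i v s. ans u v}"

text \<open>
  The levels from h on are correct at time l. The vertices in W still wait for their incremental
  update after the discovery of the l-th vertex.
\<close>

definition levels_ok :: "nat \<Rightarrow> (nat \<Rightarrow> nat) \<Rightarrow> nat \<Rightarrow> nat set \<Rightarrow> state \<Rightarrow> bool" where
  "levels_ok l T h W s \<longleftrightarrow>
     (\<forall>i>q. lev s i = undiscovered l) \<and>
     (\<forall>i. h \<le> i \<and> i \<le> q \<longrightarrow> lev s i \<subseteq> lev s (i + 1)) \<and>
     (\<forall>i v. h \<le> i \<and> i \<le> q \<and> v \<in> lev s (i + 1) - lev s i \<longrightarrow> blk s v \<noteq> {} \<and>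
        (\<forall>u\<in>blk s v. u \<in> undiscovered (if v \<in> W then l - 1 else l) \<and> precedes xs u v \<and>
           {u, v} \<in> Es i)) \<and>
     (\<forall>i\<ge>h. lev s i \<subseteq> cand l T i) \<and>
     (h = 1 \<longrightarrow> (\<forall>v\<in>lev s 1. blk s v = {}))"

lemma levels_okD:
  assumes "levels_ok l T h W s"
  shows "\<And>i. i > q \<Longrightarrow> lev s i = undiscovered l"
    and "\<And>i. h \<le> i \<Longrightarrow> i \<le> q \<Longrightarrow> lev s i \<subseteq> lev s (i + 1)"
    and "\<And>i v. h \<le> i \<Longrightarrow> i \<le> q \<Longrightarrow> v \<in> lev s (i + 1) \<Longrightarrow> v \<notin> lev s i \<Longrightarrow> blk s v \<noteq> {}"
    and "\<And>i v u. h \<le> i \<Longrightarrow> i \<le> q \<Longrightarrow> v \<in> lev s (i + 1) \<Longrightarrow> v \<notin> lev s i \<Longrightarrow> u \<in> blk s v \<Longrightarrow>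
      u \<in> undiscovered (if v \<in> W then l - 1 else l) \<and> precedes xs u v \<and> {u, v} \<in> Es i"
    and "\<And>i. h \<le> i \<Longrightarrow> lev s i \<subseteq> cand l T i"
    and "h = 1 \<Longrightarrow> v \<in> lev s 1 \<Longrightarrow> blk s v = {}"
  using assms unfolding levels_ok_def by blast+

lemma levels_ok_finite: "levels_ok l T h W s \<Longrightarrow> h \<le> i \<Longrightarrow> finite (lev s i)"
  by (rule finite_subset[OF levels_okD(5) finite_cand])

lemma levels_ok_mono_level:
  assumes "levels_ok l T h W s" "h \<le> i" "i \<le> j" "j \<le> q + 1"
  shows "lev s i \<subseteq> lev s j"
  using assms(3,4)
proof (induction j rule: dec_induct)
  case base
  then show ?case by simp
next
  case (step k)
  then show ?case using levels_okD(2)[OF assms(1), of k] assms(2) by auto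
qed

lemma blocked_level:
  assumes "levels_ok l T h W s" "h \<le> i" "i \<le> q + 1" "v \<in> undiscovered l" "v \<notin> lev s i"
  obtains j where "i \<le> j" "j \<le> q" "v \<in> lev s (j + 1)" "v \<notin> lev s j"
proof -
  have "\<exists>j. i \<le> j \<and> j \<le> q \<and> v \<in> lev s (j + 1) \<and> v \<notin> lev s j"
  proof (rule ccontr)
    assume *: "\<nexists>j. i \<le> j \<and> j \<le> q \<and> v \<in> lev s (j + 1) \<and> v \<notin> lev s j"
    have "k \<le> q + 1 \<Longrightarrow> v \<notin> lev s k" if "i \<le> k" for k
      using that
    proof (induction k rule: dec_induct)
      case base
      then show ?case using assms by simp
    next
      case (step k)
      then show ?case using * by auto
    qed
    then have "v \<notin> lev s (q + 1)" using assms(3) by blast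
    then show False using levels_okD(1)[OF assms(1), of "q + 1"] assms(4) by simp
  qed
  then show thesis using that by blast
qed

text \<open>A missing vertex drops out of the chain of levels at some j at least i, where an
  \<open>E_j\<close>-edge to an earlier vertex blocks it. That blocker is undiscovered, except that
  a vertex still in W may be blocked by the one just discovered, at position l - 1; hence the
  stronger bound on t when W is not empty. Robustness from t excludes both kinds of blocker.\<close>

lemma robust_in_level:
  assumes "levels_ok l T h W s" "h \<le> i" "robust q r i t k" "l \<le> k" "k < n"
    "t \<le> l" "W \<noteq> {} \<Longrightarrow> t \<le> l - 1"
  shows "xs ! k \<in> lev s i"
proof (rule ccontr)
  assume not_in: "xs ! k \<notin> lev s i"
  have U: "xs ! k \<in> undiscovered l" using nth_in_undiscovered assms by simp
  have "i \<le> q + 1" using not_in U levels_okD(1)[OF assms(1), of i] by (cases "i \<le> q") auto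
  then obtain j where j: "i \<le> j" "j \<le> q" "xs ! k \<in> lev s (j + 1)" "xs ! k \<notin> lev s j"
    using blocked_level[OF assms(1,2) _ U not_in] by blast
  have hj: "h \<le> j" using assms j by simp
  obtain u where u: "u \<in> blk s (xs ! k)" using levels_okD(3)[OF assms(1) hj j(2-4)] by blast
  from levels_okD(4)[OF assms(1) hj j(2-4) u]
  have u': "u \<in> undiscovered (if xs ! k \<in> W then l - 1 else l)" "precedes xs u (xs ! k)"
    "{u, xs ! k} \<in> Es j" by auto
  obtain a where a: "a < k" "u = xs ! a" using precedesE[OF u'(2)] nth_eq assms(5) by metis
  have "a < n" using a assms(5) by simp
  then have "(if xs ! k \<in> W then l - 1 else l) \<le> a" using u'(1) nth_in_undiscovered a(2) by blast
  moreover have "t \<le> l - 1" if "xs ! k \<in> W" using assms(7) that by blast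
  ultimately have "t \<le> a" using assms(6) by (cases "xs ! k \<in> W") auto
  moreover have "r a k j" using u'(3) a(2) \<open>a < n\<close> assms(5) unfolding r_def by simp
  ultimately show False using assms(3) a(1) j(1,2) unfolding robust_def by blast
qed

lemma cand_step:
  assumes "v \<in> cand l T (i + 1)" "i \<le> q"
    and "\<And>k. l \<le> k \<Longrightarrow> k < n \<Longrightarrow> precedes xs (xs ! k) v \<Longrightarrow> {xs ! k, v} \<in> Es i \<Longrightarrow>
      \<not> robust q r (i + c) (T i) k"
  shows "v \<in> cand l T i"
proof -
  from assms(1) obtain a where a: "v = xs ! a" "a \<in> candidates n q c r l T (i + 1)"
    unfolding cand_def by blast
  then have "a < n" using candidates_subset by fastforce
  have "a \<in> candidates n q c r l T i"
    unfolding candidates_def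
  proof (safe)
    show "a \<in> {l..<n}" using a candidates_subset by fastforce
    fix j k' assume *: "i \<le> j" "j \<le> q" "l \<le> k'" "k' < a" "r k' a j" "robust q r (j + c) (T j) k'"
    show False
    proof (cases "j = i")
      case True
      then show False using assms(3)[of k'] * \<open>a < n\<close> precedes_nth[of k' a] unfolding r_def a(1) by auto
    next
      case False
      then show False using a(2) * unfolding candidates_def by auto
    qed
  qed
  then show ?thesis unfolding a(1) cand_def by blast
qed

text \<open>A check that finds no blocker certifies candidacy: a robust earlier vertex with an
  \<open>E_i\<close>-edge to v would be in \<open>L_(i+c)\<close> and hence among the vertices
  queried.\<close>

lemma unblocked_cand:
  assumes "levels_ok l T h W s" "h \<le> i + c" "i \<le> q" "T i \<le> l" "W \<noteq> {} \<Longrightarrow> T i \<le> l - 1"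
    and "v \<in> cand l T (i + 1)" "blocking i v s = {}"
  shows "v \<in> cand l T i"
proof (rule cand_step[OF assms(6,3)])
  fix k assume k: "l \<le> k" "k < n" "precedes xs (xs ! k) v" "{xs ! k, v} \<in> Es i"
  show "\<not> robust q r (i + c) (T i) k"
  proof
    assume "robust q r (i + c) (T i) k"
    then have "xs ! k \<in> lev s (i + c)"
      using robust_in_level[OF assms(1,2) _ k(1,2) assms(4,5)] by blast
    then have "xs ! k \<in> blocking i v s"
      using k Es_edges unfolding blocking_def all_edges_def answer_def by blast
    then show False using assms(7) by simp
  qed
qed

section \<open>Building levels from scratch\<close>

definition build_cost :: "nat \<Rightarrow> (nat \<Rightarrow> nat) \<Rightarrow> nat \<Rightarrow> nat" where
  "build_cost l T i = (\<Sum>v\<in>cand l T (i + 1). card {u \<in> cand l T (i + c). {u, v} \<in> Es i})"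

lemma cand_antimono_time: "(\<And>j. T j \<le> T' j) \<Longrightarrow> cand l T' h \<subseteq> cand l T h"
  unfolding cand_def by (intro image_mono candidates_antimono_time) simp

lemma build_cost_antimono:
  assumes "\<And>j. T j \<le> T' j"
  shows "build_cost l T' i \<le> build_cost l T i"
proof -
  have "build_cost l T' i \<le> (\<Sum>v\<in>cand l T' (i + 1). card {u \<in> cand l T (i + c). {u, v} \<in> Es i})"
    unfolding build_cost_def
    by (intro sum_mono card_mono) (use finite_cand cand_antimono_time[of T T' l, OF assms] in \<open>auto simp: subset_iff\<close>)
  also have "\<dots> \<le> build_cost l T i" unfolding build_cost_def
    by (intro sum_mono2 finite_cand cand_antimono_time[of T T' l] assms) simp
  finally show ?thesis .
qed

lemma all_edges_cand:
  assumes "levels_ok l T h W s" "h \<le> i + c"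
  shows "card (all_edges c Es i v s) \<le> card {u \<in> cand l T (i + c). {u, v} \<in> Es i}"
  unfolding all_edges_def
  by (rule card_mono) (use finite_cand levels_okD(5)[OF assms] in auto)

text \<open>As c is at least 1, writing \<open>L_i\<close> does not touch \<open>L_(i+c)\<close>.
  All checks of one level therefore read the original state, and both the result and the cost have a
  closed form.\<close>

lemma levels_ok_build_level:
  assumes levels_ok: "levels_ok l T (i + 1) {} s" and i: "1 \<le> i" "i \<le> q" and T: "T i \<le> l"
  shows "levels_ok l T i {} (result ans (build_level c Es i s)) \<and>
    cost ans (build_level c Es i s) \<le> build_cost l T i"
proof -
  define B where "B v = blocking i v s" for v
  let ?f = "\<lambda>v s. bind_comp (blockers c Es i v s)
              (\<lambda>B. Return (if B = {} then enter i v s else block v B s))"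
  let ?s0 = "s\<lparr>lev := (lev s)(i := {})\<rparr>"
  let ?vs = "sorted_list_of_set (lev s (i + 1))"
  define I where "I ys s' \<longleftrightarrow> lev s' = (lev s)(i := {v \<in> set ys. B v = {}}) \<and>
     blk s' = (\<lambda>v. if v \<in> set ys then B v else blk s v)" for ys and s' :: state
  have fin: "finite (lev s (i + c))" "finite (lev s (i + 1))"
    using levels_ok_finite[OF levels_ok] c_pos by auto
  have step: "I (ys @ [y]) (result ans (?f y s')) \<and> cost ans (?f y s') \<le> card (all_edges c Es i y s)"
    if "I ys s'" for ys y s'
  proof -
    have l: "lev s' (i + c) = lev s (i + c)" using that c_pos unfolding I_def by simp
    then have ae: "all_edges c Es i y s' = all_edges c Es i y s" by (simp add: all_edges_def)
    have "run ans (blockers c Es i y s') = (B y, card (all_edges c Es i y s))"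
      using run_blockers[of s' i c] fin l by (simp add: ae B_def blocking_def)
    then show ?thesis using that unfolding I_def
      by (auto simp: run_bind enter_def block_def fun_eq_iff)
  qed
  have "I ?vs (result ans (for_each ?vs ?f ?s0)) \<and>
     cost ans (for_each ?vs ?f ?s0) \<le> (\<Sum>v\<leftarrow>?vs. card (all_edges c Es i v s))"
    by (rule for_each_invariant[where I = I]) (rule step, simp_all add: I_def)
  then have I: "I ?vs (result ans (build_level c Es i s))" and
    cost: "cost ans (build_level c Es i s) \<le> (\<Sum>v\<leftarrow>?vs. card (all_edges c Es i v s))"
    unfolding build_level_def by auto
  let ?r = "result ans (build_level c Es i s)"
  have lev: "lev ?r j = (if j = i then {v \<in> lev s (i + 1). B v = {}} else lev s j)" for j
    using I fin unfolding I_def by simp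
  have blk: "blk ?r v = (if v \<in> lev s (i + 1) then B v else blk s v)" for v
    using I fin unfolding I_def by simp
  have "levels_ok l T i {} ?r"
    unfolding levels_ok_def
  proof (intro conjI allI impI)
    fix j assume "j > q"
    then show "lev ?r j = undiscovered l" using levels_okD(1)[OF levels_ok] i by (simp add: lev)
  next
    fix j assume "i \<le> j \<and> j \<le> q"
    then show "lev ?r j \<subseteq> lev ?r (j + 1)" using levels_okD(2)[OF levels_ok, of j] by (auto simp: lev)
  next
    fix j v assume *: "i \<le> j \<and> j \<le> q \<and> v \<in> lev ?r (j + 1) - lev ?r j"
    have "blk ?r v \<noteq> {} \<and> (\<forall>u\<in>blk ?r v. u \<in> undiscovered l \<and> precedes xs u v \<and> {u, v} \<in> Es j)"
    proof (cases "j = i")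
      case True
      then have v: "v \<in> lev s (i + 1)" "B v \<noteq> {}" using * by (auto simp: lev)
      \<comment> \<open>New blockers are drawn from \<open>L_(i+c)\<close>, so they are
        undiscovered, as the invariant demands.\<close>
      have "lev s (i + c) \<subseteq> undiscovered l" using levels_okD(5)[OF levels_ok, of "i + c"] cand_subset c_pos by fastforce
      moreover have "u \<in> lev s (i + c) \<and> {u, v} \<in> Es i \<and> precedes xs u v" if "u \<in> B v" for u
        using that unfolding B_def blocking_def all_edges_def answer_def by simp
      ultimately show ?thesis using v True unfolding blk by auto
    next
      case False
      then have v: "v \<in> lev s (j + 1)" "v \<notin> lev s j" using * by (auto simp: lev)
      then have "v \<notin> lev s (i + 1)" using levels_ok_mono_level[OF levels_ok, of "i + 1" j] * False by auto
      then show ?thesis using levels_okD(3,4)[OF levels_ok _ _ v] * False unfolding blk by simp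
    qed
    then show "blk ?r v \<noteq> {}" "\<forall>u\<in>blk ?r v. u \<in> undiscovered (if v \<in> {} then l - 1 else l) \<and>
       precedes xs u v \<and> {u, v} \<in> Es j" by auto
  next
    fix j assume "i \<le> j"
    show "lev ?r j \<subseteq> cand l T j"
    proof (cases "j = i")
      case True
      have "v \<in> cand l T i" if "v \<in> lev s (i + 1)" "B v = {}" for v
        by (rule unblocked_cand[OF levels_ok]) (use that i T levels_okD(5)[OF levels_ok, of "i + 1"] c_pos in \<open>auto simp: B_def\<close>)
      then show ?thesis using True by (auto simp: lev)
    next
      case False
      then show ?thesis using levels_okD(5)[OF levels_ok, of j] \<open>i \<le> j\<close> by (simp add: lev)
    qed
  next
    assume "i = 1"
    then show "\<forall>v\<in>lev ?r 1. blk ?r v = {}" unfolding lev blk by auto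
  qed
  moreover have "(\<Sum>v\<leftarrow>?vs. card (all_edges c Es i v s)) \<le> build_cost l T i"
  proof -
    have "(\<Sum>v\<leftarrow>?vs. card (all_edges c Es i v s)) = (\<Sum>v\<in>lev s (i + 1). card (all_edges c Es i v s))"
      using fin by (simp add: sum_list_distinct_conv_sum_set)
    also have "\<dots> \<le> (\<Sum>v\<in>lev s (i + 1). card {u \<in> cand l T (i + c). {u, v} \<in> Es i})"
      by (intro sum_mono all_edges_cand[OF levels_ok]) (use c_pos in simp)
    also have "\<dots> \<le> build_cost l T i" unfolding build_cost_def
      by (intro sum_mono2 finite_cand levels_okD(5)[OF levels_ok]) auto
    finally show ?thesis .
  qed
  ultimately show ?thesis using cost by simp
qed

lemma levels_ok_build_down:
  assumes "levels_ok l T (i + 1) {} s" "i \<le> q" "\<And>j. j \<le> i \<Longrightarrow> T j \<le> l"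
  shows "levels_ok l T 1 {} (result ans (build_down c Es i s)) \<and>
    cost ans (build_down c Es i s) \<le> (\<Sum>j=1..i. build_cost l T j)"
  using assms
proof (induction i arbitrary: s)
  case 0
  then show ?case by (simp add: build_down_def)
next
  case (Suc i)
  let ?s = "result ans (build_level c Es (Suc i) s)"
  have 1: "levels_ok l T (Suc i) {} ?s \<and> cost ans (build_level c Es (Suc i) s) \<le> build_cost l T (Suc i)"
    by (rule levels_ok_build_level) (use Suc.prems in auto)
  have "levels_ok l T (i + 1) {} ?s" using 1 by simp
  then have IH: "levels_ok l T 1 {} (result ans (build_down c Es i ?s)) \<and>
      cost ans (build_down c Es i ?s) \<le> (\<Sum>j=1..i. build_cost l T j)"
    by (rule Suc.IH) (use Suc.prems in auto)
  have "run ans (build_down c Es (Suc i) s) = (result ans (build_down c Es i ?s),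
     cost ans (build_level c Es (Suc i) s) + cost ans (build_down c Es i ?s))"
    unfolding build_down_def by (simp add: run_bind)
  then show ?case using IH 1 by simp
qed

lemma levels_ok_cong:
  assumes ok: "levels_ok l T h W s" and T: "\<And>j. h \<le> j \<Longrightarrow> j \<le> q \<Longrightarrow> T j = T' j"
  shows "levels_ok l T' h W s"
proof -
  have "candidates n q c r l T' i = candidates n q c r l T i" if "h \<le> i" for i
    by (rule candidates_cong) (rule T, use that in simp_all)
  then have "\<forall>i\<ge>h. lev s i \<subseteq> cand l T' i" using levels_okD(5)[OF ok] unfolding cand_def by simp
  then show ?thesis using ok unfolding levels_ok_def by (elim conjE) (intro conjI; assumption)
qed

text \<open>Forgets the levels below i when they are about to be rebuilt. With i at least 2 the
  clause about blockings in \<open>L_1\<close> becomes vacuous.\<close>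

lemma levels_ok_weaken:
  assumes ok: "levels_ok l T h W s" and "h \<le> i" "2 \<le> i"
  shows "levels_ok l T i W s"
  unfolding levels_ok_def
proof (intro conjI allI impI)
  fix j v assume "i \<le> j \<and> j \<le> q \<and> v \<in> lev s (j + 1) - lev s j"
  then show "blk s v \<noteq> {}" "\<forall>u\<in>blk s v. u \<in> undiscovered (if v \<in> W then l - 1 else l) \<and>
      precedes xs u v \<and> {u, v} \<in> Es j"
    using levels_okD(3,4)[OF ok, of j v] assms(2) by (simp, meson DiffE le_trans)
qed (use levels_okD[OF ok] assms(2,3) in auto)

text \<open>The recorded time of a level is raised to l only when its own turn comes, from the top
  level downwards. The cost is stated with the old times T throughout; older times give larger
  candidate sets, so this is an upper bound.\<close>

lemma levels_ok_rebuilds: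
  fixes p :: real
  assumes "levels_ok l (\<lambda>j. if i < j \<and> rebuild_due p l j then l else T j) 1 {} s" "i \<le> q" "\<And>j. T j \<le> l"
  shows "levels_ok l (\<lambda>j. if 0 < j \<and> rebuild_due p l j then l else T j) 1 {} (result ans
      (for_each (rev [1..<i + 1]) (\<lambda>i s. if rebuild_due p l i then build_down c Es i s else Return s) s)) \<and>
    cost ans (for_each (rev [1..<i + 1]) (\<lambda>i s. if rebuild_due p l i then build_down c Es i s else Return s) s) \<le>
      (\<Sum>i\<in>{1..i}. if rebuild_due p l i then \<Sum>j=1..i. build_cost l T j else 0)"
  using assms(1,2)
proof (induction i arbitrary: s)
  case 0
  then show ?case by simp
next
  case (Suc i)
  let ?T = "\<lambda>i j. if i < j \<and> rebuild_due p l j then l else T j"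
  let ?f = "\<lambda>i s. if rebuild_due p l i then build_down c Es i s else Return s"
  let ?s = "result ans (?f (Suc i) s)"
  have 1: "levels_ok l (?T i) 1 {} ?s \<and> cost ans (?f (Suc i) s) \<le>
    (if rebuild_due p l (Suc i) then \<Sum>j=1..Suc i. build_cost l T j else 0)"
  proof (cases "rebuild_due p l (Suc i)")
    case False
    then have "?T i = ?T (Suc i)" by (auto simp: fun_eq_iff) (metis Suc_lessI)
    then show ?thesis using Suc.prems False by simp
  next
    case True
    \<comment> \<open>Once level \<open>Suc i\<close> and those below are forgotten, the invariant
      does not see their recorded times, so the time of level \<open>Suc i\<close> may be set to l
      before the rebuild.\<close>
    have "levels_ok l (?T (Suc i)) (Suc i + 1) {} s"
      by (rule levels_ok_weaken[OF Suc.prems(1)]) auto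
    then have "levels_ok l (?T i) (Suc i + 1) {} s" by (rule levels_ok_cong) auto
    then have "levels_ok l (?T i) 1 {} (result ans (build_down c Es (Suc i) s)) \<and>
      cost ans (build_down c Es (Suc i) s) \<le> (\<Sum>j=1..Suc i. build_cost l (?T i) j)"
      by (rule levels_ok_build_down) (use Suc.prems assms(3) in auto)
    moreover have "(\<Sum>j=1..Suc i. build_cost l (?T i) j) \<le> (\<Sum>j=1..Suc i. build_cost l T j)"
      by (intro sum_mono build_cost_antimono) (use assms(3) in auto)
    ultimately show ?thesis using True by auto
  qed
  have IH: "levels_ok l (?T 0) 1 {} (result ans (for_each (rev [1..<i + 1]) ?f ?s)) \<and>
    cost ans (for_each (rev [1..<i + 1]) ?f ?s) \<le>
      (\<Sum>i\<in>{1..i}. if rebuild_due p l i then \<Sum>j=1..i. build_cost l T j else 0)"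
    using Suc.IH[of ?s] 1 Suc.prems by simp
  have "run ans (for_each (rev [1..<Suc i + 1]) ?f s) = (result ans (for_each (rev [1..<i + 1]) ?f ?s),
     cost ans (?f (Suc i) s) + cost ans (for_each (rev [1..<i + 1]) ?f ?s))"
    by (simp add: run_bind)
  then show ?case using IH 1 by simp
qed


text \<open>Promoting v changes the levels only by inserting v, and v is not its own neighbour. All
  checks can thus be evaluated in the initial state. The witness \<open>j'\<close> is the level
  whose check blocks v again, or 0 if v reaches \<open>L_1\<close>; the check at \<open>j'\<close>
  itself is paid for, hence the sum from \<open>max 1 j'\<close>.\<close>

lemma run_promote:
  assumes "\<And>i. 1 \<le> i \<Longrightarrow> finite (lev s i)"
  shows "\<exists>j'\<le>j. lev (result ans (promote c Es v j s)) =
       (\<lambda>i. if j' < i \<and> i \<le> j then insert v (lev s i) else lev s i) \<and>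
     (\<forall>i. j' < i \<and> i \<le> j \<longrightarrow> blocking i v s = {}) \<and>
     (0 < j' \<longrightarrow> blocking j' v s \<noteq> {}) \<and>
     (0 < j \<longrightarrow> blk (result ans (promote c Es v j s)) =
        (blk s)(v := if j' = 0 then {} else blocking j' v s)) \<and>
     cost ans (promote c Es v j s) \<le> (\<Sum>i=max 1 j'..j. card (all_edges c Es i v s))"
  using assms
proof (induction j arbitrary: s)
  case 0
  have "lev s = (\<lambda>i. if 0 < i \<and> i \<le> 0 then insert v (lev s i) else lev s i)" by (auto simp: fun_eq_iff)
  then show ?case by (intro exI[of _ 0]) auto
next
  case (Suc j)
  let ?B = "blocking (Suc j) v s"
  let ?k = "card (all_edges c Es (Suc j) v s)"
  have rb: "run ans (blockers c Es (Suc j) v s) = (?B, ?k)"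
    using run_blockers[of s "Suc j" c ans Es v] Suc.prems by (simp add: blocking_def)
  show ?case
  proof (cases "?B = {}")
    case False
    have "lev s = (\<lambda>i. if Suc j < i \<and> i \<le> Suc j then insert v (lev s i) else lev s i)"
      by (auto simp: fun_eq_iff)
    with False show ?thesis
      by (intro exI[of _ "Suc j"]) (auto simp: run_bind rb block_def)
  next
    case True
    let ?s = "enter (Suc j) v s"
    have ae: "all_edges c Es i v ?s = all_edges c Es i v s" for i
      using edge_not_singleton by (auto simp: all_edges_def enter_def)
    then have bl: "blocking i v ?s = blocking i v s" for i by (simp add: blocking_def)
    have "finite (lev ?s i)" if "1 \<le> i" for i using that Suc.prems by (auto simp: enter_def)
    from Suc.IH[of ?s, OF this] obtain j' where j': "j' \<le> j"
      "lev (result ans (promote c Es v j ?s)) =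
         (\<lambda>i. if j' < i \<and> i \<le> j then insert v (lev ?s i) else lev ?s i)"
      "\<forall>i. j' < i \<and> i \<le> j \<longrightarrow> blocking i v s = {}"
      "0 < j' \<longrightarrow> blocking j' v s \<noteq> {}"
      "0 < j \<longrightarrow> blk (result ans (promote c Es v j ?s)) =
        (blk ?s)(v := if j' = 0 then {} else blocking j' v s)"
      "cost ans (promote c Es v j ?s) \<le> (\<Sum>i=max 1 j'..j. card (all_edges c Es i v s))"
      unfolding bl ae by blast
    have pr: "run ans (promote c Es v (Suc j) s) =
      (result ans (promote c Es v j ?s), ?k + cost ans (promote c Es v j ?s))"
      using True by (simp add: run_bind rb)
    have "blk (result ans (promote c Es v j ?s)) = (blk s)(v := if j' = 0 then {} else blocking j' v s)"
      using j'(1,5) by (cases "j = 0") (auto simp: enter_def)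
    moreover have "lev (result ans (promote c Es v j ?s)) =
         (\<lambda>i. if j' < i \<and> i \<le> Suc j then insert v (lev s i) else lev s i)"
      using j'(1) unfolding j'(2) by (auto simp: enter_def fun_eq_iff)
    moreover have "\<forall>i. j' < i \<and> i \<le> Suc j \<longrightarrow> blocking i v s = {}"
      using j'(3) True by (metis le_Suc_eq)
    moreover have "?k + cost ans (promote c Es v j ?s) \<le>
      (\<Sum>i=max 1 j'..Suc j. card (all_edges c Es i v s))"
      using j'(1,6) by simp
    ultimately show ?thesis using j'(1,4) unfolding pr fst_conv snd_conv
      by (intro exI[of _ j']) auto
  qed
qed

text \<open>If v was blocked by the vertex just discovered, at position l - 1, the blocking edge
  lies in some \<open>E_j\<close>, and the levels checked are among 1 to j. Seen from level i, the
  check is charged only if that edge has a label j at least i.\<close>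

definition promote_cost :: "nat \<Rightarrow> (nat \<Rightarrow> nat) \<Rightarrow> nat \<Rightarrow> nat" where
  "promote_cost l T v = (\<Sum>i=1..q.
     if v \<in> cand l T (i + 1) \<and> (\<exists>j\<in>{i..q}. {xs ! (l - 1), v} \<in> Es j)
     then card {u \<in> cand l T (i + c). {u, v} \<in> Es i} else 0)"

lemma levels_ok_promote:
  assumes ok: "levels_ok l T 1 W s" and vW: "v \<in> W" and x: "xs ! (l - 1) \<in> blk s v"
    and v: "v \<in> undiscovered l" and T: "\<And>j. T j \<le> l - 1"
  defines "j \<equiv> (THE j. 1 \<le> j \<and> v \<in> lev s (j + 1) - lev s j)"
  defines "s' \<equiv> result ans (promote c Es v j s)"
  shows "levels_ok l T 1 (W - {v}) s'" "\<And>w. w \<noteq> v \<Longrightarrow> blk s' w = blk s w"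
    "cost ans (promote c Es v j s) \<le> promote_cost l T v"
proof -
  have "v \<notin> lev s 1" using levels_okD(6)[OF ok] x by auto
  from blocked_level[OF ok _ _ v this] obtain k where
    k: "1 \<le> k" "k \<le> q" "v \<in> lev s (k + 1)" "v \<notin> lev s k" by auto
  \<comment> \<open>The levels increase, so v enters the chain at exactly one place, which the
    definite description picks.\<close>
  have uniq: "k' = k" if "1 \<le> k'" "v \<in> lev s (k' + 1) - lev s k'" for k'
  proof (rule ccontr)
    assume "k' \<noteq> k"
    have "k' \<le> q"
    proof (rule ccontr)
      assume "\<not> k' \<le> q"
      then show False using levels_okD(1)[OF ok, of k'] v that by simp
    qed
    then show False using \<open>k' \<noteq> k\<close> levels_ok_mono_level[OF ok, of "k' + 1" k]
      levels_ok_mono_level[OF ok, of "k + 1" k'] that k by (cases "k' < k") auto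
  qed
  have "1 \<le> k \<and> v \<in> lev s (k + 1) - lev s k" using k by blast
  then have "j = k" unfolding j_def by (rule the_equality) (use uniq in blast)
  then have j: "1 \<le> j" "j \<le> q" "v \<in> lev s (j + 1)" "v \<notin> lev s j" using k by auto
  have fin: "\<And>i. 1 \<le> i \<Longrightarrow> finite (lev s i)" using levels_ok_finite[OF ok] by simp
  obtain j' where j': "j' \<le> j"
      and lev': "lev s' = (\<lambda>i. if j' < i \<and> i \<le> j then insert v (lev s i) else lev s i)"
      and nb': "\<forall>i. j' < i \<and> i \<le> j \<longrightarrow> blocking i v s = {}"
      and bl': "0 < j' \<longrightarrow> blocking j' v s \<noteq> {}"
      and blk': "0 < j \<longrightarrow> blk s' = (blk s)(v := if j' = 0 then {} else blocking j' v s)"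
      and cost: "cost ans (promote c Es v j s) \<le> (\<Sum>i=max 1 j'..j. card (all_edges c Es i v s))"
    using run_promote[of s j v, OF fin] unfolding s'_def by blast
  have lev: "\<And>i. lev s' i = (if j' < i \<and> i \<le> j then insert v (lev s i) else lev s i)"
    using lev' by simp
  have nb: "\<And>i. j' < i \<Longrightarrow> i \<le> j \<Longrightarrow> blocking i v s = {}" using nb' by blast
  have bl: "0 < j' \<Longrightarrow> blocking j' v s \<noteq> {}" using bl' by blast
  have blk: "blk s' = (blk s)(v := if j' = 0 then {} else blocking j' v s)" using blk' j(1) by simp
  have low: "v \<notin> lev s i" if "1 \<le> i" "i \<le> j" for i
    using levels_ok_mono_level[OF ok that] j by auto
  have high: "v \<in> lev s i" if "j < i" for i
  proof (cases "i \<le> q")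
    case True
    then show ?thesis using levels_ok_mono_level[OF ok, of "j + 1" i] that j by auto
  next
    case False
    then show ?thesis using levels_okD(1)[OF ok, of i] v by auto
  qed
  have v_lev: "v \<in> lev s' i \<longleftrightarrow> j' < i" if "1 \<le> i" for i
    using low[OF that] high[of i] j' unfolding lev by auto
  \<comment> \<open>Descending induction from j + 1: every check passed on the way down certifies
    candidacy for one more level.\<close>
  have v_cand: "j' < i \<Longrightarrow> i \<le> j + 1 \<Longrightarrow> v \<in> cand l T i" for i
  proof (induction "j + 1 - i" arbitrary: i)
    case 0
    then show ?case using j levels_okD(5)[OF ok, of "j + 1"] by (auto simp: le_antisym)
  next
    case (Suc d)
    have T': "T i \<le> l" "T i \<le> l - 1" using T[of i] by auto
    show ?case
      by (rule unblocked_cand[OF ok _ _ T']) (use Suc.hyps Suc.prems c_pos j nb in auto)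
  qed
  show "levels_ok l T 1 (W - {v}) s'"
    unfolding levels_ok_def
  proof (intro conjI allI impI)
    fix i assume "i > q"
    then show "lev s' i = undiscovered l" using levels_okD(1)[OF ok, of i] j unfolding lev by auto
  next
    fix i assume i: "1 \<le> i \<and> i \<le> q"
    then show "lev s' i \<subseteq> lev s' (i + 1)"
      using levels_okD(2)[OF ok, of i] v_lev[of "i + 1"] unfolding lev by auto
  next
    fix i w assume i: "1 \<le> i \<and> i \<le> q \<and> w \<in> lev s' (i + 1) - lev s' i"
    have "blk s' w \<noteq> {} \<and> (\<forall>u\<in>blk s' w. u \<in> undiscovered (if w \<in> W - {v} then l - 1 else l) \<and>
       precedes xs u w \<and> {u, w} \<in> Es i)"
    proof (cases "w = v")
      case True
      \<comment> \<open>The new blockers of v are in \<open>L_(j'+c)\<close>, which contains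
        undiscovered vertices only; so v meets the strict form of the invariant and leaves
        W.\<close>
      then have "i = j'" using i v_lev[of i] v_lev[of "i + 1"] by auto
      then have "0 < j'" using i by simp
      have "lev s (j' + c) \<subseteq> undiscovered l" using levels_okD(5)[OF ok, of "j' + c"] cand_subset c_pos by fastforce
      then show ?thesis using True \<open>i = j'\<close> bl[OF \<open>0 < j'\<close>] \<open>0 < j'\<close>
        unfolding blk blocking_def all_edges_def answer_def by auto
    next
      case False
      then have w: "w \<in> lev s (i + 1)" "w \<notin> lev s i" using i unfolding lev by (auto split: if_splits)
      show ?thesis using levels_okD(3,4)[OF ok _ _ w] i False unfolding blk by simp
    qed
    then show "blk s' w \<noteq> {}" "\<forall>u\<in>blk s' w. u \<in> undiscovered (if w \<in> W - {v} then l - 1 else l) \<and>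
       precedes xs u w \<and> {u, w} \<in> Es i" by auto
  next
    fix i :: nat assume "1 \<le> i"
    then show "lev s' i \<subseteq> cand l T i" using levels_okD(5)[OF ok, of i] v_cand[of i] unfolding lev by auto
  next
    show "\<forall>w\<in>lev s' 1. blk s' w = {}"
      using levels_okD(6)[OF ok] v_lev[of 1] unfolding blk lev by auto
  qed
  show "blk s' w = blk s w" if "w \<noteq> v" for w using that unfolding blk by simp
  have xj: "{xs ! (l - 1), v} \<in> Es j" using levels_okD(4)[OF ok j x] by simp
  note cost
  also have "(\<Sum>i=max 1 j'..j. card (all_edges c Es i v s)) \<le>
    (\<Sum>i=max 1 j'..j. if v \<in> cand l T (i + 1) \<and> (\<exists>j\<in>{i..q}. {xs ! (l - 1), v} \<in> Es j)
     then card {u \<in> cand l T (i + c). {u, v} \<in> Es i} else 0)"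
  proof (rule sum_mono)
    fix i assume i: "i \<in> {max 1 j'..j}"
    then have "v \<in> cand l T (i + 1)" using v_cand[of "i + 1"] by auto
    moreover have "\<exists>j\<in>{i..q}. {xs ! (l - 1), v} \<in> Es j" using xj i j by auto
    ultimately show "card (all_edges c Es i v s) \<le>
       (if v \<in> cand l T (i + 1) \<and> (\<exists>j\<in>{i..q}. {xs ! (l - 1), v} \<in> Es j)
       then card {u \<in> cand l T (i + c). {u, v} \<in> Es i} else 0)"
      using all_edges_cand[OF ok, of i v] c_pos by simp
  qed
  also have "\<dots> \<le> promote_cost l T v"
    unfolding promote_cost_def by (rule sum_mono2) (use j in auto)
  finally show "cost ans (promote c Es v j s) \<le> promote_cost l T v" .
qed

text \<open>Removing the discovered vertex invalidates exactly the blockings through it. The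
  vertices concerned become the set W, for which position l is still tolerated as a blocker.\<close>

lemma levels_ok_remove:
  assumes ok: "levels_ok l T 1 {} s" and l: "l < n"
  defines "s0 \<equiv> remove_vertex (xs ! l) s"
  shows "levels_ok (Suc l) T 1 {v \<in> lev s0 (q + 1). xs ! l \<in> blk s0 v} s0"
  unfolding levels_ok_def
proof (intro conjI allI impI)
  let ?W = "{v \<in> lev s0 (q + 1). xs ! l \<in> blk s0 v}"
  have lev: "lev s0 i = lev s i - {xs ! l}" and blk: "blk s0 = blk s" for i
    by (auto simp: s0_def remove_vertex_def)
  show "lev s0 i = undiscovered (Suc l)" if "i > q" for i
    using levels_okD(1)[OF ok that] undiscovered_Suc[OF l] by (simp add: lev)
  show "lev s0 i \<subseteq> lev s0 (i + 1)" if "1 \<le> i \<and> i \<le> q" for i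
    using levels_okD(2)[OF ok, of i] that by (auto simp: lev)
  {
    fix i v assume i: "1 \<le> i \<and> i \<le> q \<and> v \<in> lev s0 (i + 1) - lev s0 i"
    then have v: "v \<in> lev s (i + 1)" "v \<notin> lev s i" "v \<noteq> xs ! l" by (auto simp: lev)
    have "v \<in> lev s (q + 1)" using levels_ok_mono_level[OF ok, of "i + 1" "q + 1"] i v by auto
    then have *: "xs ! l \<notin> blk s v" if "v \<notin> ?W" using that v by (auto simp: lev blk)
    from levels_okD(3,4)[OF ok _ _ v(1,2)] i
    have b: "blk s v \<noteq> {}" "\<And>u. u \<in> blk s v \<Longrightarrow> u \<in> undiscovered l \<and> precedes xs u v \<and> {u, v} \<in> Es i"
      by auto
    then show "blk s0 v \<noteq> {}" by (simp add: blk)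
    show "\<forall>u\<in>blk s0 v. u \<in> undiscovered (if v \<in> ?W then Suc l - 1 else Suc l) \<and>
       precedes xs u v \<and> {u, v} \<in> Es i"
      using b * undiscovered_Suc[OF l] by (cases "v \<in> ?W") (auto simp: blk)
  }
  show "lev s0 i \<subseteq> cand (Suc l) T i" if "1 \<le> i" for i
  proof
    fix v assume "v \<in> lev s0 i"
    then have v: "v \<in> cand l T i" "v \<noteq> xs ! l" using levels_okD(5)[OF ok that] by (auto simp: lev)
    then obtain k where k: "k \<in> candidates n q c r l T i" "v = xs ! k" unfolding cand_def by blast
    then have "k \<noteq> l" using v by auto
    then have "k \<in> candidates n q c r (Suc l) T i" using k unfolding candidates_def by auto
    then show "v \<in> cand (Suc l) T i" unfolding cand_def k by blast
  qed
  show "\<forall>v\<in>lev s0 1. blk s0 v = {}" using levels_okD(6)[OF ok] by (auto simp: lev blk)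
qed

text \<open>The loop invariant also records that every vertex still waiting is blocked by the
  discovered one. Promoting a vertex leaves the blockings of all others alone, so this survives each
  step.\<close>

lemma levels_ok_incremental:
  assumes ok: "levels_ok l T 1 {} s" and l: "l < n" and T: "\<And>j. T j \<le> l"
  defines "A \<equiv> incremental_updates q c Es (xs ! l) (remove_vertex (xs ! l) s)"
  shows "levels_ok (Suc l) T 1 {} (result ans A) \<and>
    cost ans A \<le> (\<Sum>v\<in>undiscovered (Suc l). promote_cost (Suc l) T v)"
proof -
  let ?s0 = "remove_vertex (xs ! l) s"
  let ?W = "{v \<in> lev ?s0 (q + 1). xs ! l \<in> blk ?s0 v}"
  let ?vs = "sorted_list_of_set ?W"
  let ?f = "\<lambda>v s. promote c Es v (THE j. 1 \<le> j \<and> v \<in> lev s (j + 1) - lev s j) s"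
  note ok0 = levels_ok_remove[OF ok l]
  have WU: "?W \<subseteq> undiscovered (Suc l)" using levels_okD(1)[OF ok0, of "q + 1"] by auto
  then have fin: "finite ?W" using finite_undiscovered finite_subset by blast
  define I where "I ys s' \<longleftrightarrow> levels_ok (Suc l) T 1 (?W - set ys) s' \<and>
    (\<forall>v\<in>?W - set ys. xs ! l \<in> blk s' v)" for ys and s' :: state
  have step: "I (ys @ [y]) (result ans (?f y s')) \<and> cost ans (?f y s') \<le> promote_cost (Suc l) T y"
    if vs: "?vs = ys @ y # zs" and I: "I ys s'" for ys y zs s'
  proof -
    have "distinct (ys @ y # zs)" unfolding vs[symmetric] by simp
    moreover have "y \<in> ?W" using fin arg_cong[OF vs, of set] by auto
    ultimately have y: "y \<in> ?W - set ys" by auto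
    then have x: "xs ! (Suc l - 1) \<in> blk s' y" using I unfolding I_def by simp
    have yU: "y \<in> undiscovered (Suc l)" using y WU by blast
    have ok': "levels_ok (Suc l) T 1 (?W - set ys) s'" using I unfolding I_def by simp
    have T': "T j \<le> Suc l - 1" for j using T by simp
    note pr = levels_ok_promote[OF ok' y x yU T']
    have "?W - set ys - {y} = ?W - set (ys @ [y])" by auto
    with pr(1) have 1: "levels_ok (Suc l) T 1 (?W - set (ys @ [y])) (result ans (?f y s'))" by (simp only:)
    have "xs ! l \<in> blk (result ans (?f y s')) v" if "v \<in> ?W - set (ys @ [y])" for v
    proof -
      have "v \<noteq> y" "v \<in> ?W - set ys" using that by auto
      then show ?thesis using pr(2) I unfolding I_def by metis
    qed
    with 1 pr(3) show ?thesis unfolding I_def by blast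
  qed
  have I0: "I [] ?s0" using ok0 unfolding I_def by auto
  have "I ?vs (result ans (for_each ?vs ?f ?s0)) \<and> cost ans (for_each ?vs ?f ?s0) \<le>
    sum_list (map (promote_cost (Suc l) T) ?vs)"
    by (rule for_each_invariant[where I = I, OF step I0])
  then have "I ?vs (result ans A)" "cost ans A \<le> sum_list (map (promote_cost (Suc l) T) ?vs)"
    unfolding A_def incremental_updates_def by auto
  moreover have "sum_list (map (promote_cost (Suc l) T) ?vs) = (\<Sum>v\<in>?W. promote_cost (Suc l) T v)"
    using fin by (simp add: sum_list_distinct_conv_sum_set)
  moreover have "\<dots> \<le> (\<Sum>v\<in>undiscovered (Suc l). promote_cost (Suc l) T v)"
    by (rule sum_mono2[OF finite_undiscovered WU]) simp
  ultimately show ?thesis using fin unfolding I_def by simp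
qed

end

section \<open>Searching for the next vertex, the first vertex, and a complete run\<close>

lemma upt_split:
  assumes "[a..<b] = ys @ i # zs"
  shows "i = a + length ys" "i < b"
proof -
  have l: "length ys < b - a" using arg_cong[OF assms, of length] by (simp del: upt_Suc)
  have "[a..<b] ! length ys = i" unfolding assms by simp
  then show "i = a + length ys" using l by (simp del: upt_Suc)
  then show "i < b" using l by simp
qed

definition position_build_cost ::
    "nat \<Rightarrow> nat \<Rightarrow> nat \<Rightarrow> (nat \<Rightarrow> nat \<Rightarrow> nat \<Rightarrow> bool) \<Rightarrow> nat \<Rightarrow> (nat \<Rightarrow> nat) \<Rightarrow> nat \<Rightarrow> nat" where
  "position_build_cost n q c r l T i =
     (\<Sum>v\<in>candidates n q c r l T (i + 1). card {u \<in> candidates n q c r l T (i + c). r u v i})"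

definition position_update_cost ::
    "nat \<Rightarrow> nat \<Rightarrow> nat \<Rightarrow> (nat \<Rightarrow> nat \<Rightarrow> nat \<Rightarrow> bool) \<Rightarrow> nat \<Rightarrow> (nat \<Rightarrow> nat) \<Rightarrow> nat \<Rightarrow> nat" where
  "position_update_cost n q c r l T i =
     (\<Sum>v\<in>candidates n q c r l T (i + 1). if \<exists>j\<in>{i..q}. r (l - 1) v j
        then card {u \<in> candidates n q c r l T (i + c). r u v i} else 0)"

text \<open>Superset of the rivals of position l that are left in C when round i starts. Round i - 1
  has removed every rival with an edge to an earlier vertex of \<open>L_(i-1)\<close>, in particular
  to one that is robust from the current time l; before the first round nothing has been removed,
  hence the guard on i.\<close>

definition position_survivors ::
    "nat \<Rightarrow> nat \<Rightarrow> nat \<Rightarrow> (nat \<Rightarrow> nat \<Rightarrow> nat \<Rightarrow> bool) \<Rightarrow> (nat \<Rightarrow> nat \<Rightarrow> bool) \<Rightarrow> nat \<Rightarrow>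
     (nat \<Rightarrow> nat) \<Rightarrow> nat \<Rightarrow> nat set" where
  "position_survivors n q c r e l T i = {w \<in> candidates n q c r l T 1. e (l - 1) w \<and> w \<noteq> l \<and>
     (2 \<le> i \<longrightarrow> (\<forall>k. l \<le> k \<and> k < w \<and> e k w \<longrightarrow> \<not> robust q r (i - 1) l k))}"

definition position_round_cost ::
    "nat \<Rightarrow> nat \<Rightarrow> nat \<Rightarrow> (nat \<Rightarrow> nat \<Rightarrow> nat \<Rightarrow> bool) \<Rightarrow> (nat \<Rightarrow> nat \<Rightarrow> bool) \<Rightarrow> nat \<Rightarrow>
     (nat \<Rightarrow> nat) \<Rightarrow> nat \<Rightarrow> nat" where
  "position_round_cost n q c r e l T i = (\<Sum>w\<in>position_survivors n q c r e l T i.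
     card {u \<in> candidates n q c r l T i. e u w} + card {u \<in> candidates n q c r l T i. e u l})"

context sorting_instance
begin

lemma levels_ok_older:
  assumes ok: "levels_ok l T' h W s" and "\<And>j. T j \<le> T' j"
  shows "levels_ok l T h W s"
proof -
  have "cand l T' i \<subseteq> cand l T i" for i using cand_antimono_time[OF assms(2)] .
  then have "\<forall>i\<ge>h. lev s i \<subseteq> cand l T i" using levels_okD(5)[OF ok] by blast
  then show ?thesis using ok unfolding levels_ok_def by (elim conjE) (intro conjI; assumption)
qed

lemma edge_precedes:
  assumes "{u, v} \<in> E"
  shows "precedes xs u v \<or> precedes xs v u"
proof -
  have "u \<in> set xs" "v \<in> set xs" "u \<noteq> v" using edge_in_range[OF assms] set_xs by auto
  then obtain a b where "u = xs ! a" "v = xs ! b" "a < n" "b < n" "a \<noteq> b"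
    unfolding in_set_conv_nth length_xs by blast
  then show ?thesis using precedes_nth by (metis linorder_neqE_nat)
qed

lemma precedes_trans:
  assumes "precedes xs u v" "precedes xs v w"
  shows "precedes xs u w"
proof -
  obtain a b where ab: "a < b" "b < n" "u = xs ! a" "v = xs ! b" using precedesE[OF assms(1)] .
  obtain b' d where bd: "b' < d" "d < n" "v = xs ! b'" "w = xs ! d" using precedesE[OF assms(2)] .
  have "b = b'" using ab bd nth_eq[of b b'] by simp
  then show ?thesis using ab bd precedes_nth[of a d] by simp
qed

lemma precedes_irrefl: "\<not> precedes xs u u"
proof
  assume "precedes xs u u"
  then obtain a b where "a < b" "b < n" "u = xs ! a" "u = xs ! b" by (rule precedesE)
  then show False using nth_eq[of a b] by simp
qed

definition survivors :: "nat \<Rightarrow> (nat \<Rightarrow> nat) \<Rightarrow> nat \<Rightarrow> nat set" where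
  "survivors l T i = {w \<in> cand l T 1. {xs ! (l - 1), w} \<in> E \<and> w \<noteq> xs ! l \<and>
     (2 \<le> i \<longrightarrow> (\<forall>k. l \<le> k \<and> k < n \<and> precedes xs (xs ! k) w \<and> {xs ! k, w} \<in> E
        \<longrightarrow> \<not> robust q r (i - 1) l k))}"

text \<open>The second summand pays for the queries at the true successor. It is charged to each
  survivor: a round takes place only while at least one rival is left.\<close>

definition round_cost :: "nat \<Rightarrow> (nat \<Rightarrow> nat) \<Rightarrow> nat \<Rightarrow> nat" where
  "round_cost l T i = (\<Sum>w\<in>survivors l T i.
     card {u \<in> cand l T i. {u, w} \<in> E} + card {u \<in> cand l T i. {u, xs ! l} \<in> E})"

lemma finite_survivors: "finite (survivors l T i)"
  by (rule finite_subset[OF _ finite_cand[of l T 1]]) (auto simp: survivors_def)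

text \<open>The successor is never eliminated because no undiscovered vertex precedes it. Every
  rival is gone after round q + c: the last level holds all undiscovered vertices, among them the
  direct predecessor of the rival, and that pair is an edge.\<close>

lemma run_find_next:
  assumes ok: "levels_ok l T 1 {} s" and l: "1 \<le> l" "l < n"
  shows "result ans (find_next q c E (xs ! (l - 1)) s) = xs ! l \<and>
    cost ans (find_next q c E (xs ! (l - 1)) s) \<le> (\<Sum>i=1..q + c. round_cost l T i)"
proof -
  let ?x = "xs ! (l - 1)" and ?y = "xs ! l"
  let ?C0 = "{v \<in> lev s 1. {?x, v} \<in> E}"
  let ?f = "\<lambda>i C. if card C = 1 then Return C else eliminate E (lev s i) C"
  have finl: "finite (lev s i)" if "1 \<le> i" for i using levels_ok_finite[OF ok that] .
  \<comment> \<open>Robustness of position l from time l on is vacuous.\<close>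
  have y_lev: "?y \<in> lev s 1"
    by (rule robust_in_level[OF ok, of 1 l]) (use l in \<open>auto simp: robust_def\<close>)
  have y0: "?y \<in> ?C0" using y_lev consecutive_edge[of "l - 1"] l by auto
  have levU: "lev s i \<subseteq> undiscovered l" if "1 \<le> i" for i
    using levels_okD(5)[OF ok that] cand_subset by blast
  have y_first: "\<not> precedes xs u ?y" if "u \<in> undiscovered l" for u
  proof -
    obtain k where "u = xs ! k" "l \<le> k" "k < n" using \<open>u \<in> undiscovered l\<close> unfolding undiscovered_def by auto
    then show ?thesis using precedes_nth[of k l] l by simp
  qed
  have lev1: "lev s 1 \<subseteq> lev s i" if "1 \<le> i" for i
  proof (cases "i \<le> q")
    case True
    then show ?thesis using levels_ok_mono_level[OF ok _ that] by simp
  next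
    case False
    then show ?thesis using levels_okD(1)[OF ok, of i] levU[of 1] by simp
  qed
  define I where "I ys C \<longleftrightarrow> C \<subseteq> ?C0 \<and> ?y \<in> C \<and> (ys \<noteq> [] \<longrightarrow> (\<forall>w\<in>C. \<forall>u\<in>lev s (last ys). {u, w} \<in> E \<longrightarrow> \<not> precedes xs u w))"
    for ys C
  have step: "I (ys @ [i]) (result ans (?f i C)) \<and> cost ans (?f i C) \<le> round_cost l T i"
    if upt: "[1..<q + c + 1] = ys @ i # zs" and I: "I ys C" for ys i zs C
  proof -
    note i = upt_split[OF upt]
    have last: "last ys = i - 1" "ys \<noteq> []" if "2 \<le> i"
    proof -
      show ne: "ys \<noteq> []" using i that by auto
      have "butlast ys @ last ys # i # zs = [1..<q + c + 1]" using upt ne by simp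
      from upt_split(1)[OF this[symmetric]] show "last ys = i - 1" using i ne by (simp add: Suc_leI)
    qed
    have i1: "1 \<le> i" using i by simp
    have C: "C \<subseteq> ?C0" "?y \<in> C" using I unfolding I_def by auto
    then have finC: "finite C" using finl[of 1] finite_subset[of C "lev s 1"] by auto
    have CL: "C \<subseteq> lev s i" using C(1) lev1[OF i1] by blast
    show ?thesis
    proof (cases "card C = 1")
      case True
      \<comment> \<open>The round is skipped, yet the invariant advances since nothing undiscovered
        precedes the only vertex left.\<close>
      then have "C = {?y}" using C(2) by (metis card_1_singletonE singletonD)
      moreover have "\<not> precedes xs u ?y" if "u \<in> lev s i" for u using y_first levU[OF i1] that by blast
      ultimately have "I (ys @ [i]) C" using C unfolding I_def by simp
      then show ?thesis using True by simp
    next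
      case False
      let ?P = "{(u, v). v \<in> C \<and> u \<in> lev s i \<and> {u, v} \<in> E \<and> (u \<in> C \<longrightarrow> u < v)}"
      let ?g = "\<lambda>(u, v). if ans u v then v else u"
      note el = run_eliminate[OF finC finl[OF i1], of ans E]
      have asym: "\<not> precedes xs v u" if "precedes xs u v" for u v
        using that precedes_trans precedes_irrefl by blast
      have g: "?g (u, v) = w \<longleftrightarrow> (w = v \<and> precedes xs u v \<or> w = u \<and> precedes xs v u)"
        if "(u, v) \<in> ?P" for u v w
        using that edge_precedes[of u v] asym[of u v] asym[of v u] CL unfolding answer_def by auto
      have "?y \<notin> ?g ` ?P"
      proof
        assume "?y \<in> ?g ` ?P"
        then obtain e where "e \<in> ?P" "?g e = ?y" by (metis (no_types, lifting) imageE)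
        then obtain u v where uv: "(u, v) \<in> ?P" "?g (u, v) = ?y" by (cases e) blast
        have "precedes xs u ?y \<or> precedes xs v ?y" using iffD1[OF g[OF uv(1)] uv(2)] by auto
        moreover have "u \<in> undiscovered l" "v \<in> undiscovered l" using uv(1) levU[OF i1] CL by auto
        ultimately show False using y_first by blast
      qed
      moreover have "\<not> precedes xs u w" if "w \<in> C - ?g ` ?P" "u \<in> lev s i" "{u, w} \<in> E" for u w
      proof
        assume uw: "precedes xs u w"
        show False
        proof (cases "u \<in> C \<and> \<not> u < w")
          case False
          then have P: "(u, w) \<in> ?P" using that by auto
          have "?g (u, w) = w" by (rule iffD2[OF g[OF P]]) (use uw in simp)
          then have "w \<in> ?g ` ?P" using P by (intro image_eqI[of _ _ "(u, w)"]) simp_all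
          then show False using that(1) by simp
        next
          \<comment> \<open>Both endpoints are in C and the edge is listed in the other orientation,
            as (w, u); w still loses.\<close>
          case True
          then have P: "(w, u) \<in> ?P" using that CL edge_in_range[OF that(3)] by (auto simp: insert_commute)
          have "?g (w, u) = w" by (rule iffD2[OF g[OF P]]) (use uw in simp)
          then have "w \<in> ?g ` ?P" using P by (intro image_eqI[of _ _ "(w, u)"]) simp_all
          then show False using that(1) by simp
        qed
      qed
      ultimately have "I (ys @ [i]) (C - ?g ` ?P)" using C unfolding I_def by auto
      then have 1: "I (ys @ [i]) (result ans (?f i C))" using False el(1) by simp
      have surv: "C - {?y} \<subseteq> survivors l T i"
      proof
        fix w assume w: "w \<in> C - {?y}"
        have "\<not> robust q r (i - 1) l k"
          if "2 \<le> i" "l \<le> k" "k < n" "precedes xs (xs ! k) w" "{xs ! k, w} \<in> E" for k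
        proof
          assume "robust q r (i - 1) l k"
          then have "xs ! k \<in> lev s (i - 1)"
            by (intro robust_in_level[OF ok, of "i - 1" l]) (use that in auto)
          then show False using I w that last unfolding I_def by auto
        qed
        then show "w \<in> survivors l T i"
          using w C(1) levels_okD(5)[OF ok, of 1] unfolding survivors_def by auto
      qed
      have ne: "C - {?y} \<noteq> {}"
      proof
        assume "C - {?y} = {}"
        then have "C = {?y}" using C(2) by blast
        then show False using False by simp
      qed
      let ?h = "\<lambda>v. card {u \<in> cand l T i. {u, v} \<in> E}"
      have "cost ans (?f i C) \<le> (\<Sum>v\<in>C. card {u \<in> lev s i. {u, v} \<in> E})"
        using False el(2) by simp
      also have "\<dots> \<le> (\<Sum>v\<in>C. ?h v)"
        by (intro sum_mono card_mono) (use finite_cand levels_okD(5)[OF ok i1] in auto)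
      also have "\<dots> = ?h ?y + (\<Sum>v\<in>C - {?y}. ?h v)" using finC C(2) by (simp add: sum.remove)
      \<comment> \<open>At least one rival is present, so one copy of the cost at the successor is
        at most one copy per rival.\<close>
      also have "\<dots> \<le> (\<Sum>v\<in>C - {?y}. ?h ?y) + (\<Sum>v\<in>C - {?y}. ?h v)"
      proof -
        have "1 * ?h ?y \<le> card (C - {?y}) * ?h ?y"
          using ne finC by (intro mult_right_mono) (auto simp: Suc_le_eq card_gt_0_iff)
        then show ?thesis by simp
      qed
      also have "\<dots> = (\<Sum>v\<in>C - {?y}. ?h v + ?h ?y)" by (simp add: sum.distrib)
      also have "\<dots> \<le> round_cost l T i" unfolding round_cost_def
        by (rule sum_mono2[OF finite_survivors surv]) simp
      finally show ?thesis using 1 by simp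
    qed
  qed
  let ?is = "[1..<q + c + 1]"
  have I0: "I [] ?C0" using y0 unfolding I_def by simp
  have fin: "I ?is (result ans (for_each ?is ?f ?C0)) \<and>
    cost ans (for_each ?is ?f ?C0) \<le> sum_list (map (round_cost l T) ?is)"
    by (rule for_each_invariant[where I = I, OF step I0])
  define C where "C = result ans (for_each ?is ?f ?C0)"
  have "?is \<noteq> []" "last ?is = q + c" using q_pos by auto
  then have C: "C \<subseteq> ?C0" "?y \<in> C" "\<And>w u. w \<in> C \<Longrightarrow> u \<in> lev s (q + c) \<Longrightarrow> {u, w} \<in> E \<Longrightarrow> \<not> precedes xs u w"
    using conjunct1[OF fin] unfolding I_def C_def[symmetric] by (auto simp del: upt_Suc)
  have "w = ?y" if w: "w \<in> C" for w
  proof (rule ccontr)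
    assume "w \<noteq> ?y"
    have "w \<in> undiscovered l" using C(1) w levU[of 1] by auto
    then obtain k where k: "w = xs ! k" "l \<le> k" "k < n" unfolding undiscovered_def by auto
    with \<open>w \<noteq> ?y\<close> have "l < k" by (cases "k = l") auto
    then have "{xs ! (k - 1), w} \<in> E" using consecutive_edge[of "k - 1"] k by simp
    moreover have "xs ! (k - 1) \<in> lev s (q + c)"
      using levels_okD(1)[OF ok, of "q + c"] c_pos nth_in_undiscovered[of "k - 1" l] k \<open>l < k\<close> by simp
    moreover have "precedes xs (xs ! (k - 1)) w" using precedes_nth[of "k - 1" k] k \<open>l < k\<close> by simp
    ultimately show False using C(3) w by blast
  qed
  then have "C = {?y}" using C(2) by blast
  then have "result ans (find_next q c E ?x s) = ?y"
    unfolding find_next_def C_def by (simp add: run_bind del: upt_Suc)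
  moreover have "cost ans (find_next q c E ?x s) \<le> sum_list (map (round_cost l T) ?is)"
    using fin unfolding find_next_def by (simp add: run_bind del: upt_Suc)
  moreover have "sum_list (map (round_cost l T) ?is) = (\<Sum>i=1..q + c. round_cost l T i)"
  proof -
    have "sum_list (map (round_cost l T) ?is) = (\<Sum>i\<in>{1..<q + c + 1}. round_cost l T i)"
      by (simp only: interv_sum_list_conv_sum_set_nat set_upt)
    then show ?thesis by (simp add: atLeastLessThanSuc_atLeastAtMost)
  qed
  ultimately show ?thesis by simp
qed

text \<open>All of S comes after the current candidate, and S grows in every effective round. When
  no edge to a vertex outside S is left, the direct predecessor of the candidate would have to be in
  S, hence later than it; so there is no predecessor.\<close>

lemma run_find_first:
  assumes pick: "\<And>F. F \<noteq> {} \<Longrightarrow> pick F \<in> F"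
  shows "result ans (find_first pick n E) = xs ! 0 \<and> cost ans (find_first pick n E) \<le> n + 1"
proof -
  let ?F = "\<lambda>v0 S. {(u, v). v = v0 \<and> {u, v} \<in> E \<and> u \<notin> S}"
  let ?f = "\<lambda>_ (v0, S).
             let F = ?F v0 S in
             if F = {} then Return (v0, S)
             else let u = fst (pick F) in
               Query u v0 (\<lambda>b. Return (if b then (u, insert v0 S) else (v0, insert u S)))"
  define J where "J v0 S \<longleftrightarrow> v0 < n \<and> v0 \<notin> S \<and> S \<subseteq> {..<n} \<and> (\<forall>u\<in>S. precedes xs v0 u)" for v0 S
  have J_step: "J (if b then u else v) (insert (if b then v else u) S)"
    if "J v S" "{u, v} \<in> E" "b \<longleftrightarrow> precedes xs u v" for u v b S
  proof (cases b)
    case True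
    then have "precedes xs u v" using that by simp
    moreover have "u \<notin> S"
      using that(1) \<open>precedes xs u v\<close> precedes_trans precedes_irrefl unfolding J_def by blast
    ultimately show ?thesis using that edge_in_range[OF that(2)] precedes_trans True unfolding J_def by auto
  next
    case False
    then have "precedes xs v u" using edge_precedes[OF that(2)] that by simp
    then show ?thesis using that edge_in_range[OF that(2)] False unfolding J_def by auto
  qed
  \<comment> \<open>Either the loop has ended or S has more elements than rounds have passed; the
    initial query puts one vertex into S. After n rounds the second case would give S more than n
    elements.\<close>
  define I where "I ys vS \<longleftrightarrow> (case vS of (v0, S) \<Rightarrow> J v0 S \<and> (?F v0 S = {} \<or> length ys < card S))"
    for ys :: "nat list" and vS :: "nat \<times> nat set"
  have step: "I (ys @ [y]) (result ans (?f y vS)) \<and> cost ans (?f y vS) \<le> 1" if I: "I ys vS" for ys y vS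
  proof -
    obtain v0 S where vS: "vS = (v0, S)" by (cases vS)
    have J: "J v0 S" using I unfolding I_def vS by simp
    then have finS: "finite S" unfolding J_def using finite_subset by blast
    show ?thesis
    proof (cases "?F v0 S = {}")
      case True
      then show ?thesis using I unfolding I_def vS by simp
    next
      case False
      define u where "u = fst (pick (?F v0 S))"
      have u: "{u, v0} \<in> E" "u \<notin> S" using pick[OF False] unfolding u_def by auto
      have "v0 \<notin> S" using J unfolding J_def by simp
      have r: "result ans (?f y vS) = (if ans u v0 then (u, insert v0 S) else (v0, insert u S))"
        using False unfolding vS u_def Let_def by (simp only: prod.case if_False run.simps map_prod_def) simp
      have "card (insert (if ans u v0 then v0 else u) S) = Suc (card S)" using finS u \<open>v0 \<notin> S\<close> by simp
      moreover have "length ys < card S" using I False unfolding I_def vS prod.case by blast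
      moreover have "J (if ans u v0 then u else v0) (insert (if ans u v0 then v0 else u) S)"
        by (rule J_step[OF J u(1)]) (use u in \<open>simp add: answer_def\<close>)
      ultimately have "I (ys @ [y]) (result ans (?f y vS))"
        unfolding r I_def by (cases "ans u v0") auto
      moreover have "cost ans (?f y vS) \<le> 1" unfolding vS by (simp add: Let_def)
      ultimately show ?thesis by simp
    qed
  qed
  have "{(u, v). {u, v} \<in> E} \<noteq> {}" using consecutive_edge[of 0] n_ge_2 by auto
  from pick[OF this] obtain u v where uv: "pick {(u, v). {u, v} \<in> E} = (u, v)" "{u, v} \<in> E" by auto
  let ?i = "if ans u v then (u, {v}) else (v, {u})"
  have "v < n" using edge_in_range[OF uv(2)] by simp
  then have "J v {}" unfolding J_def by simp
  from J_step[OF this uv(2), of "ans u v"]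
  have "J (fst ?i) (snd ?i)" using uv(2) by (cases "ans u v") (auto simp: answer_def)
  then have I0: "I [] ?i" unfolding I_def by auto
  have fin: "I [0..<n] (result ans (for_each [0..<n] ?f ?i)) \<and> cost ans (for_each [0..<n] ?f ?i) \<le> sum_list (map (\<lambda>_. 1) [0..<n])"
    by (rule for_each_invariant[where I = I]) (rule step, assumption, rule I0)
  obtain v0 S where vS: "result ans (for_each [0..<n] ?f ?i) = (v0, S)" by fastforce
  have J: "J v0 S" and or: "?F v0 S = {} \<or> n < card S" using fin unfolding vS I_def by auto
  have "card S \<le> n" using J card_mono[of "{..<n}" S] unfolding J_def by auto
  then have F: "?F v0 S = {}" using or by auto
  have "v0 \<in> set xs" using J set_xs unfolding J_def by simp
  then obtain a where a: "v0 = xs ! a" "a < n" unfolding in_set_conv_nth length_xs by blast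
  have "a = 0"
  proof (rule ccontr)
    assume "a \<noteq> 0"
    then have "{xs ! (a - 1), v0} \<in> E" using consecutive_edge[of "a - 1"] a by simp
    then have "xs ! (a - 1) \<in> S" using F by auto
    then have "precedes xs (xs ! a) (xs ! (a - 1))" using J a(1) unfolding J_def by blast
    moreover have "a - 1 < n" using a by simp
    ultimately show False using precedes_nth[of a "a - 1"] a by simp
  qed
  have ff: "find_first pick n E = Query u v (\<lambda>b. do {
     (v0, S) \<leftarrow> for_each [0..<n] ?f (if b then (u, {v}) else (v, {u})); Return v0})"
    unfolding find_first_def uv(1) by simp
  have "sum_list (map (\<lambda>_. 1) [0..<n]) = n" by (simp add: sum_list_triv)
  then show ?thesis using fin vS a \<open>a = 0\<close> unfolding ff
    by (simp add: run_bind case_prod_beta del: upt_Suc)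
qed

definition step_cost :: "real \<Rightarrow> nat \<Rightarrow> nat" where
  "step_cost p l = (let T = last_rebuild p (l - 1) in
     (\<Sum>v\<in>undiscovered l. promote_cost l T v) +
     (\<Sum>i=1..q. if rebuild_due p l i then \<Sum>j=1..i. build_cost l T j else 0) +
     (\<Sum>i=1..q + c. round_cost l T i))"

lemma run_after_discovery:
  assumes ok: "levels_ok l (last_rebuild p l) 1 {} s" and l: "Suc l < n"
  defines "A \<equiv> after_discovery p q c Es (Suc l) (xs ! l) s"
  shows "levels_ok (Suc l) (last_rebuild p (Suc l)) 1 {} (result ans A) \<and>
    cost ans A \<le> (\<Sum>v\<in>undiscovered (Suc l). promote_cost (Suc l) (last_rebuild p l) v) +
     (\<Sum>i=1..q. if rebuild_due p (Suc l) i then \<Sum>j=1..i. build_cost (Suc l) (last_rebuild p l) j else 0)"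
proof -
  let ?T = "last_rebuild p l"
  let ?A1 = "incremental_updates q c Es (xs ! l) (remove_vertex (xs ! l) s)"
  let ?s = "result ans ?A1"
  let ?f = "\<lambda>i s. if rebuild_due p (Suc l) i then build_down c Es i s else Return s"
  let ?A2 = "for_each (rev [1..<q + 1]) ?f ?s"
  have 1: "levels_ok (Suc l) ?T 1 {} ?s \<and>
      cost ans ?A1 \<le> (\<Sum>v\<in>undiscovered (Suc l). promote_cost (Suc l) ?T v)"
    by (rule levels_ok_incremental[OF ok]) (use l last_rebuild_le in auto)
  have "levels_ok (Suc l) (\<lambda>j. if q < j \<and> rebuild_due p (Suc l) j then Suc l else ?T j) 1 {} ?s"
    by (rule levels_ok_cong[OF conjunct1[OF 1]]) auto
  then have 2: "levels_ok (Suc l) (\<lambda>j. if 0 < j \<and> rebuild_due p (Suc l) j then Suc l else ?T j) 1 {}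
      (result ans ?A2) \<and>
    cost ans ?A2 \<le> (\<Sum>i=1..q. if rebuild_due p (Suc l) i then \<Sum>j=1..i. build_cost (Suc l) ?T j else 0)"
    by (rule levels_ok_rebuilds) (use last_rebuild_le in \<open>auto intro: le_SucI\<close>)
  have "levels_ok (Suc l) (last_rebuild p (Suc l)) 1 {} (result ans ?A2)"
    by (rule levels_ok_cong[OF conjunct1[OF 2]]) auto
  moreover have "run ans A = (result ans ?A2, cost ans ?A1 + cost ans ?A2)"
    unfolding A_def after_discovery_def by (simp only: run_bind)
  ultimately show ?thesis using 1 2 by simp
qed

lemma initial_levels_ok: "levels_ok 0 T (q + 1) {} (initial_state n q)"
proof -
  have "cand 0 T i = undiscovered 0" if "q + 1 \<le> i" for i
    using candidates_beyond[of q i n c r 0 T] that unfolding cand_def undiscovered_def by simp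
  then show ?thesis using q_pos undiscovered_0 by (simp add: levels_ok_def initial_state_def)
qed

lemma run_discover:
  assumes pick: "\<And>F. F \<noteq> {} \<Longrightarrow> pick F \<in> F" and m: "1 \<le> m" "m \<le> n"
  shows "result ans (discover pick n p q c E Es m) = take m xs \<and>
    cost ans (discover pick n p q c E Es m) \<le>
      (\<Sum>j=1..q. build_cost 0 (\<lambda>_. 0) j) + (n + 1) + (\<Sum>l=1..<m. step_cost p l)"
proof -
  let ?A0 = "build_down c Es q (initial_state n q)"
  let ?f = "\<lambda>l (ys, s). do {
          s \<leftarrow> after_discovery p q c Es l (last ys) s;
          y \<leftarrow> find_next q c E (last ys) s;
          Return (ys @ [y], s) }"
  let ?s0 = "result ans ?A0"
  have 0: "levels_ok 0 (\<lambda>_. 0) 1 {} ?s0 \<and> cost ans ?A0 \<le> (\<Sum>j=1..q. build_cost 0 (\<lambda>_. 0) j)"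
    by (rule levels_ok_build_down[OF initial_levels_ok]) auto
  note ff = run_find_first[OF pick]
  define I where "I ls ys_s \<longleftrightarrow> (case ys_s of (ys, s) \<Rightarrow> ys = take (Suc (length ls)) xs \<and>
     levels_ok (length ls) (last_rebuild p (length ls)) 1 {} s)"
    for ls :: "nat list" and ys_s :: "nat list \<times> state"
  have step: "I (ls @ [l]) (result ans (?f l ys_s)) \<and> cost ans (?f l ys_s) \<le> step_cost p l"
    if upt: "[1..<m] = ls @ l # zs" and I: "I ls ys_s" for ls l zs ys_s
  proof -
    let ?k = "length ls"
    have l: "l = Suc ?k" and k: "?k < m - 1" using upt_split[OF upt] by auto
    obtain s where s: "ys_s = (take l xs, s)" "levels_ok ?k (last_rebuild p ?k) 1 {} s"
      using I unfolding I_def l by (cases ys_s) auto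
    have ln: "Suc ?k < n" using k m by simp
    have last: "last (take l xs) = xs ! ?k"
      using ln unfolding l by (simp add: take_Suc_conv_app_nth length_xs)
    let ?A = "after_discovery p q c Es l (xs ! ?k) s"
    note ad = run_after_discovery[OF s(2) ln, folded l]
    let ?s = "result ans ?A"
    \<comment> \<open>The times recorded after the rebuilds are set back to those before the step,
      so that a single function T bounds all costs of the step.\<close>
    have "levels_ok l (last_rebuild p ?k) 1 {} ?s"
      by (rule levels_ok_older[OF conjunct1[OF ad]]) (use last_rebuild_le[of p ?k] in \<open>auto simp: l intro: le_SucI\<close>)
    from run_find_next[OF this] have fn: "result ans (find_next q c E (xs ! ?k) ?s) = xs ! l"
      "cost ans (find_next q c E (xs ! ?k) ?s) \<le> (\<Sum>i=1..q + c. round_cost l (last_rebuild p ?k) i)"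
      using ln l by auto
    have "run ans (?f l ys_s) = ((take l xs @ [xs ! l], ?s), cost ans ?A + cost ans (find_next q c E (xs ! ?k) ?s))"
      unfolding s(1) by (simp add: run_bind last fn(1))
    moreover have "take l xs @ [xs ! l] = take (Suc l) xs"
      using ln l by (simp add: take_Suc_conv_app_nth length_xs)
    moreover have "l - 1 = ?k" "length (ls @ [l]) = l" using l by auto
    ultimately show ?thesis using ad fn(2) unfolding I_def step_cost_def Let_def
      by (simp only: fst_conv snd_conv prod.case) simp
  qed
  have "take (Suc 0) xs = [xs ! 0]" using n_ge_2 length_xs by (simp add: take_Suc_conv_app_nth)
  moreover have "levels_ok 0 (last_rebuild p 0) 1 {} ?s0"
    by (rule levels_ok_cong[OF conjunct1[OF 0]]) simp
  ultimately have I0: "I [] ([xs ! 0], ?s0)" unfolding I_def by simp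
  let ?B = "for_each [1..<m] ?f ([xs ! 0], ?s0)"
  have fin: "I [1..<m] (result ans ?B) \<and> cost ans ?B \<le> sum_list (map (step_cost p) [1..<m])"
    by (rule for_each_invariant[where I = I, OF step I0])
  have r: "run ans (discover pick n p q c E Es m) =
    (fst (result ans ?B), cost ans ?A0 + (cost ans (find_first pick n E) + cost ans ?B))"
    unfolding discover_def by (simp add: run_bind ff case_prod_beta)
  have "fst (result ans ?B) = take m xs"
    using fin m unfolding I_def by (auto simp: case_prod_beta)
  moreover have "sum_list (map (step_cost p) [1..<m]) = (\<Sum>l=1..<m. step_cost p l)"
    by (simp only: interv_sum_list_conv_sum_set_nat set_upt)
  ultimately show ?thesis using 0 ff fin unfolding r by simp
qed

section \<open>Translation of the costs from vertices to positions\<close>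

lemma card_vertices:
  assumes "A \<subseteq> {..<n}"
  shows "card {u \<in> (!) xs ` A. P u} = card {a \<in> A. P (xs ! a)}"
proof -
  have "{u \<in> (!) xs ` A. P u} = (!) xs ` {a \<in> A. P (xs ! a)}" by auto
  then show ?thesis using card_image[OF inj_nth, of "{a \<in> A. P (xs ! a)}"] assms by auto
qed

lemma candidates_lessThan: "candidates n q c r l T h \<subseteq> {..<n}"
  using candidates_subset by fastforce

lemma card_cand_edges:
  assumes "a < n"
  shows "card {u \<in> cand l T h. {u, xs ! a} \<in> Es i} = card {b \<in> candidates n q c r l T h. r b a i}"
    "card {u \<in> cand l T h. {u, xs ! a} \<in> E} = card {b \<in> candidates n q c r l T h. e b a}"
  unfolding cand_def card_vertices[OF candidates_lessThan]
  using candidates_lessThan[of l T h] assms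
  by (auto simp: r_def e_def subset_iff intro!: arg_cong[where f = card])

lemma sum_cand: "(\<Sum>v\<in>cand l T h. f v) = (\<Sum>a\<in>candidates n q c r l T h. f (xs ! a))"
  unfolding cand_def by (simp add: sum.reindex[OF inj_nth[OF candidates_lessThan]])

lemma build_cost_positions: "build_cost l T i = position_build_cost n q c r l T i"
  unfolding build_cost_def position_build_cost_def sum_cand
  by (intro sum.cong refl card_cand_edges) (use candidates_lessThan in auto)

lemma promote_cost_positions:
  assumes "1 \<le> l" "l < n"
  shows "(\<Sum>v\<in>undiscovered l. promote_cost l T v) = (\<Sum>i=1..q. position_update_cost n q c r l T i)"
proof -
  have "(\<Sum>v\<in>undiscovered l. if v \<in> cand l T (i + 1) \<and> (\<exists>j\<in>{i..q}. {xs ! (l - 1), v} \<in> Es j)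
     then card {u \<in> cand l T (i + c). {u, v} \<in> Es i} else 0) = position_update_cost n q c r l T i" (is "?a = _") for i
  proof -
    have "?a = (\<Sum>v\<in>cand l T (i + 1). if \<exists>j\<in>{i..q}. {xs ! (l - 1), v} \<in> Es j
       then card {u \<in> cand l T (i + c). {u, v} \<in> Es i} else 0)"
      by (rule sum.mono_neutral_cong_right[OF finite_undiscovered cand_subset]) auto
    also have "\<dots> = position_update_cost n q c r l T i"
      unfolding position_update_cost_def sum_cand
    proof (rule sum.cong[OF refl])
      fix a assume "a \<in> candidates n q c r l T (i + 1)"
      then have "a < n" using candidates_lessThan by auto
      then have "(\<exists>j\<in>{i..q}. {xs ! (l - 1), xs ! a} \<in> Es j) \<longleftrightarrow> (\<exists>j\<in>{i..q}. r (l - 1) a j)"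
        using assms unfolding r_def by auto
      then show "(if \<exists>j\<in>{i..q}. {xs ! (l - 1), xs ! a} \<in> Es j
        then card {u \<in> cand l T (i + c). {u, xs ! a} \<in> Es i} else 0) =
        (if \<exists>j\<in>{i..q}. r (l - 1) a j then card {u \<in> candidates n q c r l T (i + c). r u a i} else 0)"
        using card_cand_edges(1)[OF \<open>a < n\<close>] by simp
    qed
    finally show ?thesis .
  qed
  then show ?thesis unfolding promote_cost_def by (subst sum.swap) simp
qed

lemma round_cost_positions:
  assumes "1 \<le> l" "l < n"
  shows "round_cost l T i = position_round_cost n q c r e l T i"
proof -
  have surv: "survivors l T i = (!) xs ` position_survivors n q c r e l T i"
  proof -
    have "xs ! a \<in> survivors l T i \<longleftrightarrow> a \<in> position_survivors n q c r e l T i" if a: "a < n" for a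
    proof -
      have "(\<forall>k. l \<le> k \<and> k < n \<and> precedes xs (xs ! k) (xs ! a) \<and> {xs ! k, xs ! a} \<in> E \<longrightarrow> \<not> robust q r (i - 1) l k)
        \<longleftrightarrow> (\<forall>k. l \<le> k \<and> k < a \<and> e k a \<longrightarrow> \<not> robust q r (i - 1) l k)"
        using a precedes_nth unfolding e_def by (meson order.strict_trans)
      then show ?thesis using a assms nth_in_cand[OF a, of l T 1] nth_eq[of a l]
        unfolding survivors_def position_survivors_def by (auto simp: e_def)
    qed
    moreover have "survivors l T i \<subseteq> (!) xs ` {..<n}"
      using candidates_lessThan unfolding survivors_def cand_def by blast
    moreover have "position_survivors n q c r e l T i \<subseteq> {..<n}"
      using candidates_lessThan unfolding position_survivors_def by blast
    ultimately show ?thesis by blast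
  qed
  have sub: "position_survivors n q c r e l T i \<subseteq> {..<n}"
    using candidates_lessThan unfolding position_survivors_def by blast
  show ?thesis unfolding round_cost_def position_round_cost_def surv sum.reindex[OF inj_nth[OF sub]] o_def
    by (rule sum.cong[OF refl]) (use sub assms card_cand_edges(2) in auto)
qed

end

section \<open>Independence in finite products\<close>

text \<open>Plays the part of measurability with respect to the coordinates in D; disjoint sets D
  give independence under \<open>Pi_pmf\<close>.\<close>

definition depends_on :: "'a set \<Rightarrow> (('a \<Rightarrow> 'b) \<Rightarrow> bool) \<Rightarrow> bool" where
  "depends_on D P \<longleftrightarrow> (\<forall>f g. (\<forall>x\<in>D. f x = g x) \<longrightarrow> P f = P g)"

lemma depends_onI: "(\<And>f g. (\<And>x. x \<in> D \<Longrightarrow> f x = g x) \<Longrightarrow> P f \<Longrightarrow> P g) \<Longrightarrow> depends_on D P"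
  unfolding depends_on_def by metis

lemma depends_on_mono: "depends_on D P \<Longrightarrow> D \<subseteq> D' \<Longrightarrow> depends_on D' P"
  unfolding depends_on_def by blast

lemma depends_on_conj:
  "depends_on D P \<Longrightarrow> depends_on D' Q \<Longrightarrow> depends_on (D \<union> D') (\<lambda>f. P f \<and> Q f)"
  unfolding depends_on_def by blast

lemma depends_on_all:
  assumes "\<And>k. k \<in> W \<Longrightarrow> depends_on (D k) (P k)"
  shows "depends_on (\<Union>k\<in>W. D k) (\<lambda>f. \<forall>k\<in>W. P k f)"
  using assms unfolding depends_on_def by (metis UN_I)

text \<open>The product splits into independent factors over \<open>A \<inter> D\<close> and
  \<open>A - D\<close>. P reads the first factor and Q the second; coordinates outside A have the
  default value d in both.\<close>

lemma prob_Pi_pmf_conj: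
  assumes "finite A" "depends_on D P" "depends_on D' Q" "D \<inter> D' = {}"
  shows "measure_pmf.prob (Pi_pmf A d M) {f. P f \<and> Q f} =
    measure_pmf.prob (Pi_pmf A d M) {f. P f} * measure_pmf.prob (Pi_pmf A d M) {f. Q f}"
proof -
  let ?A1 = "A \<inter> D" and ?A2 = "A - D"
  let ?P1 = "Pi_pmf ?A1 d M" and ?P2 = "Pi_pmf ?A2 d M"
  let ?h = "\<lambda>(f, g) x. if x \<in> ?A1 then f x else g x"
  have fin: "finite ?A1" "finite ?A2" using assms(1) by auto
  have "A = ?A1 \<union> ?A2" by auto
  then have A: "Pi_pmf A d M = map_pmf ?h (pair_pmf ?P1 ?P2)"
    using Pi_pmf_union[OF fin, of d M] by auto
  let ?R = "\<lambda>R. measure_pmf.prob (Pi_pmf A d M) {f. R f}"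
  have prob: "?R R = measure_pmf.prob (pair_pmf ?P1 ?P2) ({f. R1 f} \<times> {f. R2 f})"
    if R: "\<And>f g. f \<in> set_pmf ?P1 \<Longrightarrow> g \<in> set_pmf ?P2 \<Longrightarrow> R (?h (f, g)) \<longleftrightarrow> R1 f \<and> R2 g" for R R1 R2
  proof -
    have "?R R = measure_pmf.prob (pair_pmf ?P1 ?P2) {fg. R (?h fg)}"
      unfolding A measure_map_pmf by (simp add: vimage_def)
    also have "\<dots> = measure_pmf.prob (pair_pmf ?P1 ?P2) ({f. R1 f} \<times> {f. R2 f})"
      by (rule measure_pmf.finite_measure_eq_AE) (use R in \<open>auto simp: AE_measure_pmf_iff\<close>)
    finally show ?thesis .
  qed
  have out1: "f x = d" if "f \<in> set_pmf ?P1" "x \<notin> ?A1" for f x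
    using subsetD[OF set_Pi_pmf_subset[OF fin(1), of d M] that(1)] that(2) by simp
  have out2: "f x = d" if "f \<in> set_pmf ?P2" "x \<notin> ?A2" for f x
    using subsetD[OF set_Pi_pmf_subset[OF fin(2), of d M] that(1)] that(2) by simp
  have P: "P (?h (f, g)) \<longleftrightarrow> P f" if "f \<in> set_pmf ?P1" "g \<in> set_pmf ?P2" for f g
  proof -
    have "\<forall>x\<in>D. ?h (f, g) x = f x" using out1[OF that(1)] out2[OF that(2)] by auto
    then show ?thesis using assms(2) unfolding depends_on_def by blast
  qed
  have Q: "Q (?h (f, g)) \<longleftrightarrow> Q g" if "f \<in> set_pmf ?P1" "g \<in> set_pmf ?P2" for f g
  proof -
    have "\<forall>x\<in>D'. ?h (f, g) x = g x" using assms(4) by auto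
    then show ?thesis using assms(3) unfolding depends_on_def by blast
  qed
  \<comment> \<open>The product rule for \<open>pair_pmf\<close> asks for countable sets, so both
    sets are first cut down to the supports.\<close>
  have mult: "measure_pmf.prob (pair_pmf ?P1 ?P2) (S \<times> S') = measure_pmf.prob ?P1 S * measure_pmf.prob ?P2 S'" for S S'
  proof -
    have "measure_pmf.prob (pair_pmf ?P1 ?P2) (S \<times> S') =
      measure_pmf.prob (pair_pmf ?P1 ?P2) ((S \<inter> set_pmf ?P1) \<times> (S' \<inter> set_pmf ?P2))"
      by (rule measure_pmf.finite_measure_eq_AE) (auto simp: AE_measure_pmf_iff)
    also have "\<dots> = measure_pmf.prob ?P1 (S \<inter> set_pmf ?P1) * measure_pmf.prob ?P2 (S' \<inter> set_pmf ?P2)"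
      by (rule measure_pmf_prob_product) (auto intro: countable_Int2)
    finally show ?thesis by (simp add: measure_Int_set_pmf)
  qed
  have "?R (\<lambda>f. P f \<and> Q f) = measure_pmf.prob (pair_pmf ?P1 ?P2) ({f. P f} \<times> {f. Q f})"
    by (rule prob) (use P Q in blast)
  moreover have "?R P = measure_pmf.prob (pair_pmf ?P1 ?P2) ({f. P f} \<times> {f. True})"
    by (rule prob) (use P in blast)
  moreover have "?R Q = measure_pmf.prob (pair_pmf ?P1 ?P2) ({f. True} \<times> {f. Q f})"
    by (rule prob) (use Q in blast)
  ultimately show ?thesis unfolding mult by simp
qed

lemma prob_Pi_pmf_all:
  assumes "finite A" "finite W" "\<And>k. k \<in> W \<Longrightarrow> depends_on (D k) (P k)"
    "\<And>k k'. k \<in> W \<Longrightarrow> k' \<in> W \<Longrightarrow> k \<noteq> k' \<Longrightarrow> D k \<inter> D k' = {}"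
  shows "measure_pmf.prob (Pi_pmf A d M) {f. \<forall>k\<in>W. P k f} =
    (\<Prod>k\<in>W. measure_pmf.prob (Pi_pmf A d M) {f. P k f})"
  using assms(2-)
proof (induction W rule: finite_induct)
  case empty
  then show ?case by simp
next
  case (insert k W)
  have all: "depends_on (\<Union>k\<in>W. D k) (\<lambda>f. \<forall>k\<in>W. P k f)"
    by (rule depends_on_all) (use insert.prems in auto)
  have "D k \<inter> (\<Union>k\<in>W. D k) = {}" using insert.prems(2) insert.hyps(2) by fastforce
  from prob_Pi_pmf_conj[OF assms(1) insert.prems(1)[OF insertI1] all this, of d M]
  show ?case using insert by (simp add: insert.IH)
qed

text \<open>Compared pointwise: the preimage of a function f with default values off A is a
  rectangle over B, whose probability is the same product of point masses. For any other f both
  sides vanish.\<close>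

lemma Pi_pmf_reindex:
  assumes "finite A" "bij_betw h A B"
  shows "Pi_pmf A d (\<lambda>x. M (h x)) = map_pmf (\<lambda>g x. if x \<in> A then g (h x) else d) (Pi_pmf B d M)"
proof (rule pmf_eqI)
  fix f :: "'a \<Rightarrow> 'c"
  have B: "finite B" using assms bij_betw_finite by blast
  let ?i = "the_inv_into A h"
  have inj: "inj_on h A" and img: "B = h ` A" using assms(2) unfolding bij_betw_def by auto
  let ?G = "\<lambda>g x. if x \<in> A then g (h x) else d"
  have rhs: "pmf (map_pmf ?G (Pi_pmf B d M)) f = measure_pmf.prob (Pi_pmf B d M) (?G -` {f})"
    by (simp add: pmf_map)
  show "pmf (Pi_pmf A d (\<lambda>x. M (h x))) f = pmf (map_pmf ?G (Pi_pmf B d M)) f"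
  proof (cases "\<forall>x. x \<notin> A \<longrightarrow> f x = d")
    case False
    then have "?G -` {f} = {}" by auto
    moreover have "pmf (Pi_pmf A d (\<lambda>x. M (h x))) f = 0"
      by (rule pmf_Pi_outside[OF assms(1)]) (use False in blast)
    ultimately show ?thesis using rhs by simp
  next
    case True
    have "?G -` {f} = Pi B (\<lambda>b. {f (?i b)})"
      using True inj unfolding img by (auto simp: the_inv_into_f_f fun_eq_iff Pi_iff)
    then have "pmf (map_pmf ?G (Pi_pmf B d M)) f = (\<Prod>b\<in>B. measure_pmf.prob (M b) {f (?i b)})"
      unfolding rhs using measure_Pi_pmf_Pi[OF B] by simp
    also have "\<dots> = (\<Prod>x\<in>A. pmf (M (h x)) (f x))"
      unfolding img prod.reindex[OF inj] by (simp add: the_inv_into_f_f[OF inj] measure_pmf_single cong: prod.cong)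
    also have "\<dots> = pmf (Pi_pmf A d (\<lambda>x. M (h x))) f"
      by (rule pmf_Pi'[OF assms(1), symmetric]) (use True in simp)
    finally show ?thesis by simp
  qed
qed

lemma prob_Pi_pmf_component:
  assumes "finite A" "x \<in> A"
  shows "measure_pmf.prob (Pi_pmf A d M) {f. P (f x)} = measure_pmf.prob (M x) {y. P y}"
proof -
  have "measure_pmf.prob (M x) {y. P y} = measure_pmf.prob (map_pmf (\<lambda>f. f x) (Pi_pmf A d M)) {y. P y}"
    using Pi_pmf_component[OF assms(1), of x d M] assms(2) by simp
  then show ?thesis by (simp add: vimage_def)
qed

section \<open>The distribution of the labelled graph\<close>

text \<open>The product is continuous and strictly decreasing up to a = 2, where all factors are
  still nonnegative. Its values at 1 and 2 enclose 1 - p, so exactly one solution lies in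
  [1, 2].\<close>

lemma alpha_spec:
  assumes p: "0 < p" "p \<le> 1" and q: "1 \<le> q"
  shows "1 \<le> alpha p q \<and> alpha p q \<le> 2 \<and> (\<Prod>i=1..q. 1 - alpha p q * p / 2 ^ i) = 1 - p"
proof -
  let ?g = "\<lambda>a. \<Prod>i=1..q. 1 - a * p / 2 ^ i"
  have small: "b * p / 2 ^ i \<le> 1" if "b \<le> 2" "i \<in> {1..q}" for b and i :: nat
  proof -
    have "b * p \<le> 2 * 1" using that p by (intro mult_mono) auto
    also have "\<dots> \<le> 2 ^ i" using that power_increasing[of 1 i "2::real"] by simp
    finally show ?thesis by simp
  qed
  have less: "?g b < ?g a" if "a < b" "b \<le> 2" for a b
  proof -
    have lt: "1 - b * p / 2 ^ i < 1 - a * p / 2 ^ i" for i :: nat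
      using that p by (simp add: divide_strict_right_mono)
    have b0: "0 \<le> 1 - b * p / 2 ^ i" if "i \<in> {1..q}" for i using small[OF \<open>b \<le> 2\<close> that] by simp
    show ?thesis
    proof (rule prod_mono_strict[of 1])
      show "1 - b * p / 2 ^ 1 < 1 - a * p / 2 ^ 1" by (rule lt)
      fix i assume "i \<in> {1..q}"
      note b0[OF this] lt[of i]
      then show "0 \<le> 1 - b * p / 2 ^ i \<and> 1 - b * p / 2 ^ i \<le> 1 - a * p / 2 ^ i"
        "0 < 1 - a * p / 2 ^ i" by linarith+
    qed (use q in auto)
  qed
  \<comment> \<open>At a = 2 the factor for i = 1 equals 1 - p, and the other factors are at most
    1.\<close>
  have g2: "?g 2 \<le> 1 - p"
  proof -
    have "?g 2 = (1 - p) * (\<Prod>i\<in>{1..q} - {1}. 1 - 2 * p / 2 ^ i)"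
      using q by (subst prod.remove[of _ 1]) auto
    also have "\<dots> \<le> (1 - p) * 1"
      using p small[of 2] by (intro mult_left_mono prod_le_1) auto
    finally show ?thesis by simp
  qed
  \<comment> \<open>Weierstrass: a product of factors 1 - x is at least 1 minus the sum of the x,
    here a geometric sum below p.\<close>
  have g1: "1 - p \<le> ?g 1"
  proof -
    have "1 - (\<Sum>i=1..k. p / 2 ^ i) \<le> (\<Prod>i=1..k. 1 - 1 * p / 2 ^ i) \<and> (\<Prod>i=1..k. 1 - 1 * p / 2 ^ i) \<le> 1"
      if "k \<le> q" for k using that
    proof (induction k)
      case 0
      then show ?case by simp
    next
      case (Suc k)
      let ?P = "\<Prod>i=1..k. 1 - 1 * p / 2 ^ i"
      have t: "0 \<le> p / 2 ^ Suc k" "p / 2 ^ Suc k \<le> 1" using p small[of 1 "Suc k"] Suc.prems by auto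
      have P: "1 - (\<Sum>i=1..k. p / 2 ^ i) \<le> ?P" "?P \<le> 1" using Suc by auto
      have P0: "0 \<le> ?P" by (rule prod_nonneg) (use small[of 1] Suc.prems in auto)
      have "?P * (1 - p / 2 ^ Suc k) = ?P - ?P * (p / 2 ^ Suc k)" by (simp add: algebra_simps)
      moreover have "?P * (p / 2 ^ Suc k) \<le> 1 * (p / 2 ^ Suc k)" using P t by (intro mult_right_mono) auto
      moreover have "0 \<le> ?P * (p / 2 ^ Suc k)" using P0 t(1) by (rule mult_nonneg_nonneg)
      ultimately show ?case using P by simp
    qed
    from this[of q] have "1 - (\<Sum>i=1..q. p / 2 ^ i) \<le> ?g 1" by simp
    moreover have "(\<Sum>i=1..q. p / 2 ^ i) \<le> p"
    proof -
      have "(\<Sum>i=1..k. p / 2 ^ i) = p - p / 2 ^ k" for k :: nat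
        by (induction k) (auto simp: field_simps)
      then show ?thesis using p by simp
    qed
    ultimately show ?thesis by linarith
  qed
  have "continuous_on {1..2} ?g" by (intro continuous_intros) auto
  then obtain a where a: "1 \<le> a" "a \<le> 2" "?g a = 1 - p"
    using IVT2'[of ?g 2 "1 - p" 1] g1 g2 by auto
  have "\<exists>!a. 1 \<le> a \<and> a \<le> 2 \<and> ?g a = 1 - p"
  proof (rule ex1I[of _ a])
    show "1 \<le> a \<and> a \<le> 2 \<and> ?g a = 1 - p" using a by simp
    fix b assume b: "1 \<le> b \<and> b \<le> 2 \<and> ?g b = 1 - p"
    then show "b = a" using a less[of a b] less[of b a] by (cases a b rule: linorder_cases) auto
  qed
  from theI'[OF this] show ?thesis unfolding alpha_def .
qed

definition independent_label_pmf :: "real \<Rightarrow> nat \<Rightarrow> (nat \<Rightarrow> bool) pmf" where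
  "independent_label_pmf p q =
     Pi_pmf {1..q} False (\<lambda>i. bernoulli_pmf (alpha p q * p / 2 ^ i))"

definition labelled :: "nat \<Rightarrow> (nat \<Rightarrow> bool) \<Rightarrow> bool" where
  "labelled q X \<longleftrightarrow> (\<exists>i\<in>{1..q}. X i)"

locale label_parameters =
  fixes p :: real and q :: nat
  assumes p_pos: "0 < p" and p_le_1: "p \<le> 1" and q_ge_1: "1 \<le> q"
begin

abbreviation "pr i \<equiv> alpha p q * p / 2 ^ i"

lemmas alpha = alpha_spec[OF p_pos p_le_1 q_ge_1]

lemma pr_range: "1 \<le> i \<Longrightarrow> 0 \<le> pr i \<and> pr i \<le> 1"
proof -
  assume "1 \<le> i"
  have "alpha p q * p \<le> 2 * 1" using alpha p_pos p_le_1 by (intro mult_mono) auto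
  also have "\<dots> \<le> 2 ^ i" using \<open>1 \<le> i\<close> power_increasing[of 1 i "2::real"] by simp
  finally show ?thesis using alpha p_pos by simp
qed

lemma pr_le: "pr i \<le> 2 * p / 2 ^ i"
  using alpha p_pos by (intro divide_right_mono mult_right_mono) auto

lemma pr_ge: "p / 2 ^ i \<le> pr i"
  using alpha p_pos by (intro divide_right_mono) auto

lemma prob_independent_label:
  assumes "i \<in> {1..q}"
  shows "measure_pmf.prob (independent_label_pmf p q) {X. X i} = pr i"
proof -
  have "measure_pmf.prob (independent_label_pmf p q) {X. X i} = measure_pmf.prob (bernoulli_pmf (pr i)) {y. y}"
    unfolding independent_label_pmf_def using prob_Pi_pmf_component[of "{1..q}" i False _ "\<lambda>y. y"] assms by simp
  also have "{y. y} = {True}" by auto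
  finally show ?thesis using pr_range[of i] assms by (simp add: measure_pmf_single)
qed

lemma pmf_independent_label_unlabelled:
  assumes "\<not> labelled q X"
  shows "pmf (independent_label_pmf p q) X = (if X = (\<lambda>_. False) then 1 - p else 0)"
proof (cases "X = (\<lambda>_. False)")
  case True
  have "pmf (independent_label_pmf p q) X = (\<Prod>i=1..q. pmf (bernoulli_pmf (pr i)) (X i))"
    unfolding independent_label_pmf_def by (rule pmf_Pi') (use True in auto)
  also have "\<dots> = (\<Prod>i=1..q. 1 - pr i)" by (rule prod.cong) (use True pr_range in auto)
  finally show ?thesis using True alpha by simp
next
  case False
  then obtain i where "X i" by auto
  then have "pmf (independent_label_pmf p q) X = 0"
    unfolding independent_label_pmf_def
    by (intro pmf_Pi_outside exI[of _ i]) (use assms in \<open>auto simp: labelled_def\<close>)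
  then show ?thesis using False by simp
qed

text \<open>This is what \<alpha> is chosen for: an unconditioned label vector is nonempty with the
  edge probability p.\<close>

lemma prob_independent_labelled: "measure_pmf.prob (independent_label_pmf p q) {X. labelled q X} = p"
proof -
  have "measure_pmf.prob (independent_label_pmf p q) {X. \<not> labelled q X} =
    measure_pmf.prob (independent_label_pmf p q) {\<lambda>_. False}"
  proof (rule measure_pmf.finite_measure_eq_AE)
    show "AE X in independent_label_pmf p q. (X \<in> {X. \<not> labelled q X}) = (X \<in> {\<lambda>_. False})"
      using pmf_independent_label_unlabelled
      by (auto simp: AE_measure_pmf_iff set_pmf_iff labelled_def split: if_splits)
  qed auto
  also have "\<dots> = 1 - p"
    using pmf_independent_label_unlabelled[of "\<lambda>_. False"] by (simp add: measure_pmf_single labelled_def)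
  finally have "measure_pmf.prob (independent_label_pmf p q) {X. \<not> labelled q X} = 1 - p" .
  moreover have "{X. \<not> labelled q X} = UNIV - {X. labelled q X}" by auto
  ultimately show ?thesis using measure_pmf.prob_compl[of "{X. labelled q X}" "independent_label_pmf p q"] by simp
qed

lemma label_pmf_cond: "label_pmf p q = cond_pmf (independent_label_pmf p q) {X. labelled q X}"
  unfolding label_pmf_def independent_label_pmf_def labelled_def ..

lemma labelled_possible: "set_pmf (independent_label_pmf p q) \<inter> {X. labelled q X} \<noteq> {}"
  using prob_independent_labelled p_pos
  by (metis measure_pmf_zero_iff disjoint_iff inf_commute less_irrefl)

lemma pmf_label: "pmf (label_pmf p q) X = (if labelled q X then pmf (independent_label_pmf p q) X / p else 0)"
  unfolding label_pmf_cond pmf_cond[OF labelled_possible] prob_independent_labelled by simp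

lemma set_label_pmf: "X \<in> set_pmf (label_pmf p q) \<Longrightarrow> labelled q X"
  by (auto simp: set_pmf_iff pmf_label split: if_splits)

text \<open>The event on which the label vector is conditioned has probability p, so tossing the
  edge coin first and then drawing the conditioned vector undoes the conditioning. For a stochastic
  pair the labels at different indices thus become independent.\<close>

lemma bernoulli_label:
  "bind_pmf (bernoulli_pmf p) (\<lambda>b. if b then label_pmf p q else return_pmf (\<lambda>_. False)) =
     independent_label_pmf p q"
proof (rule pmf_eqI)
  fix X
  have "pmf (bind_pmf (bernoulli_pmf p) (\<lambda>b. if b then label_pmf p q else return_pmf (\<lambda>_. False))) X =
    p * pmf (label_pmf p q) X + (1 - p) * pmf (return_pmf (\<lambda>_. False)) X"
    using p_pos p_le_1 by (simp add: pmf_bind)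
  also have "\<dots> = pmf (independent_label_pmf p q) X"
  proof (cases "labelled q X")
    case True
    then have "X \<noteq> (\<lambda>_. False)" by (auto simp: labelled_def)
    then show ?thesis using True p_pos by (simp add: pmf_label pmf_return)
  next
    case False
    then show ?thesis using pmf_independent_label_unlabelled by (simp add: pmf_label pmf_return)
  qed
  finally show "pmf (bind_pmf (bernoulli_pmf p) (\<lambda>b. if b then label_pmf p q else return_pmf (\<lambda>_. False))) X =
    pmf (independent_label_pmf p q) X" .
qed

lemma sum_geometric_tail: "(\<Sum>j=h..q. 2 * p / 2 ^ j) \<le> 4 * p / 2 ^ h"
proof (cases "h \<le> q")
  case True
  then have "(\<Sum>j=h..q. 2 * p / 2 ^ j) = 4 * p / 2 ^ h - 2 * p / 2 ^ q"
  proof (induction q rule: dec_induct)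
    case base
    then show ?case by simp
  next
    case (step k)
    have "2 * p / 2 ^ k = 2 * (2 * p / 2 ^ Suc k)" by simp
    then show ?case using step by simp
  qed
  then show ?thesis using p_pos by simp
next
  case False
  then show ?thesis using p_pos by simp
qed

lemma prob_independent_label_above:
  assumes "1 \<le> h"
  shows "measure_pmf.prob (independent_label_pmf p q) {X. \<exists>j. h \<le> j \<and> j \<le> q \<and> X j} \<le> 4 * p / 2 ^ h"
proof -
  have "{X. \<exists>j. h \<le> j \<and> j \<le> q \<and> X j} = (\<Union>j\<in>{h..q}. {X. X j})" by auto
  then have "measure_pmf.prob (independent_label_pmf p q) {X. \<exists>j. h \<le> j \<and> j \<le> q \<and> X j} \<le>
    (\<Sum>j=h..q. measure_pmf.prob (independent_label_pmf p q) {X. X j})"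
    using measure_pmf.finite_measure_subadditive_finite[of "{h..q}" "\<lambda>j. {X. X j}" "independent_label_pmf p q"] by simp
  also have "\<dots> \<le> (\<Sum>j=h..q. 2 * p / 2 ^ j)"
    by (rule sum_mono) (use prob_independent_label pr_le assms in auto)
  also have "\<dots> \<le> 4 * p / 2 ^ h" by (rule sum_geometric_tail)
  finally show ?thesis .
qed

lemma finite_set_independent_label: "finite (set_pmf (independent_label_pmf p q))"
  unfolding independent_label_pmf_def
  by (subst set_Pi_pmf) (auto intro!: finite_PiE_dflt)

lemma finite_set_label: "finite (set_pmf (label_pmf p q))"
  by (rule finite_subset[OF _ finite_set_independent_label])
    (auto simp: set_pmf_iff pmf_label split: if_splits)

text \<open>Conditioning on an event of probability p inflates probabilities by at most 1 /
  p.\<close>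

lemma prob_label_above:
  assumes "1 \<le> h"
  shows "measure_pmf.prob (label_pmf p q) {X. \<exists>j. h \<le> j \<and> j \<le> q \<and> X j} \<le> 4 / 2 ^ h"
proof -
  have "p * measure_pmf.prob (label_pmf p q) {X. \<exists>j. h \<le> j \<and> j \<le> q \<and> X j} \<le> 
     measure_pmf.prob (independent_label_pmf p q) {X. \<exists>j. h \<le> j \<and> j \<le> q \<and> X j}" (is "_ * ?a \<le> ?b")
  proof -
    let ?A = "{X. \<exists>j. h \<le> j \<and> j \<le> q \<and> X j}"
    let ?F = "?A \<inter> set_pmf (label_pmf p q)"
    have F: "finite ?F" using finite_set_label by simp
    have "?a = measure_pmf.prob (label_pmf p q) ?F" by (rule measure_Int_set_pmf[symmetric])
    also have "\<dots> = (\<Sum>X\<in>?F. pmf (label_pmf p q) X)" by (rule measure_measure_pmf_finite[OF F])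
    also have "\<dots> \<le> (\<Sum>X\<in>?F. pmf (independent_label_pmf p q) X / p)"
      by (rule sum_mono) (use p_pos in \<open>auto simp: pmf_label\<close>)
    also have "\<dots> = measure_pmf.prob (independent_label_pmf p q) ?F / p"
      by (simp add: measure_measure_pmf_finite[OF F] sum_divide_distrib)
    also have "\<dots> \<le> ?b / p"
      by (intro divide_right_mono measure_pmf.finite_measure_mono) (use p_pos in auto)
    finally show ?thesis using p_pos by (simp add: field_simps)
  qed
  also have "?b \<le> 4 * p / 2 ^ h" by (rule prob_independent_label_above[OF assms])
  finally show ?thesis using p_pos by (simp add: field_simps)
qed

end

section \<open>A single product law for graph and labels, over pairs of vertices or of
  positions\<close>

definition all_pairs :: "nat list \<Rightarrow> nat set set" where
  "all_pairs xs = {e. e \<subseteq> set xs \<and> card e = 2}"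

text \<open>Here the graph is not drawn separately: a pair is an edge iff its label vector is
  nonempty, as in \<open>edges_of\<close>. Only deterministic pairs keep the conditioned
  vector.\<close>

definition edge_law :: "real \<Rightarrow> nat \<Rightarrow> nat list \<Rightarrow> (nat set \<Rightarrow> nat \<Rightarrow> bool) pmf" where
  "edge_law p q xs = Pi_pmf (all_pairs xs) (\<lambda>_. False)
     (\<lambda>e. if e \<in> deterministic_pairs xs then label_pmf p q else independent_label_pmf p q)"

definition edges_of :: "nat \<Rightarrow> nat list \<Rightarrow> (nat set \<Rightarrow> nat \<Rightarrow> bool) \<Rightarrow> nat set set" where
  "edges_of q xs X = {e \<in> all_pairs xs. labelled q (X e)}"

definition position_pairs :: "nat \<Rightarrow> (nat \<times> nat) set" where
  "position_pairs n = {(m, k). m < k \<and> k < n}"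

definition position_law :: "real \<Rightarrow> nat \<Rightarrow> nat \<Rightarrow> (nat \<times> nat \<Rightarrow> nat \<Rightarrow> bool) pmf" where
  "position_law p q n = Pi_pmf (position_pairs n) (\<lambda>_. False)
     (\<lambda>(m, k). if k = Suc m then label_pmf p q else independent_label_pmf p q)"

definition at_positions ::
    "nat list \<Rightarrow> (nat set \<Rightarrow> nat \<Rightarrow> bool) \<Rightarrow> nat \<times> nat \<Rightarrow> nat \<Rightarrow> bool" where
  "at_positions xs X = (\<lambda>(m, k). if (m, k) \<in> position_pairs (length xs) then X {xs ! m, xs ! k} else (\<lambda>_. False))"

lemma finite_all_pairs: "finite (all_pairs xs)"
  unfolding all_pairs_def by (rule finite_subset[of _ "Pow (set xs)"]) auto

lemma finite_position_pairs: "finite (position_pairs n)"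
  unfolding position_pairs_def by (rule finite_subset[of _ "{..<n} \<times> {..<n}"]) auto

lemma deterministic_pairs_subset:
  assumes "distinct xs"
  shows "deterministic_pairs xs \<subseteq> all_pairs xs"
  using assms unfolding deterministic_pairs_def all_pairs_def
  by (auto simp: card_insert_if nth_eq_iff_index_eq)

lemma deterministic_pairs_iff:
  assumes "distinct xs" "m < k" "k < length xs"
  shows "{xs ! m, xs ! k} \<in> deterministic_pairs xs \<longleftrightarrow> k = Suc m"
  using assms unfolding deterministic_pairs_def
  by (auto simp: doubleton_eq_iff nth_eq_iff_index_eq)

lemma deterministic_pairs_rev: "deterministic_pairs (rev xs) = deterministic_pairs xs"
proof -
  have "deterministic_pairs (rev xs) \<subseteq> deterministic_pairs xs" for xs
  proof
    fix e assume "e \<in> deterministic_pairs (rev xs)"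
    then obtain i where i: "i + 1 < length xs" "e = {rev xs ! i, rev xs ! (i + 1)}"
      unfolding deterministic_pairs_def by auto
    let ?j = "length xs - Suc (Suc i)"
    have "e = {xs ! ?j, xs ! (?j + 1)}" using i by (auto simp: rev_nth Suc_diff_Suc insert_commute)
    moreover have "?j + 1 < length xs" using i by simp
    ultimately show "e \<in> deterministic_pairs xs" unfolding deterministic_pairs_def by blast
  qed
  from this[of xs] this[of "rev xs"] show ?thesis by simp
qed

text \<open>Lets the second half of the algorithm be analysed as a run on the reversed order under
  the same random experiment.\<close>

lemma edge_law_rev: "edge_law p q (rev xs) = edge_law p q xs"
  unfolding edge_law_def deterministic_pairs_rev all_pairs_def by simp

lemma edges_of_rev: "edges_of q (rev xs) X = edges_of q xs X"
  unfolding edges_of_def all_pairs_def by simp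

lemma bij_betw_position_pairs:
  assumes "distinct xs"
  shows "bij_betw (\<lambda>(m, k). {xs ! m, xs ! k}) (position_pairs (length xs)) (all_pairs xs)"
  unfolding bij_betw_def
proof
  show "inj_on (\<lambda>(m, k). {xs ! m, xs ! k}) (position_pairs (length xs))"
    using assms by (auto intro!: inj_onI simp: position_pairs_def doubleton_eq_iff nth_eq_iff_index_eq)
  show "(\<lambda>(m, k). {xs ! m, xs ! k}) ` position_pairs (length xs) = all_pairs xs"
  proof (intro equalityI subsetI)
    fix e assume "e \<in> (\<lambda>(m, k). {xs ! m, xs ! k}) ` position_pairs (length xs)"
    then show "e \<in> all_pairs xs"
      using assms by (auto simp: position_pairs_def all_pairs_def card_insert_if nth_eq_iff_index_eq)
  next
    fix e assume "e \<in> all_pairs xs"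
    then obtain u v where e: "e = {u, v}" "u \<noteq> v" "u \<in> set xs" "v \<in> set xs"
      unfolding all_pairs_def card_2_iff by auto
    then obtain a b where ab: "u = xs ! a" "v = xs ! b" "a < length xs" "b < length xs"
      unfolding in_set_conv_nth by blast
    have "a \<noteq> b" using ab e by auto
    then have "(min a b, max a b) \<in> position_pairs (length xs)" using ab by (auto simp: position_pairs_def)
    moreover have "e = {xs ! min a b, xs ! max a b}" using e ab by (cases "a \<le> b") (auto simp: min_def max_def)
    ultimately show "e \<in> (\<lambda>(m, k). {xs ! m, xs ! k}) ` position_pairs (length xs)" by force
  qed
qed

lemma map_at_positions:
  assumes "distinct xs"
  shows "map_pmf (at_positions xs) (edge_law p q xs) = position_law p q (length xs)"
proof -
  let ?h = "\<lambda>(m, k). {xs ! m, xs ! k}"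
  let ?M = "\<lambda>e. if e \<in> deterministic_pairs xs then label_pmf p q else independent_label_pmf p q"
  have "position_law p q (length xs) = Pi_pmf (position_pairs (length xs)) (\<lambda>_. False) (\<lambda>x. ?M (?h x))"
    unfolding position_law_def
    by (rule Pi_pmf_cong) (auto simp: position_pairs_def deterministic_pairs_iff[OF assms])
  also have "\<dots> = map_pmf (\<lambda>g x. if x \<in> position_pairs (length xs) then g (?h x) else (\<lambda>_. False))
      (Pi_pmf (all_pairs xs) (\<lambda>_. False) ?M)"
    by (rule Pi_pmf_reindex[OF finite_position_pairs bij_betw_position_pairs[OF assms]])
  also have "(\<lambda>g x. if x \<in> position_pairs (length xs) then g (?h x) else (\<lambda>_. False)) = at_positions xs"
    by (auto simp: at_positions_def fun_eq_iff)
  finally show ?thesis unfolding edge_law_def ..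
qed

context label_parameters
begin

text \<open>Coins and labels are drawn in two stages, but each stage is a product over pairs.
  Composing the stages pair by pair gives one product, with \<open>bernoulli_label\<close> on each
  stochastic pair.\<close>

lemma sorting_experiment_edge_law:
  assumes "distinct xs"
  shows "sorting_experiment pick p q c xs =
    map_pmf (\<lambda>X. run (answer xs (edges_of q xs X))
       (sort_with pick (length xs) p q c (edges_of q xs X) (\<lambda>i. {e \<in> edges_of q xs X. X e i})))
     (edge_law p q xs)"
proof -
  let ?A = "all_pairs xs" and ?D = "deterministic_pairs xs"
  let ?B = "\<lambda>e. if e \<in> ?D then return_pmf True else bernoulli_pmf p"
  let ?E = "\<lambda>f. {e \<in> ?A. f e}"
  let ?r = "\<lambda>E X. run (answer xs E) (sort_with pick (length xs) p q c E (\<lambda>i. {e \<in> E. X e i}))"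
  have DA: "?D \<subseteq> ?A" using deterministic_pairs_subset[OF assms] .
  have st: "stochastic_pairs xs = ?A - ?D" unfolding stochastic_pairs_def all_pairs_def ..
  have finD: "finite ?D" "finite (?A - ?D)" using DA finite_all_pairs finite_subset by auto
  \<comment> \<open>The graph as a product over all pairs, with a coin that always succeeds on
    deterministic pairs.\<close>
  have graph: "graph_pmf p xs = map_pmf ?E (Pi_pmf ?A False ?B)"
  proof -
    have "Pi_pmf ?A False ?B = Pi_pmf (?D \<union> (?A - ?D)) False ?B" using DA by (simp add: Un_absorb1)
    also have "\<dots> = map_pmf (\<lambda>(f, g) x. if x \<in> ?D then f x else g x)
        (pair_pmf (Pi_pmf ?D False ?B) (Pi_pmf (?A - ?D) False ?B))"
      by (rule Pi_pmf_union[OF finD]) auto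
    also have "Pi_pmf ?D False ?B = Pi_pmf ?D False (\<lambda>_. return_pmf True)"
      by (rule Pi_pmf_cong) auto
    also have "\<dots> = return_pmf (\<lambda>x. x \<in> ?D)" using finD by (simp add: fun_eq_iff)
    also have "Pi_pmf (?A - ?D) False ?B = Pi_pmf (?A - ?D) False (\<lambda>_. bernoulli_pmf p)"
      by (rule Pi_pmf_cong) auto
    also have "map_pmf (\<lambda>(f, g) x. if x \<in> ?D then f x else g x)
      (pair_pmf (return_pmf (\<lambda>x. x \<in> ?D)) (Pi_pmf (?A - ?D) False (\<lambda>_. bernoulli_pmf p))) =
      map_pmf (\<lambda>g x. if x \<in> ?D then True else g x) (Pi_pmf (?A - ?D) False (\<lambda>_. bernoulli_pmf p))"
      by (simp add: pair_return_pmf1 map_pmf_comp if_bool_eq_conj cong: map_pmf_cong if_cong)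
    finally have "map_pmf ?E (Pi_pmf ?A False ?B) =
       map_pmf (\<lambda>g. {e \<in> ?A. if e \<in> ?D then True else g e}) (Pi_pmf (?A - ?D) False (\<lambda>_. bernoulli_pmf p))"
      by (simp add: map_pmf_comp)
    also have "(\<lambda>g. {e \<in> ?A. if e \<in> ?D then True else g e}) = (\<lambda>b. ?D \<union> {e \<in> ?A - ?D. b e})"
      using DA by (auto simp: fun_eq_iff)
    finally show ?thesis unfolding graph_pmf_def st by simp
  qed
  let ?q = "\<lambda>b. if b then label_pmf p q else return_pmf (\<lambda>_. False)"
  have inner: "Pi_pmf (?E f) (\<lambda>_. False) (\<lambda>_. label_pmf p q) = Pi_pmf ?A (\<lambda>_. False) (\<lambda>e. ?q (f e))" for f
    by (rule Pi_pmf_if_set[OF finite_all_pairs, symmetric])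
  \<comment> \<open>Labels of an edge are never all empty and those of a non-edge always are, so the
    graph can be read off the labels.\<close>
  have edges: "edges_of q xs X = ?E f" if "X \<in> set_pmf (Pi_pmf ?A (\<lambda>_. False) (\<lambda>e. ?q (f e)))" for f X
  proof -
    have Xe: "X e \<in> set_pmf (?q (f e))" if "e \<in> ?A" for e
      using \<open>X \<in> _\<close> that unfolding set_Pi_pmf[OF finite_all_pairs] PiE_dflt_def by auto
    have "labelled q (X e) \<longleftrightarrow> f e" if "e \<in> ?A" for e
      using Xe[OF that] set_label_pmf[of "X e"] by (cases "f e") (auto simp: labelled_def)
    then show ?thesis unfolding edges_of_def by blast
  qed
  have "sorting_experiment pick p q c xs = bind_pmf (Pi_pmf ?A False ?B) (\<lambda>f.
     map_pmf (?r (?E f)) (Pi_pmf ?A (\<lambda>_. False) (\<lambda>e. ?q (f e))))"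
    unfolding sorting_experiment_def graph stochastic_sort_def bind_map_pmf
    by (simp add: inner map_pmf_comp map_pmf_def[symmetric] o_def)
  also have "\<dots> = bind_pmf (Pi_pmf ?A False ?B) (\<lambda>f.
     map_pmf (\<lambda>X. ?r (edges_of q xs X) X) (Pi_pmf ?A (\<lambda>_. False) (\<lambda>e. ?q (f e))))"
    by (intro bind_pmf_cong map_pmf_cong refl) (simp add: edges)
  also have "\<dots> = map_pmf (\<lambda>X. ?r (edges_of q xs X) X)
      (bind_pmf (Pi_pmf ?A False ?B) (\<lambda>f. Pi_pmf ?A (\<lambda>_. False) (\<lambda>e. ?q (f e))))"
    by (simp add: map_bind_pmf)
  also have "bind_pmf (Pi_pmf ?A False ?B) (\<lambda>f. Pi_pmf ?A (\<lambda>_. False) (\<lambda>e. ?q (f e))) =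
      Pi_pmf ?A (\<lambda>_. False) (\<lambda>e. bind_pmf (?B e) ?q)"
    by (rule Pi_pmf_bind[OF finite_all_pairs, symmetric])
  also have "\<dots> = edge_law p q xs"
    unfolding edge_law_def
  proof (rule Pi_pmf_cong)
    fix e
    show "bind_pmf (?B e) ?q = (if e \<in> ?D then label_pmf p q else independent_label_pmf p q)"
      using bernoulli_label by (simp add: bind_return_pmf)
  qed auto
  finally show ?thesis .
qed

lemma set_edge_law:
  assumes "distinct xs" "X \<in> set_pmf (edge_law p q xs)"
  shows "deterministic_pairs xs \<subseteq> edges_of q xs X"
proof
  fix e assume e: "e \<in> deterministic_pairs xs"
  then have "e \<in> all_pairs xs" using deterministic_pairs_subset[OF assms(1)] by auto
  then have "X e \<in> set_pmf (label_pmf p q)"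
    using assms(2) e unfolding edge_law_def set_Pi_pmf[OF finite_all_pairs] PiE_dflt_def by auto
  then show "e \<in> edges_of q xs X" using set_label_pmf \<open>e \<in> all_pairs xs\<close> unfolding edges_of_def by simp
qed

lemma finite_set_position_law: "finite (set_pmf (position_law p q n))"
  unfolding position_law_def set_Pi_pmf[OF finite_position_pairs]
  by (rule finite_PiE_dflt[OF finite_position_pairs])
    (auto simp: finite_set_label finite_set_independent_label)

lemma finite_set_edge_law: "finite (set_pmf (edge_law p q xs))"
  unfolding edge_law_def set_Pi_pmf[OF finite_all_pairs]
  by (rule finite_PiE_dflt[OF finite_all_pairs])
    (auto simp: finite_set_label finite_set_independent_label)

end

section \<open>Probability estimates\<close>

text \<open>The law indexes a pair by its smaller position first; this is the symmetric
  reading.\<close>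

definition rel :: "(nat \<times> nat \<Rightarrow> nat \<Rightarrow> bool) \<Rightarrow> nat \<Rightarrow> nat \<Rightarrow> nat \<Rightarrow> bool" where
  "rel Y m k = Y (min m k, max m k)"

text \<open>With d the rank, the summands are at most \<open>4 * A\<^sup>2 / (A + d)\<^sup>2\<close>
  and \<open>4 * A ^ 3 / (A + d)\<^sup>2\<close>: if d is at most A, then A + d is at most 2 * A,
  and otherwise at most 2 * d. The sum of \<open>1 / (A + d)\<^sup>2\<close> telescopes to at most 1
  / A.\<close>

lemma sum_rank_cube:
  fixes A :: real
  assumes "A > 0"
  shows "(\<Sum>y\<in>{l..<n}. min 1 ((A / real (y - l + 1)) ^ 3)) \<le> 4 * A"
    and "(\<Sum>y\<in>{l..<n}. real (y - l + 1) * min 1 ((A / real (y - l + 1)) ^ 3)) \<le> 4 * A\<^sup>2"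
proof -
  define S where "S = (\<Sum>y\<in>{l..<n}. 1 / (A + real (y - l + 1))\<^sup>2)"
  have S: "S \<le> 1 / A"
  proof -
    have "(\<Sum>d<k. 1 / (A + real (d + 1))\<^sup>2) \<le> 1 / A - 1 / (A + real k)" for k
    proof (induction k)
      case 0
      then show ?case by simp
    next
      case (Suc k)
      have "1 / (A + real (k + 1))\<^sup>2 \<le> 1 / (A + real k) - 1 / (A + real (Suc k))"
      proof -
        have "1 / (A + real k) - 1 / (A + real (Suc k)) = 1 / ((A + real k) * (A + real (Suc k)))"
          using assms by (simp add: field_simps)
        also have "\<dots> \<ge> 1 / (A + real (k + 1))\<^sup>2"
          unfolding power2_eq_square using assms
          by (intro divide_left_mono mult_mono mult_pos_pos) auto
        finally show ?thesis .
      qed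
      then show ?case using Suc by simp
    qed
    from this[of "n - l"] have "(\<Sum>d<n - l. 1 / (A + real (d + 1))\<^sup>2) \<le> 1 / A"
      using assms by (smt (verit) divide_nonneg_pos of_nat_0_le_iff)
    moreover have "S = (\<Sum>d<n - l. 1 / (A + real (d + 1))\<^sup>2)"
      unfolding S_def by (rule sum.reindex_bij_witness[of _ "\<lambda>d. d + l" "\<lambda>y. y - l"]) auto
    ultimately show ?thesis by simp
  qed
  have b: "min 1 ((A / d) ^ 3) \<le> 4 * A\<^sup>2 * (1 / (A + d)\<^sup>2)"
    "d * min 1 ((A / d) ^ 3) \<le> 4 * A ^ 3 * (1 / (A + d)\<^sup>2)" if "d \<ge> 1" for d :: real
  proof -
    have d: "d > 0" "A + d > 0" using that assms by auto
    show "min 1 ((A / d) ^ 3) \<le> 4 * A\<^sup>2 * (1 / (A + d)\<^sup>2)"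
    proof (cases "d \<le> A")
      case True
      have "(A + d)\<^sup>2 \<le> (2 * A)\<^sup>2" using True d by (intro power_mono) auto
      then have "1 \<le> 4 * A\<^sup>2 * (1 / (A + d)\<^sup>2)" using d by (simp add: power_mult_distrib)
      then show ?thesis by simp
    next
      case False
      have "(A + d)\<^sup>2 \<le> (2 * d)\<^sup>2" using False assms by (intro power_mono) auto
      then have "1 / (2 * d)\<^sup>2 \<le> 1 / (A + d)\<^sup>2" using d by (intro divide_left_mono) auto
      then have "4 * A\<^sup>2 * (1 / (2 * d)\<^sup>2) \<le> 4 * A\<^sup>2 * (1 / (A + d)\<^sup>2)" by (intro mult_left_mono) auto
      moreover have "4 * A\<^sup>2 * (1 / (2 * d)\<^sup>2) = (A / d)\<^sup>2" by (simp add: power_mult_distrib power_divide)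
      moreover have "(A / d) ^ 3 \<le> (A / d)\<^sup>2" using False assms by (intro power_decreasing) auto
      ultimately show ?thesis by simp
    qed
    show "d * min 1 ((A / d) ^ 3) \<le> 4 * A ^ 3 * (1 / (A + d)\<^sup>2)"
    proof (cases "d \<le> A")
      case True
      have "(A + d)\<^sup>2 \<le> (2 * A)\<^sup>2" using True d by (intro power_mono) auto
      then have "1 \<le> 4 * A\<^sup>2 * (1 / (A + d)\<^sup>2)" using d by (simp add: power_mult_distrib)
      then have "A * 1 \<le> A * (4 * A\<^sup>2 * (1 / (A + d)\<^sup>2))" using assms by (intro mult_left_mono) auto
      moreover have "A * (4 * A\<^sup>2 * (1 / (A + d)\<^sup>2)) = 4 * A ^ 3 * (1 / (A + d)\<^sup>2)"
        by (simp add: power2_eq_square power3_eq_cube)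
      moreover have "d * min 1 ((A / d) ^ 3) \<le> d * 1" using d by (intro mult_left_mono) auto
      ultimately show ?thesis using True by linarith
    next
      case False
      have "(A + d)\<^sup>2 \<le> (2 * d)\<^sup>2" using False assms by (intro power_mono) auto
      then have "1 / (2 * d)\<^sup>2 \<le> 1 / (A + d)\<^sup>2" using d by (intro divide_left_mono) auto
      then have "4 * A ^ 3 * (1 / (2 * d)\<^sup>2) \<le> 4 * A ^ 3 * (1 / (A + d)\<^sup>2)"
        using assms by (intro mult_left_mono) auto
      moreover have "4 * A ^ 3 * (1 / (2 * d)\<^sup>2) = d * (A / d) ^ 3"
        using d by (simp add: power2_eq_square power3_eq_cube field_simps)
      moreover have "d * min 1 ((A / d) ^ 3) \<le> d * (A / d) ^ 3" using d by (intro mult_left_mono) auto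
      ultimately show ?thesis by simp
    qed
  qed
  have "(\<Sum>y\<in>{l..<n}. min 1 ((A / real (y - l + 1)) ^ 3)) \<le> 4 * A\<^sup>2 * S"
    unfolding S_def sum_distrib_left by (intro sum_mono b(1)) simp
  also have "\<dots> \<le> 4 * A\<^sup>2 * (1 / A)" using S by (intro mult_left_mono) auto
  finally show "(\<Sum>y\<in>{l..<n}. min 1 ((A / real (y - l + 1)) ^ 3)) \<le> 4 * A"
    using assms by (simp add: power2_eq_square)
  have "(\<Sum>y\<in>{l..<n}. real (y - l + 1) * min 1 ((A / real (y - l + 1)) ^ 3)) \<le> 4 * A ^ 3 * S"
    unfolding S_def sum_distrib_left by (intro sum_mono b(2)) simp
  also have "\<dots> \<le> 4 * A ^ 3 * (1 / A)" using S assms by (intro mult_left_mono) auto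
  finally show "(\<Sum>y\<in>{l..<n}. real (y - l + 1) * min 1 ((A / real (y - l + 1)) ^ 3)) \<le> 4 * A\<^sup>2"
    using assms by (simp add: power2_eq_square power3_eq_cube)
qed

text \<open>A value y is the maximum of at most 2 * (y - l + 1) pairs from l on.\<close>

lemma sum_max_le:
  fixes g :: "nat \<Rightarrow> real"
  assumes "\<And>y. 0 \<le> g y"
  shows "(\<Sum>v\<in>{l..<n}. \<Sum>u\<in>{l..<n}. g (max u v)) \<le> 2 * (\<Sum>y\<in>{l..<n}. real (y - l + 1) * g y)"
proof -
  have eq: "(\<Sum>u\<in>{l..v}. g v) = real (v - l + 1) * g v" if "v \<in> {l..<n}" for v using that by auto
  have "(\<Sum>v\<in>{l..<n}. \<Sum>u\<in>{l..<n}. g (max u v)) \<le>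
    (\<Sum>v\<in>{l..<n}. \<Sum>u\<in>{l..<n}. (if u \<le> v then g v else 0) + (if v \<le> u then g u else 0))"
    by (intro sum_mono) (use assms in \<open>auto simp: max_def\<close>)
  also have "\<dots> = (\<Sum>v\<in>{l..<n}. \<Sum>u\<in>{l..<n}. if u \<le> v then g v else 0) +
     (\<Sum>u\<in>{l..<n}. \<Sum>v\<in>{l..<n}. if v \<le> u then g u else 0)"
    by (subst (3) sum.swap) (simp add: sum.distrib)
  also have "\<dots> = 2 * (\<Sum>v\<in>{l..<n}. \<Sum>u\<in>{l..<n}. if u \<le> v then g v else 0)" by simp
  also have "(\<Sum>v\<in>{l..<n}. \<Sum>u\<in>{l..<n}. if u \<le> v then g v else 0) = (\<Sum>v\<in>{l..<n}. \<Sum>u\<in>{l..v}. g v)"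
  proof (rule sum.cong[OF refl])
    fix v assume "v \<in> {l..<n}"
    then show "(\<Sum>u\<in>{l..<n}. if u \<le> v then g v else 0) = (\<Sum>u\<in>{l..v}. g v)"
      by (intro sum.mono_neutral_cong_right) auto
  qed
  also have "\<dots> = (\<Sum>y\<in>{l..<n}. real (y - l + 1) * g y)" by (rule sum.cong[OF refl]) (rule eq)
  finally show ?thesis .
qed

text \<open>One fixed time l with recorded rebuild times T. The bound on n says that
  \<open>s q\<close> is at least n, so the scales reach every rank; \<open>T_recent\<close> says
  that level j was rebuilt within the last \<open>s j\<close> discoveries.\<close>

locale sorting_analysis = label_parameters +
  fixes n c l :: nat and T :: "nat \<Rightarrow> nat"
  assumes n_le: "real n \<le> 2 ^ q / p" and c_ge: "8 \<le> c"
    and T_recent: "1 \<le> j \<Longrightarrow> real l \<le> real (T j) + 2 ^ j / p"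
begin

definition s :: "nat \<Rightarrow> real" where "s j = 2 ^ j / p"
abbreviation "P \<equiv> position_law p q n"
abbreviation "prob Q \<equiv> measure_pmf.prob P {Y. Q Y}"

lemma s_pos: "0 < s j" using p_pos by (simp add: s_def)

lemma s_ge: "2 ^ j \<le> s j"
  using p_pos p_le_1 by (simp add: s_def pos_le_divide_eq mult_left_le)

lemma s_ge_1: "1 \<le> s j"
  using s_ge[of j] one_le_power[of "2::real" j] by linarith

lemma s_mono: "i \<le> j \<Longrightarrow> s i \<le> s j"
  unfolding s_def using p_pos by (intro divide_right_mono power_increasing) auto

lemma s_add: "s (i + j) = 2 ^ j * s i"
  by (simp add: s_def power_add)

lemma s_Suc: "s (Suc i) = 2 * s i"
  by (simp add: s_def)

lemma prob_conj:
  assumes "depends_on D Q" "depends_on D' R" "D \<inter> D' = {}"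
  shows "prob (\<lambda>Y. Q Y \<and> R Y) = prob Q * prob R"
  unfolding position_law_def by (rule prob_Pi_pmf_conj[OF finite_position_pairs assms])

lemma prob_conj_le:
  assumes "depends_on D Q" "depends_on D' R" "D \<inter> D' = {}" "prob Q \<le> a" "prob R \<le> b"
  shows "prob (\<lambda>Y. Q Y \<and> R Y) \<le> a * b"
proof -
  have "0 \<le> a" using assms(4) measure_nonneg order_trans by blast
  then show ?thesis unfolding prob_conj[OF assms(1-3)] using assms(4,5) by (intro mult_mono) auto
qed

lemma prob_mono:
  assumes "\<And>Y. Y \<in> set_pmf P \<Longrightarrow> Q Y \<Longrightarrow> R Y"
  shows "prob Q \<le> prob R"
  by (rule measure_pmf.finite_measure_mono_AE) (use assms in \<open>auto simp: AE_measure_pmf_iff\<close>)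

lemma prob_stochastic:
  assumes "Suc m < k" "k < n"
  shows "prob (\<lambda>Y. G (Y (m, k))) = measure_pmf.prob (independent_label_pmf p q) {X. G X}"
  unfolding position_law_def
  by (subst prob_Pi_pmf_component) (use assms finite_position_pairs in \<open>auto simp: position_pairs_def\<close>)

lemma prob_deterministic:
  assumes "Suc m < n"
  shows "prob (\<lambda>Y. G (Y (m, Suc m))) = measure_pmf.prob (label_pmf p q) {X. G X}"
  unfolding position_law_def
  by (subst prob_Pi_pmf_component) (use assms finite_position_pairs in \<open>auto simp: position_pairs_def\<close>)

lemma prob_label: "Suc m < k \<Longrightarrow> k < n \<Longrightarrow> 1 \<le> j \<Longrightarrow> j \<le> q \<Longrightarrow> prob (\<lambda>Y. Y (m, k) j) = pr j"
  by (subst prob_stochastic) (auto simp: prob_independent_label)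

lemma prob_edge: "Suc m < k \<Longrightarrow> k < n \<Longrightarrow> prob (\<lambda>Y. labelled q (Y (m, k))) = p"
  by (subst prob_stochastic) (auto simp: prob_independent_labelled)

lemma prob_above: "Suc m < k \<Longrightarrow> k < n \<Longrightarrow> 1 \<le> h \<Longrightarrow>
    prob (\<lambda>Y. \<exists>j. h \<le> j \<and> j \<le> q \<and> Y (m, k) j) \<le> 4 / s h"
  using prob_independent_label_above[of h] by (subst prob_stochastic) (auto simp: s_def)

lemma pr_le_s: "pr j \<le> 2 / s j"
  using pr_le[of j] by (simp add: s_def)

lemma depends_on_component: "depends_on {x} (\<lambda>Y. G (Y x))"
  by (rule depends_onI) auto

section \<open>Robustness and windows of potential blockers\<close>

lemma robust_rel: "robust q (rel Y) h t k \<longleftrightarrow> (\<forall>m j. t \<le> m \<and> m < k \<and> h \<le> j \<and> j \<le> q \<longrightarrow> \<not> Y (m, k) j)"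
  unfolding robust_def rel_def by (auto simp: min_def max_def)

lemma depends_on_robust: "depends_on {(m, k) |m. t \<le> m \<and> m < k} (\<lambda>Y. robust q (rel Y) h t k)"
  unfolding robust_rel by (rule depends_onI) force

lemma depends_on_not: "depends_on D Q \<Longrightarrow> depends_on D (\<lambda>Y. \<not> Q Y)"
  unfolding depends_on_def by blast

text \<open>Union bound over earlier positions. Each stochastic pair contributes 4 /
  \<open>s h\<close>; the direct predecessor is joined by a deterministic pair, whose conditioned
  label contributes 4 / 2 ^ h.\<close>

lemma prob_not_robust:
  assumes "1 \<le> h" "k < n"
  shows "prob (\<lambda>Y. \<not> robust q (rel Y) h t k) \<le> real (k - t) * (4 / s h) + 4 / 2 ^ h"
proof -
  let ?Q = "\<lambda>m Y. \<exists>j. h \<le> j \<and> j \<le> q \<and> Y (m, k) j"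
  have "{Y. \<not> robust q (rel Y) h t k} = (\<Union>m\<in>{t..<k}. {Y. ?Q m Y})"
    unfolding robust_rel by auto
  then have "prob (\<lambda>Y. \<not> robust q (rel Y) h t k) \<le> (\<Sum>m\<in>{t..<k}. prob (?Q m))"
    using measure_pmf.finite_measure_subadditive_finite[of "{t..<k}" "\<lambda>m. {Y. ?Q m Y}" P] by simp
  also have "\<dots> \<le> (\<Sum>m\<in>{t..<k}. 4 / s h + (if m = k - 1 then 4 / 2 ^ h else 0))"
  proof (rule sum_mono)
    fix m assume m: "m \<in> {t..<k}"
    show "prob (?Q m) \<le> 4 / s h + (if m = k - 1 then 4 / 2 ^ h else 0)"
    proof (cases "m = k - 1")
      case True
      then have k: "k = Suc m" using m by auto
      have "prob (?Q m) \<le> 4 / 2 ^ h"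
        using prob_deterministic[of m "\<lambda>X. \<exists>j. h \<le> j \<and> j \<le> q \<and> X j"] prob_label_above[OF assms(1)] assms(2)
        unfolding k by simp
      moreover have "0 \<le> 4 / s h" using s_pos[of h] by simp
      ultimately show ?thesis unfolding if_P[OF True] by linarith
    next
      case False
      then show ?thesis using prob_above[of m k h] m assms by auto
    qed
  qed
  also have "\<dots> \<le> real (k - t) * (4 / s h) + 4 / 2 ^ h"
    by (auto simp: sum.distrib sum.delta)
  finally show ?thesis .
qed

text \<open>
  What happens at different positions K i is independent: it concerns the pair (K i, y) and pairs
  with later element K i.
\<close>

lemma prob_unblocked:
  fixes K :: "'i \<Rightarrow> nat" and g :: "'i \<Rightarrow> real"
  assumes "finite I" "inj_on K I" "y < n" and K: "\<And>i. i \<in> I \<Longrightarrow> Suc (K i) < y"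
    and g: "\<And>i. i \<in> I \<Longrightarrow> g i = measure_pmf.prob (independent_label_pmf p q) {X. G i X}"
    and rob: "\<And>i. i \<in> I \<Longrightarrow> prob (\<lambda>Y. \<not> robust q (rel Y) (h i) (t i) (K i)) \<le> 1 / 2"
  defines "Q \<equiv> \<lambda>Y. \<forall>i\<in>I. \<not> (G i (Y (K i, y)) \<and> robust q (rel Y) (h i) (t i) (K i))"
  shows "prob Q \<le> (\<Prod>i\<in>I. 1 - g i / 2)"
    "depends_on (\<Union>i\<in>I. insert (K i, y) {(m, K i) |m. t i \<le> m \<and> m < K i}) Q"
proof -
  let ?D = "\<lambda>i. insert (K i, y) {(m, K i) |m. t i \<le> m \<and> m < K i}"
  let ?R = "\<lambda>i Y. robust q (rel Y) (h i) (t i) (K i)"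
  let ?B = "\<lambda>i Y. G i (Y (K i, y)) \<and> ?R i Y"
  have D: "depends_on (?D i) (\<lambda>Y. \<not> ?B i Y)" if "i \<in> I" for i
  proof (rule depends_on_not)
    have "depends_on ({(K i, y)} \<union> {(m, K i) |m. t i \<le> m \<and> m < K i}) (?B i)"
      by (intro depends_on_conj depends_on_component depends_on_robust)
    then show "depends_on (?D i) (?B i)" by simp
  qed
  show "depends_on (\<Union>i\<in>I. ?D i) Q" unfolding Q_def by (rule depends_on_all[OF D])
  have "prob Q = (\<Prod>i\<in>I. prob (\<lambda>Y. \<not> ?B i Y))"
    unfolding Q_def position_law_def
  proof (rule prob_Pi_pmf_all[OF finite_position_pairs assms(1) D])
    fix i i' assume i: "i \<in> I" "i' \<in> I" "i \<noteq> i'"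
    then have "K i \<noteq> K i'" using assms(2) by (auto dest: inj_onD)
    then show "?D i \<inter> ?D i' = {}" using K[OF i(1)] K[OF i(2)] by auto
  qed
  also have "\<dots> \<le> (\<Prod>i\<in>I. 1 - g i / 2)"
  proof (rule prod_mono)
    fix i assume i: "i \<in> I"
    have "prob (?B i) = prob (\<lambda>Y. G i (Y (K i, y))) * prob (?R i)"
      by (rule prob_conj[OF depends_on_component depends_on_robust]) (use K[OF i] in auto)
    moreover have "prob (\<lambda>Y. G i (Y (K i, y))) = g i"
      using prob_stochastic[OF K[OF i] assms(3), of "G i"] g[OF i] by simp
    moreover have not: "prob (\<lambda>Y. \<not> A Y) = 1 - prob A" for A
    proof -
      have "{Y. \<not> A Y} = UNIV - {Y. A Y}" by auto
      then show ?thesis using measure_pmf.prob_compl[of "{Y. A Y}" P] by simp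
    qed
    moreover have "1 / 2 \<le> prob (?R i)" using rob[OF i] not[of "?R i"] by simp
    moreover have "0 \<le> g i" using g[OF i] by simp
    ultimately have "prob (?B i) = g i * prob (?R i)" "g i * prob (?R i) \<ge> g i * (1 / 2)"
      by (simp, intro mult_left_mono)
    then have "prob (?B i) \<ge> g i * (1 / 2)" by simp
    then show "0 \<le> prob (\<lambda>Y. \<not> ?B i Y) \<and> prob (\<lambda>Y. \<not> ?B i Y) \<le> 1 - g i / 2"
      using not[of "?B i"] by simp
  qed
  finally show "prob Q \<le> (\<Prod>i\<in>I. 1 - g i / 2)" .
qed

text \<open>The bound on the probability that y is a candidate for level h. Each scale between h and
  the rank of y contributes 1/8, which is the cube of the ratio 1/2 of consecutive scales; ranks are
  counted from 1.\<close>

definition decay :: "nat \<Rightarrow> nat \<Rightarrow> real" where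
  "decay h y = min 1 ((20 * s h / real (y - l + 1)) ^ 3)"

lemma decay_nonneg: "0 \<le> decay h y"
  unfolding decay_def using s_pos[of h] by simp

lemma decay_le_1: "decay h y \<le> 1"
  unfolding decay_def by simp

lemma sum_decay: "(\<Sum>y\<in>{l..<n}. decay h y) \<le> 80 * s h"
  using sum_rank_cube(1)[of "20 * s h" l n] s_pos[of h] unfolding decay_def by simp

lemma sum_decay_max: "(\<Sum>v\<in>{l..<n}. \<Sum>u\<in>{l..<n}. decay h (max u v)) \<le> 3200 * (s h)\<^sup>2"
proof -
  have "(\<Sum>v\<in>{l..<n}. \<Sum>u\<in>{l..<n}. decay h (max u v)) \<le> 2 * (\<Sum>y\<in>{l..<n}. real (y - l + 1) * decay h y)"
    by (rule sum_max_le[OF decay_nonneg])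
  also have "\<dots> \<le> 2 * (4 * (20 * s h)\<^sup>2)"
    using sum_rank_cube(2)[of "20 * s h" l n] s_pos[of h] unfolding decay_def by (intro mult_left_mono) auto
  finally show ?thesis by (simp add: power_mult_distrib)
qed

text \<open>For scale j the window consists of positions between 8 and 16 times \<open>s j\<close>
  beyond l. Scales double, so windows of different scales are disjoint. The factor 19 leaves a gap
  between window and y, so that all pairs (k, y) are stochastic.\<close>

definition windows :: "nat \<Rightarrow> nat \<Rightarrow> nat \<Rightarrow> (nat \<times> nat) set" where
  "windows h y z = {(j, k). h \<le> j \<and> j \<le> q \<and> 19 * s j \<le> real (y - l + 1) \<and>
     real l + 8 * s j < real k \<and> real k \<le> real l + 16 * s j \<and> k \<noteq> z}"

definition unblocked :: "nat \<Rightarrow> nat \<Rightarrow> nat \<Rightarrow> (nat \<times> nat \<Rightarrow> nat \<Rightarrow> bool) \<Rightarrow> bool" where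
  "unblocked h y z Y \<longleftrightarrow>
     (\<forall>(j, k)\<in>windows h y z. \<not> (Y (k, y) j \<and> robust q (rel Y) (j + c) (T j) k))"

text \<open>
  A set that contains all pairs on which unblocked h y z depends. The position z is exempt, so that
  edges between z and y and the robustness of z remain independent of it.
\<close>

definition zone :: "nat \<Rightarrow> nat \<Rightarrow> nat \<Rightarrow> (nat \<times> nat) set" where
  "zone h y z = {(a, b). (b = y \<and> a \<noteq> z \<and> a < y \<and> real l + 8 * s h < real a) \<or>
     (b < y \<and> b \<noteq> z \<and> real l + 8 * s h < real b)}"

lemma windows_before: "(j, k) \<in> windows h y z \<Longrightarrow> l \<le> y \<Longrightarrow> Suc k < y"
proof -
  assume *: "(j, k) \<in> windows h y z" "l \<le> y"
  then have "19 * s j \<le> real y - real l + 1" "real k \<le> real l + 16 * s j"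
    unfolding windows_def by (auto simp: of_nat_diff)
  then have "real k + 1 < real y" using s_ge_1[of j] by linarith
  then show ?thesis by linarith
qed

lemma unblocked_cand:
  assumes "y \<in> candidates n q c (rel Y) l T h"
  shows "unblocked h y z Y"
  unfolding unblocked_def
proof (clarify)
  fix j k assume *: "(j, k) \<in> windows h y z" "Y (k, y) j" "robust q (rel Y) (j + c) (T j) k"
  have "l \<le> y" using assms unfolding candidates_def by simp
  then have "k < y" using windows_before[OF *(1)] by simp
  moreover have "l \<le> k"
  proof -
    have "real l + 8 * s j < real k" using *(1) unfolding windows_def by simp
    then show ?thesis using s_pos[of j] by linarith
  qed
  moreover have "h \<le> j" "j \<le> q" using *(1) unfolding windows_def by auto
  moreover have "rel Y k y j" using *(2) \<open>k < y\<close> unfolding rel_def by (simp add: min_def max_def)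
  ultimately show False using assms *(3) unfolding candidates_def by auto
qed

text \<open>The half-open interval has length 8 * x; rounding loses less than one position, the
  exempt z at most one more.\<close>

lemma card_window:
  assumes "1 \<le> x"
  shows "8 * x - 2 \<le> real (card {k. real l + 8 * x < real k \<and> real k \<le> real l + 16 * x \<and> k \<noteq> z})"
    (is "_ \<le> real (card ?W)")
proof -
  let ?V = "{l + nat \<lfloor>8 * x\<rfloor> + 1..l + nat \<lfloor>16 * x\<rfloor>} - {z}"
  have "?V \<subseteq> ?W"
  proof
    fix k assume k: "k \<in> ?V"
    then have "l + nat \<lfloor>8 * x\<rfloor> + 1 \<le> k" "k \<le> l + nat \<lfloor>16 * x\<rfloor>" by auto
    then have "real l + real_of_int \<lfloor>8 * x\<rfloor> + 1 \<le> real k" "real k \<le> real l + real_of_int \<lfloor>16 * x\<rfloor>"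
      using assms by linarith+
    then have "real l + 8 * x < real k" "real k \<le> real l + 16 * x" by linarith+
    then show "k \<in> ?W" using k by simp
  qed
  moreover have "?W \<subseteq> {..nat \<lceil>real l + 16 * x\<rceil>}" by (auto simp: le_nat_iff) linarith
  then have "finite ?W" using finite_subset by blast
  ultimately have "card ?V \<le> card ?W" by (intro card_mono)
  moreover have "card {l + nat \<lfloor>8 * x\<rfloor> + 1..l + nat \<lfloor>16 * x\<rfloor>} - 1 \<le> card ?V"
    using diff_card_le_card_Diff[of "{z}" "{l + nat \<lfloor>8 * x\<rfloor> + 1..l + nat \<lfloor>16 * x\<rfloor>}"] by simp
  ultimately have "nat \<lfloor>16 * x\<rfloor> - nat \<lfloor>8 * x\<rfloor> - 1 \<le> card ?W" by simp
  then have "\<lfloor>16 * x\<rfloor> - \<lfloor>8 * x\<rfloor> - 1 \<le> int (card ?W)" using assms by linarith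
  then have "real_of_int (\<lfloor>16 * x\<rfloor> - \<lfloor>8 * x\<rfloor> - 1) \<le> real (card ?W)" by linarith
  then show ?thesis by linarith
qed

text \<open>Position k is at most 17 \<open>s j\<close> beyond T j: 16 from the window and 1 from
  the age of the last rebuild. The union bound gives 68 / 2 ^ c plus 4 / 2 ^ c for the direct
  predecessor, and 72 / 2 ^ 8 is below 1/2. The lower bound 8 for c comes from here.\<close>

lemma prob_window_robust:
  assumes "1 \<le> j" "k < n" "real k \<le> real l + 16 * s j"
  shows "prob (\<lambda>Y. \<not> robust q (rel Y) (j + c) (T j) k) \<le> 1 / 2"
proof -
  have "prob (\<lambda>Y. \<not> robust q (rel Y) (j + c) (T j) k) \<le> real (k - T j) * (4 / s (j + c)) + 4 / 2 ^ (j + c)"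
    by (rule prob_not_robust) (use assms in auto)
  also have "\<dots> \<le> 17 * s j * (4 / s (j + c)) + 4 / 2 ^ (j + c)"
  proof -
    have "real (k - T j) \<le> 17 * s j" using T_recent[OF assms(1)] assms(3) s_pos[of j] unfolding s_def by linarith
    then show ?thesis using s_pos[of "j + c"] by (intro add_right_mono mult_right_mono) auto
  qed
  also have "17 * s j * (4 / s (j + c)) = 68 / 2 ^ c" using s_pos[of j] by (simp add: s_add)
  also have "68 / 2 ^ c + 4 / 2 ^ (j + c) \<le> 68 / 2 ^ c + 4 / (2::real) ^ c"
    by (intro add_left_mono divide_left_mono power_increasing) auto
  also have "\<dots> \<le> 72 / 2 ^ 8"
  proof -
    have "(2::real) ^ 8 \<le> 2 ^ c" by (intro power_increasing c_ge) simp
    then have "72 / (2::real) ^ c \<le> 72 / 2 ^ 8" by (intro divide_left_mono) auto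
    then show ?thesis by simp
  qed
  finally show ?thesis by simp
qed

lemma power_le_exp:
  fixes x :: real
  assumes "0 \<le> x" "x \<le> 1"
  shows "(1 - x) ^ m \<le> exp (- (x * real m))"
proof -
  have "(1 - x) ^ m \<le> exp (- x) ^ m"
    using assms exp_ge_add_one_self[of "- x"] by (intro power_mono) auto
  also have "\<dots> = exp (- (x * real m))" by (simp add: exp_of_nat_mult[symmetric] mult.commute)
  finally show ?thesis .
qed

text \<open>A position of the window blocks with probability at least half of \<open>pr j\<close>,
  which is at least 1 / \<open>s j\<close>. With 8 * \<open>s j\<close> - 2 positions the exponent
  is at least 4 - 1 / \<open>s j\<close>, hence at least 3, and exp 3 is at least 8.\<close>

lemma window_factor:
  assumes "1 \<le> j" "8 * s j - 2 \<le> real m"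
  shows "(1 - pr j / 2) ^ m \<le> 1 / 8"
proof -
  define x where "x = pr j"
  have pr: "0 \<le> x" "x \<le> 1" "1 / s j \<le> x" using pr_range[OF assms(1)] pr_ge[of j] by (auto simp: s_def x_def)
  have "3 \<le> 4 - 1 / s j" using s_ge_1[of j] by simp
  also have "\<dots> = 1 / s j * (4 * s j - 1)" using s_pos[of j] by (simp add: field_simps)
  also have "\<dots> \<le> x * (4 * s j - 1)" using pr s_ge_1[of j] by (intro mult_right_mono) auto
  also have "\<dots> = x / 2 * (8 * s j - 2)" by (simp add: field_simps)
  also have "\<dots> \<le> x / 2 * real m" using assms(2) pr by (intro mult_left_mono) auto
  finally have e: "3 \<le> x / 2 * real m" .
  have "(1 - pr j / 2) ^ m = (1 - x / 2) ^ m" by (simp add: x_def)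
  also have "\<dots> \<le> exp (- (x / 2 * real m))"
    by (rule power_le_exp) (use pr in auto)
  also have "\<dots> \<le> exp (- 3)" using e by simp
  also have "\<dots> = 1 / exp 1 ^ 3" by (simp add: exp_minus exp_of_nat_mult[of 3 "1::real", symmetric] inverse_eq_divide)
  also have "\<dots> \<le> 1 / 2 ^ 3"
    using exp_ge_add_one_self[of "1::real"] by (intro divide_left_mono power_mono) auto
  finally show ?thesis by simp
qed

lemma finite_windows: "finite (windows h y z)"
proof (rule finite_subset)
  show "windows h y z \<subseteq> {h..q} \<times> {..nat \<lceil>real l + 16 * s q\<rceil>}"
  proof clarify
    fix j k assume *: "(j, k) \<in> windows h y z"
    then have "s j \<le> s q" "real k \<le> real l + 16 * s j" unfolding windows_def by (auto intro: s_mono)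
    then have "real k \<le> real l + 16 * s q" by linarith
    then have "k \<le> nat \<lceil>real l + 16 * s q\<rceil>" by linarith
    then show "j \<in> {h..q} \<and> k \<in> {..nat \<lceil>real l + 16 * s q\<rceil>}" using * unfolding windows_def by auto
  qed
qed auto

text \<open>Let m be the largest usable scale. Then the rank is below 19 * \<open>s (Suc m)\<close>,
  and the scales h to m give (1/8)^(m + 1 - h), the cube of \<open>s h / s (Suc m)\<close>. This
  explains the constant 20 and the cube in \<open>decay\<close>.\<close>

lemma geometric_decay:
  assumes "1 \<le> h" "l \<le> y" "y < n"
  shows "(1 / 8) ^ card {j \<in> {h..q}. 19 * s j \<le> real (y - l + 1)} \<le> decay h y"
proof -
  let ?d = "real (y - l + 1)" and ?J = "{j \<in> {h..q}. 19 * s j \<le> real (y - l + 1)}"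
  have dn: "?d \<le> s q" using assms n_le unfolding s_def by linarith
  have "(1 / 8 :: real) ^ card ?J \<le> (20 * s h / ?d) ^ 3"
  proof (cases "20 * s h \<le> ?d")
    case False
    then have "1 \<le> 20 * s h / ?d" by (simp add: pos_le_divide_eq)
    then have "1 \<le> (20 * s h / ?d) ^ 3" by (rule one_le_power)
    moreover have "(1 / 8 :: real) ^ card ?J \<le> 1" by (intro power_le_one) auto
    ultimately show ?thesis by linarith
  next
    case True
    have "h \<le> q"
    proof (rule ccontr)
      assume "\<not> h \<le> q"
      then have "s q \<le> s h" by (intro s_mono) auto
      then show False using True dn s_pos[of q] s_pos[of h] by linarith
    qed
    then have "h \<in> ?J" using True s_pos[of h] by auto
    define m where "m = Max ?J"
    have "m \<in> ?J" unfolding m_def using \<open>h \<in> ?J\<close> by (intro Max_in) auto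
    then have m: "h \<le> m" "m \<le> q" "19 * s m \<le> ?d" by auto
    \<comment> \<open>The rank is at most \<open>s q\<close>, so scale q is not usable; scale
      \<open>Suc m\<close> is then still in range and fails only because it is too large for the
      rank.\<close>
    have "m \<noteq> q" using m(3) dn s_pos[of q] by auto
    have "Suc m \<notin> ?J" using Max_ge[of ?J "Suc m"] unfolding m_def by fastforce
    then have big: "?d < 19 * s (Suc m)" using m \<open>m \<noteq> q\<close> by auto
    have "{h..m} \<subseteq> ?J"
    proof
      fix j assume "j \<in> {h..m}"
      then have "s j \<le> s m" by (intro s_mono) auto
      then have "19 * s j \<le> ?d" using m(3) by linarith
      then show "j \<in> ?J" using \<open>j \<in> {h..m}\<close> m by auto
    qed
    then have "card {h..m} \<le> card ?J" by (intro card_mono) auto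
    then have "(1 / 8 :: real) ^ card ?J \<le> (1 / 8) ^ (Suc m - h)" by (intro power_decreasing) auto
    also have "\<dots> = ((1 / 2) ^ (Suc m - h)) ^ 3"
      unfolding power_mult[symmetric] mult.commute[of _ 3] unfolding power_mult by (simp add: power3_eq_cube)
    also have "(1 / 2) ^ (Suc m - h) = s h / s (Suc m)"
    proof -
      have "s (Suc m) = 2 ^ (Suc m - h) * s h" using s_add[of h "Suc m - h"] m by simp
      then show ?thesis using s_pos[of h] by (simp add: power_one_over)
    qed
    also have "(s h / s (Suc m)) ^ 3 \<le> (20 * s h / ?d) ^ 3"
    proof (rule power_mono)
      have "s h * ?d \<le> s h * (20 * s (Suc m))" using big s_pos[of h] s_pos[of "Suc m"] by (intro mult_left_mono) auto
      then show "s h / s (Suc m) \<le> 20 * s h / ?d" using s_pos[of "Suc m"] by (simp add: field_simps)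
      show "0 \<le> s h / s (Suc m)" using s_pos[of h] s_pos[of "Suc m"] by simp
    qed
    finally show ?thesis .
  qed
  moreover have "(1 / 8 :: real) ^ card ?J \<le> 1" by (intro power_le_one) auto
  ultimately show ?thesis unfolding decay_def by simp
qed

text \<open>Distinct windows have distinct positions, so \<open>prob_unblocked\<close> applies to
  all windows at once, and the product factors into one power per scale.\<close>

lemma unblocked_bounds:
  assumes "1 \<le> h" "l \<le> y" "y < n"
  shows "prob (unblocked h y z) \<le> decay h y" "depends_on (zone h y z) (unblocked h y z)"
proof -
  let ?I = "windows h y z"
  have unb: "unblocked h y z = (\<lambda>Y. \<forall>i\<in>?I. \<not> ((\<lambda>X. X (fst i)) (Y (snd i, y)) \<and>
      robust q (rel Y) (fst i + c) (T (fst i)) (snd i)))"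
    unfolding unblocked_def by (auto simp: fun_eq_iff)
  have inj: "inj_on snd ?I"
  proof (rule inj_onI)
    fix i i' assume *: "i \<in> ?I" "i' \<in> ?I" "snd i = snd i'"
    \<comment> \<open>The window of scale a ends at 16 * \<open>s a\<close>, at most 8 *
      \<open>s b\<close>, where the window of scale b has not yet begun.\<close>
    have False if "a < b" "(a, k) \<in> ?I" "(b, k) \<in> ?I" for a b k
    proof -
      have "2 * s a \<le> s b" using s_mono[of "Suc a" b] that(1) by (simp add: s_def)
      moreover have "real k \<le> real l + 16 * s a" "real l + 8 * s b < real k"
        using that(2,3) unfolding windows_def by auto
      ultimately show False by linarith
    qed
    moreover have "(fst i, snd i) \<in> ?I" using *(1) by simp
    moreover have "(fst i', snd i) \<in> ?I" unfolding *(3) using *(2) by simp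
    ultimately have "fst i = fst i'" by (metis linorder_neqE_nat)
    with * show "i = i'" by (simp add: prod_eq_iff)
  qed
  have before: "Suc (snd i) < y" if "i \<in> ?I" for i
    using windows_before[of "fst i" "snd i" h y z] that assms by simp
  have g: "pr (fst i) = measure_pmf.prob (independent_label_pmf p q) {X. X (fst i)}" if "i \<in> ?I" for i
    using that assms by (subst prob_independent_label) (auto simp: windows_def)
  have rob: "prob (\<lambda>Y. \<not> robust q (rel Y) (fst i + c) (T (fst i)) (snd i)) \<le> 1 / 2" if "i \<in> ?I" for i
    by (rule prob_window_robust) (use that assms before[OF that] in \<open>auto simp: windows_def\<close>)
  note pu = prob_unblocked[where I = ?I and K = snd and G = "\<lambda>i X. X (fst i)" and g = "\<lambda>i. pr (fst i)"
     and h = "\<lambda>i. fst i + c" and t = "\<lambda>i. T (fst i)", OF finite_windows inj assms(3) before g rob]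
  show "depends_on (zone h y z) (unblocked h y z)"
    unfolding unb
  proof (rule depends_on_mono[OF pu(2)])
    have "real l + 8 * s h < real (snd i) \<and> snd i \<noteq> z" if "i \<in> ?I" for i
    proof -
      have "s h \<le> s (fst i)" using that by (intro s_mono) (auto simp: windows_def)
      then show ?thesis using that unfolding windows_def by auto
    qed
    then show "(\<Union>i\<in>?I. insert (snd i, y) {(m, snd i) |m. T (fst i) \<le> m \<and> m < snd i}) \<subseteq> zone h y z"
      using before unfolding zone_def by fastforce
  qed
  let ?J = "{j \<in> {h..q}. 19 * s j \<le> real (y - l + 1)}"
  let ?W = "\<lambda>j. {k. real l + 8 * s j < real k \<and> real k \<le> real l + 16 * s j \<and> k \<noteq> z}"
  have finW: "finite (?W j)" for j
  proof (rule finite_subset)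
    show "?W j \<subseteq> {..nat \<lceil>real l + 16 * s j\<rceil>}" by (auto simp: le_nat_iff) linarith
  qed auto
  have "prob (unblocked h y z) \<le> (\<Prod>i\<in>?I. 1 - pr (fst i) / 2)" unfolding unb by (rule pu(1))
  also have "?I = Sigma ?J ?W" unfolding windows_def by auto
  also have "(\<Prod>i\<in>Sigma ?J ?W. 1 - pr (fst i) / 2) = (\<Prod>j\<in>?J. \<Prod>k\<in>?W j. 1 - pr j / 2)"
    by (subst prod.Sigma) (use finW in \<open>auto simp: case_prod_beta\<close>)
  also have "\<dots> \<le> (\<Prod>j\<in>?J. 1 / 8)"
  proof (rule prod_mono)
    fix j assume j: "j \<in> ?J"
    have "1 \<le> j" using j assms by auto
    have "(1 - pr j / 2) ^ card (?W j) \<le> 1 / 8"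
      by (rule window_factor[OF \<open>1 \<le> j\<close> card_window[OF s_ge_1]])
    moreover have "0 \<le> (1 - pr j / 2) ^ card (?W j)" 
    proof (rule zero_le_power)
      define x where "x = pr j"
      have "x \<le> 1" using pr_range[OF \<open>1 \<le> j\<close>] by (simp add: x_def)
      then have "0 \<le> 1 - x / 2" by simp
      then show "0 \<le> 1 - pr j / 2" unfolding x_def .
    qed
    ultimately show "0 \<le> (\<Prod>k\<in>?W j. 1 - pr j / 2) \<and> (\<Prod>k\<in>?W j. 1 - pr j / 2) \<le> 1 / 8" by simp
  qed
  also have "\<dots> = (1 / 8) ^ card ?J" by simp
  also have "\<dots> \<le> decay h y" by (rule geometric_decay[OF assms])
  finally show "prob (unblocked h y z) \<le> decay h y" .
qed

end

section \<open>Expected cost of rebuilds and incremental updates\<close>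

lemma card_le_far:
  fixes A F :: "nat set"
  assumes "A \<subseteq> {l..<n}" "finite F"
  shows "real (card {u \<in> A. R u}) \<le> real (card F) + (\<Sum>u\<in>{l..<n} - F. of_bool (u \<in> A \<and> R u))"
proof -
  have fin: "finite {u \<in> A. R u}" using assms(1) finite_subset[of A "{l..<n}"] by auto
  have "{u \<in> A. R u} \<subseteq> F \<union> {u \<in> {l..<n} - F. u \<in> A \<and> R u}" using assms(1) by auto
  then have "card {u \<in> A. R u} \<le> card (F \<union> {u \<in> {l..<n} - F. u \<in> A \<and> R u})"
    by (intro card_mono) (use assms in auto)
  also have "\<dots> \<le> card F + card {u \<in> {l..<n} - F. u \<in> A \<and> R u}" by (rule card_Un_le)
  finally have "real (card {u \<in> A. R u}) \<le> real (card F) + real (card {u \<in> {l..<n} - F. u \<in> A \<and> R u})" by simp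
  also have "real (card {u \<in> {l..<n} - F. u \<in> A \<and> R u}) = (\<Sum>u\<in>{l..<n} - F. of_bool (u \<in> A \<and> R u))"
    by (simp add: Int_def of_bool_def sum.If_cases)
  finally show ?thesis .
qed

lemma sum_first:
  fixes f :: "nat \<Rightarrow> real"
  assumes "l < n"
  shows "sum f {l..<n} = f l + sum f {l<..<n}"
proof -
  have "{l..<n} = insert l {l<..<n}" using assms by auto
  then show ?thesis by simp
qed

text \<open>The positions joined to v by a deterministic pair, and v itself. Their edges gain no
  factor p and are counted as at most 3.\<close>

definition near :: "nat \<Rightarrow> nat set" where
  "near v = {v - 1, v, v + 1}"

lemma finite_near [simp]: "finite (near v)"
  unfolding near_def by simp

lemma card_near: "card (near v) \<le> 3"
  unfolding near_def by (auto simp: card_insert_if)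

lemma not_near: "u \<notin> near v \<Longrightarrow> Suc (min u v) < max u v"
  unfolding near_def by (auto simp: min_def max_def)

context sorting_analysis
begin

abbreviation "expect f \<equiv> measure_pmf.expectation P f"
abbreviation "cands Y h \<equiv> candidates n q c (rel Y) l T h"
abbreviation "edge Y a b \<equiv> labelled q (rel Y a b)"

lemma integrable_P [simp]: "integrable (measure_pmf P) (f :: _ \<Rightarrow> real)"
  by (rule integrable_measure_pmf_finite[OF finite_set_position_law])

lemma expect_mono: "(\<And>Y. Y \<in> set_pmf P \<Longrightarrow> f Y \<le> g Y) \<Longrightarrow> expect f \<le> expect (g :: _ \<Rightarrow> real)"
  by (rule integral_mono_AE) (auto simp: AE_measure_pmf_iff)

lemma expect_of_bool [simp]: "expect (\<lambda>Y. of_bool (Q Y)) = prob Q"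
proof -
  have "(\<lambda>Y. of_bool (Q Y) :: real) = indicator {Y. Q Y}" by (auto simp: fun_eq_iff indicator_def)
  then show ?thesis by simp
qed

lemma rel_less: "m < k \<Longrightarrow> rel Y m k = Y (m, k)" "m < k \<Longrightarrow> rel Y k m = Y (m, k)"
  unfolding rel_def by (simp_all add: min_def max_def)

lemma cands_subset: "cands Y h \<subseteq> {l..<n}"
  by (rule candidates_subset)

lemma not_in_zone:
  "(z, y) \<notin> zone h y z" "k \<le> l \<Longrightarrow> v = y \<or> v = z \<Longrightarrow> z < y \<Longrightarrow> (k, v) \<notin> zone h y z"
  using s_pos[of h] unfolding zone_def by auto

text \<open>Of the two endpoints only the later one is required to be unblocked. Exempting the
  earlier one from its windows makes the event independent of the pair itself.\<close>

lemma prob_pair_unblocked: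
  assumes "1 \<le> i" "i \<le> q" "1 \<le> h" "u \<in> {l..<n} - near v" "v \<in> {l..<n}"
  shows "prob (\<lambda>Y. rel Y u v i \<and> unblocked h (max u v) (min u v) Y) \<le> pr i * decay h (max u v)"
proof -
  have far: "Suc (min u v) < max u v" using not_near assms by auto
  have y: "l \<le> max u v" "max u v < n" using assms by auto
  show ?thesis unfolding rel_def
    by (rule prob_conj_le[OF depends_on_component unblocked_bounds(2)[OF assms(3) y]])
      (use not_in_zone(1) prob_label[OF far y(2) assms(1,2)] unblocked_bounds(1)[OF assms(3) y] in auto)
qed

lemma build_cost_pointwise:
  "real (position_build_cost n q c (rel Y) l T i) \<le>
    (\<Sum>v\<in>{l..<n}. 3 * of_bool (unblocked (i + 1) v v Y) +
       (\<Sum>u\<in>{l..<n} - near v. of_bool (rel Y u v i \<and> unblocked (i + c) (max u v) (min u v) Y)))"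
proof -
  have sub: "cands Y (i + 1) \<subseteq> cands Y (i + c)" by (rule candidates_mono_level) (use c_ge in simp)
  have "real (position_build_cost n q c (rel Y) l T i) \<le> (\<Sum>v\<in>cands Y (i + 1). 3 * of_bool (unblocked (i + 1) v v Y) +
       (\<Sum>u\<in>{l..<n} - near v. of_bool (rel Y u v i \<and> unblocked (i + c) (max u v) (min u v) Y)))"
    unfolding position_build_cost_def of_nat_sum
  proof (rule sum_mono)
    fix v assume v: "v \<in> cands Y (i + 1)"
    have "real (card {u \<in> cands Y (i + c). rel Y u v i}) \<le>
      real (card (near v)) + (\<Sum>u\<in>{l..<n} - near v. of_bool (u \<in> cands Y (i + c) \<and> rel Y u v i))"
      by (rule card_le_far[OF cands_subset]) simp
    also have "\<dots> \<le> 3 * of_bool (unblocked (i + 1) v v Y) +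
       (\<Sum>u\<in>{l..<n} - near v. of_bool (rel Y u v i \<and> unblocked (i + c) (max u v) (min u v) Y))"
    proof (intro add_mono sum_mono)
      show "real (card (near v)) \<le> 3 * of_bool (unblocked (i + 1) v v Y)"
        using card_near[of v] unblocked_cand[OF v] by simp
      fix u
      \<comment> \<open>Both endpoints are candidates for the larger level i + c, hence so is the
        later one.\<close>
      have "unblocked (i + c) (max u v) (min u v) Y" if "u \<in> cands Y (i + c)"
        using that v sub unblocked_cand[of _ Y "i + c"] by (cases "u \<le> v") (auto simp: max_def)
      then show "of_bool (u \<in> cands Y (i + c) \<and> rel Y u v i) \<le>
        (of_bool (rel Y u v i \<and> unblocked (i + c) (max u v) (min u v) Y) :: real)" by auto
    qed
    finally show "real (card {u \<in> cands Y (i + c). rel Y u v i}) \<le> 3 * of_bool (unblocked (i + 1) v v Y) +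
       (\<Sum>u\<in>{l..<n} - near v. of_bool (rel Y u v i \<and> unblocked (i + c) (max u v) (min u v) Y))" .
  qed
  also have "\<dots> \<le> (\<Sum>v\<in>{l..<n}. 3 * of_bool (unblocked (i + 1) v v Y) +
       (\<Sum>u\<in>{l..<n} - near v. of_bool (rel Y u v i \<and> unblocked (i + c) (max u v) (min u v) Y)))"
    by (rule sum_mono2) (use cands_subset in \<open>auto intro!: add_nonneg_nonneg sum_nonneg\<close>)
  finally show ?thesis .
qed

lemma expected_build_cost:
  assumes "1 \<le> i" "i \<le> q"
  shows "expect (\<lambda>Y. real (position_build_cost n q c (rel Y) l T i)) \<le>
    3 * (\<Sum>v\<in>{l..<n}. decay (i + 1) v) + pr i * (\<Sum>v\<in>{l..<n}. \<Sum>u\<in>{l..<n}. decay (i + c) (max u v))"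
proof -
  have "expect (\<lambda>Y. real (position_build_cost n q c (rel Y) l T i)) \<le>
    expect (\<lambda>Y. \<Sum>v\<in>{l..<n}. 3 * of_bool (unblocked (i + 1) v v Y) +
       (\<Sum>u\<in>{l..<n} - near v. of_bool (rel Y u v i \<and> unblocked (i + c) (max u v) (min u v) Y)))"
    by (rule expect_mono) (rule build_cost_pointwise)
  also have "\<dots> = (\<Sum>v\<in>{l..<n}. 3 * prob (unblocked (i + 1) v v) +
       (\<Sum>u\<in>{l..<n} - near v. prob (\<lambda>Y. rel Y u v i \<and> unblocked (i + c) (max u v) (min u v) Y)))"
    by (simp add: Bochner_Integration.integral_sum Bochner_Integration.integral_add del: sum_of_bool_eq)
  also have "\<dots> \<le> (\<Sum>v\<in>{l..<n}. 3 * decay (i + 1) v + (\<Sum>u\<in>{l..<n} - near v. pr i * decay (i + c) (max u v)))"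
    by (intro sum_mono add_mono mult_left_mono unblocked_bounds prob_pair_unblocked) (use assms in auto)
  also have "\<dots> \<le> (\<Sum>v\<in>{l..<n}. 3 * decay (i + 1) v + (\<Sum>u\<in>{l..<n}. pr i * decay (i + c) (max u v)))"
    by (intro sum_mono add_left_mono sum_mono2 mult_nonneg_nonneg decay_nonneg
        conjunct1[OF pr_range[OF assms(1)]] finite_atLeastLessThan Diff_subset)
  also have "\<dots> = 3 * (\<Sum>v\<in>{l..<n}. decay (i + 1) v) + pr i * (\<Sum>v\<in>{l..<n}. \<Sum>u\<in>{l..<n}. decay (i + c) (max u v))"
    by (simp add: sum.distrib sum_distrib_left)
  finally show ?thesis .
qed

text \<open>The first bound multiplies the second moment, of order
  \<open>(s (i + c))\<^sup>2\<close>, by the label probability of order 1 / \<open>s i\<close>. The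
  second serves the initial build, which is not amortised over time: if \<open>s i\<close> exceeds
  n, all pairs together contribute at most n * n * 2 / \<open>s i\<close>.\<close>

lemma expected_build_cost_le:
  assumes "1 \<le> i" "i \<le> q"
  shows "expect (\<lambda>Y. real (position_build_cost n q c (rel Y) l T i)) \<le> 7000 * 4 ^ c * s i"
    "expect (\<lambda>Y. real (position_build_cost n q c (rel Y) l T i)) \<le> 7000 * 4 ^ c * real n"
proof -
  have c4: "1 \<le> (4::real) ^ c" by simp
  have pr: "pr i \<le> 2 / s i" "0 \<le> pr i" using pr_le_s pr_range[OF assms(1)] by auto
  have "expect (\<lambda>Y. real (position_build_cost n q c (rel Y) l T i)) \<le> 3 * (80 * s (i + 1)) + 2 / s i * (3200 * (s (i + c))\<^sup>2)"
  proof -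
    have "pr i * (\<Sum>v\<in>{l..<n}. \<Sum>u\<in>{l..<n}. decay (i + c) (max u v)) \<le> 2 / s i * (3200 * (s (i + c))\<^sup>2)"
      by (intro mult_mono sum_decay_max pr(1)) (use s_pos[of i] decay_nonneg in \<open>auto intro!: sum_nonneg\<close>)
    then show ?thesis using expected_build_cost[OF assms] sum_decay[of "i + 1"] by linarith
  qed
  also have "\<dots> = 480 * s i + 6400 * (2 ^ c)\<^sup>2 * s i"
    using s_pos[of i] by (simp add: s_add s_Suc power2_eq_square)
  also have "(2 ^ c)\<^sup>2 = (4::real) ^ c" by (simp add: power2_eq_square power_mult_distrib[symmetric])
  also have "480 * s i + 6400 * 4 ^ c * s i \<le> 480 * (4 ^ c * s i) + 6400 * 4 ^ c * s i"
    using c4 s_pos[of i] by (intro add_right_mono mult_left_mono) auto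
  also have "\<dots> \<le> 7000 * 4 ^ c * s i" using s_pos[of i] by (simp add: algebra_simps)
  finally show 1: "expect (\<lambda>Y. real (position_build_cost n q c (rel Y) l T i)) \<le> 7000 * 4 ^ c * s i" .
  show "expect (\<lambda>Y. real (position_build_cost n q c (rel Y) l T i)) \<le> 7000 * 4 ^ c * real n"
  proof (cases "s i \<le> real n")
    case True
    then have "7000 * 4 ^ c * s i \<le> 7000 * 4 ^ c * real n" by (intro mult_left_mono) auto
    then show ?thesis using 1 by linarith
  next
    case False
    have d1: "(\<Sum>v\<in>{l..<n}. decay (i + 1) v) \<le> (\<Sum>v\<in>{l..<n}. 1)" by (intro sum_mono decay_le_1)
    have "(\<Sum>v\<in>{l..<n}. \<Sum>u\<in>{l..<n}. decay (i + c) (max u v)) \<le> (\<Sum>v\<in>{l..<n}. \<Sum>u\<in>{l..<n}. 1)"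
      by (intro sum_mono decay_le_1)
    also have "\<dots> = real (n - l) * real (n - l)"
      by (simp only: sum_constant card_atLeastLessThan mult_1_right)
    finally have d2: "(\<Sum>v\<in>{l..<n}. \<Sum>u\<in>{l..<n}. decay (i + c) (max u v)) \<le> real (n - l) * real (n - l)" .
    have "real (n - l) * real (n - l) \<le> real n * s i" using False by (intro mult_mono) auto
    then have "2 / s i * (real (n - l) * real (n - l)) \<le> 2 / s i * (real n * s i)"
      using s_pos[of i] by (intro mult_left_mono) auto
    also have "\<dots> = 2 * real n" using s_pos[of i] by simp
    finally have "2 / s i * (real (n - l) * real (n - l)) \<le> 2 * real n" .
    moreover have "pr i * (\<Sum>v\<in>{l..<n}. \<Sum>u\<in>{l..<n}. decay (i + c) (max u v)) \<le> 2 / s i * (real (n - l) * real (n - l))"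
      by (intro mult_mono pr(1) d2) (use s_pos[of i] decay_nonneg in \<open>auto intro!: sum_nonneg\<close>)
    ultimately have "expect (\<lambda>Y. real (position_build_cost n q c (rel Y) l T i)) \<le> 5 * real n"
      using expected_build_cost[OF assms] d1 by simp
    also have "\<dots> \<le> 7000 * 4 ^ c * real n"
      by (rule mult_right_mono) (use c4 in linarith, simp)
    finally show ?thesis .
  qed
qed

lemma prob_update_pair:
  assumes "1 \<le> i" "i \<le> q" "1 \<le> h" "u \<in> {l..<n} - near v" "v \<in> {l<..<n}" "1 \<le> l"
  shows "prob (\<lambda>Y. (\<exists>j. i \<le> j \<and> j \<le> q \<and> Y (l - 1, v) j) \<and>
     (rel Y u v i \<and> unblocked h (max u v) (min u v) Y)) \<le> 4 / s i * (pr i * decay h (max u v))"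
proof -
  have far: "Suc (min u v) < max u v" using not_near assms by auto
  have y: "l \<le> max u v" "max u v < n" using assms by auto
  have v: "v = max u v \<or> v = min u v" by (auto simp: max_def min_def)
  have dep: "depends_on ({(min u v, max u v)} \<union> zone h (max u v) (min u v))
     (\<lambda>Y. rel Y u v i \<and> unblocked h (max u v) (min u v) Y)"
    unfolding rel_def by (intro depends_on_conj depends_on_component unblocked_bounds(2) assms y)
  have disj: "{(l - 1, v)} \<inter> ({(min u v, max u v)} \<union> zone h (max u v) (min u v)) = {}"
    using not_in_zone(2)[of "l - 1" v "max u v" "min u v" h] v far assms by auto
  show ?thesis
    by (rule prob_conj_le[OF depends_on_component dep disj prob_above prob_pair_unblocked])
      (use assms in auto)
qed

lemma prob_update_unblocked:
  assumes "1 \<le> i" "v \<in> {l<..<n}" "1 \<le> l"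
  shows "prob (\<lambda>Y. (\<exists>j. i \<le> j \<and> j \<le> q \<and> Y (l - 1, v) j) \<and> unblocked (i + 1) v v Y) \<le> 4 / s i * decay (i + 1) v"
proof (rule prob_conj_le[OF depends_on_component])
  show "depends_on (zone (i + 1) v v) (unblocked (i + 1) v v)" "prob (unblocked (i + 1) v v) \<le> decay (i + 1) v"
    using unblocked_bounds[of "i + 1" v v] assms by auto
  show "{(l - 1, v)} \<inter> zone (i + 1) v v = {}"
    using s_pos[of "i + 1"] assms unfolding zone_def by auto
  show "prob (\<lambda>Y. \<exists>j. i \<le> j \<and> j \<le> q \<and> Y (l - 1, v) j) \<le> 4 / s i" by (rule prob_above) (use assms in auto)
qed

text \<open>Position l is separated because its edge to the vertex just discovered is deterministic.
  Any other v needs a stochastic edge with label at least i to position l - 1, of probability at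
  most 4 / \<open>s i\<close>, which offsets the order \<open>s i\<close> of the checks.\<close>

lemma expected_update_cost:
  assumes "1 \<le> i" "i \<le> q" "1 \<le> l" "l < n"
  shows "expect (\<lambda>Y. real (position_update_cost n q c (rel Y) l T i)) \<le> 30000 * 4 ^ c"
proof -
  let ?R = "\<lambda>v Y. \<exists>j. i \<le> j \<and> j \<le> q \<and> Y (l - 1, v) j"
  let ?N = "\<lambda>u v Y. rel Y u v i \<and> unblocked (i + c) (max u v) (min u v) Y"
  have pt: "real (position_update_cost n q c (rel Y) l T i) \<le>
    (3 + (\<Sum>u\<in>{l..<n} - near l. of_bool (?N u l Y))) +
    (\<Sum>v\<in>{l<..<n}. 3 * of_bool (?R v Y \<and> unblocked (i + 1) v v Y) +
      (\<Sum>u\<in>{l..<n} - near v. of_bool (?R v Y \<and> ?N u v Y)))" for Y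
  proof -
    let ?N' = "\<lambda>v. real (card {u \<in> cands Y (i + c). rel Y u v i})"
    have sub: "cands Y (i + 1) \<subseteq> cands Y (i + c)" by (rule candidates_mono_level) (use c_ge in simp)
    have N': "?N' v \<le> 3 + (\<Sum>u\<in>{l..<n} - near v. of_bool (?N u v Y))" if "v \<in> cands Y (i + 1)" for v
    proof -
      have "?N' v \<le> real (card (near v)) + (\<Sum>u\<in>{l..<n} - near v. of_bool (u \<in> cands Y (i + c) \<and> rel Y u v i))"
        by (rule card_le_far[OF cands_subset]) simp
      also have "\<dots> \<le> 3 + (\<Sum>u\<in>{l..<n} - near v. of_bool (?N u v Y))"
      proof (intro add_mono sum_mono)
        show "real (card (near v)) \<le> 3" using card_near[of v] by simp
        fix u
        have "unblocked (i + c) (max u v) (min u v) Y" if "u \<in> cands Y (i + c)"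
          using that \<open>v \<in> _\<close> sub unblocked_cand[of _ Y "i + c"] by (cases "u \<le> v") (auto simp: max_def)
        then show "of_bool (u \<in> cands Y (i + c) \<and> rel Y u v i) \<le> (of_bool (?N u v Y) :: real)" by auto
      qed
      finally show ?thesis .
    qed
    have "real (position_update_cost n q c (rel Y) l T i) \<le>
      (\<Sum>v\<in>cands Y (i + 1). if v = l then 3 + (\<Sum>u\<in>{l..<n} - near l. of_bool (?N u l Y))
         else 3 * of_bool (?R v Y \<and> unblocked (i + 1) v v Y) + (\<Sum>u\<in>{l..<n} - near v. of_bool (?R v Y \<and> ?N u v Y)))"
      unfolding position_update_cost_def of_nat_sum
    proof (rule sum_mono)
      fix v assume v: "v \<in> cands Y (i + 1)"
      show "real (if \<exists>j\<in>{i..q}. rel Y (l - 1) v j then card {u \<in> cands Y (i + c). rel Y u v i} else 0) \<le>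
        (if v = l then 3 + (\<Sum>u\<in>{l..<n} - near l. of_bool (?N u l Y))
         else 3 * of_bool (?R v Y \<and> unblocked (i + 1) v v Y) + (\<Sum>u\<in>{l..<n} - near v. of_bool (?R v Y \<and> ?N u v Y)))"
      proof (cases "v = l")
        case True
        have "0 \<le> (\<Sum>u\<in>{l..<n} - near l. of_bool (?N u l Y) :: real)" by (intro sum_nonneg) simp
        then show ?thesis using N'[OF v] True by auto
      next
        case False
        have "l \<le> v" using v cands_subset[of Y "i + 1"] by auto
        then have "rel Y (l - 1) v = Y (l - 1, v)" using False assms by (intro rel_less) auto
        then have "(\<exists>j\<in>{i..q}. rel Y (l - 1) v j) \<longleftrightarrow> ?R v Y" by auto
        then show ?thesis using N'[OF v] False unblocked_cand[OF v, of v]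
          by (cases "?R v Y") (auto simp: sum_nonneg)
      qed
    qed
    also have "\<dots> \<le> (\<Sum>v\<in>{l..<n}. if v = l then 3 + (\<Sum>u\<in>{l..<n} - near l. of_bool (?N u l Y))
         else 3 * of_bool (?R v Y \<and> unblocked (i + 1) v v Y) + (\<Sum>u\<in>{l..<n} - near v. of_bool (?R v Y \<and> ?N u v Y)))"
      by (rule sum_mono2) (use cands_subset in \<open>auto intro!: add_nonneg_nonneg sum_nonneg\<close>)
    also have "\<dots> = (3 + (\<Sum>u\<in>{l..<n} - near l. of_bool (?N u l Y))) + (\<Sum>v\<in>{l<..<n}. if v = l then 3 + (\<Sum>u\<in>{l..<n} - near l. of_bool (?N u l Y))
         else 3 * of_bool (?R v Y \<and> unblocked (i + 1) v v Y) + (\<Sum>u\<in>{l..<n} - near v. of_bool (?R v Y \<and> ?N u v Y)))"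
      by (subst sum_first[OF assms(4)]) (simp del: sum_of_bool_eq)
    also have "(\<Sum>v\<in>{l<..<n}. if v = l then 3 + (\<Sum>u\<in>{l..<n} - near l. of_bool (?N u l Y))
         else 3 * of_bool (?R v Y \<and> unblocked (i + 1) v v Y) + (\<Sum>u\<in>{l..<n} - near v. of_bool (?R v Y \<and> ?N u v Y))) =
      (\<Sum>v\<in>{l<..<n}. 3 * of_bool (?R v Y \<and> unblocked (i + 1) v v Y) + (\<Sum>u\<in>{l..<n} - near v. of_bool (?R v Y \<and> ?N u v Y)))"
      by (rule sum.cong[OF refl], rule if_not_P) simp
    finally show ?thesis .
  qed
  have "expect (\<lambda>Y. real (position_update_cost n q c (rel Y) l T i)) \<le>
    expect (\<lambda>Y. (3 + (\<Sum>u\<in>{l..<n} - near l. of_bool (?N u l Y))) +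
    (\<Sum>v\<in>{l<..<n}. 3 * of_bool (?R v Y \<and> unblocked (i + 1) v v Y) +
      (\<Sum>u\<in>{l..<n} - near v. of_bool (?R v Y \<and> ?N u v Y))))"
    by (rule expect_mono) (rule pt)
  also have "\<dots> = (3 + (\<Sum>u\<in>{l..<n} - near l. prob (?N u l))) +
    (\<Sum>v\<in>{l<..<n}. 3 * prob (\<lambda>Y. ?R v Y \<and> unblocked (i + 1) v v Y) +
      (\<Sum>u\<in>{l..<n} - near v. prob (\<lambda>Y. ?R v Y \<and> ?N u v Y)))"
    by (simp add: Bochner_Integration.integral_sum Bochner_Integration.integral_add del: sum_of_bool_eq)
  also have "\<dots> \<le> (3 + (\<Sum>u\<in>{l..<n} - near l. pr i * decay (i + c) (max u l))) +
    (\<Sum>v\<in>{l<..<n}. 3 * (4 / s i * decay (i + 1) v) +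
      (\<Sum>u\<in>{l..<n} - near v. 4 / s i * (pr i * decay (i + c) (max u v))))"
    by (intro add_mono sum_mono mult_left_mono prob_pair_unblocked prob_update_unblocked prob_update_pair)
      (use assms in auto)
  also have "\<dots> \<le> (3 + (\<Sum>u\<in>{l..<n}. pr i * decay (i + c) u)) +
    (\<Sum>v\<in>{l..<n}. 3 * (4 / s i * decay (i + 1) v) +
      (\<Sum>u\<in>{l..<n}. 4 / s i * (pr i * decay (i + c) (max u v))))"
  proof (intro add_mono order_refl)
    have p0: "0 \<le> pr i" using pr_range[OF assms(1)] by (rule conjunct1)
    have s0: "0 \<le> 4 / s i" using s_pos[of i] by simp
    have nn: "0 \<le> pr i * decay h v" "0 \<le> 4 / s i * (pr i * decay h v)" "0 \<le> 3 * (4 / s i * decay h v)" for h v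
      by (intro mult_nonneg_nonneg decay_nonneg p0 s0 zero_le_numeral)+
    have "(\<Sum>u\<in>{l..<n} - near l. pr i * decay (i + c) (max u l)) = (\<Sum>u\<in>{l..<n} - near l. pr i * decay (i + c) u)"
      by (intro sum.cong refl) (auto simp: max_def)
    also have "\<dots> \<le> (\<Sum>u\<in>{l..<n}. pr i * decay (i + c) u)" by (intro sum_mono2 nn) auto
    finally show "(\<Sum>u\<in>{l..<n} - near l. pr i * decay (i + c) (max u l)) \<le> (\<Sum>u\<in>{l..<n}. pr i * decay (i + c) u)" .
    have "(\<Sum>v\<in>{l<..<n}. 3 * (4 / s i * decay (i + 1) v) +
      (\<Sum>u\<in>{l..<n} - near v. 4 / s i * (pr i * decay (i + c) (max u v)))) \<le>
      (\<Sum>v\<in>{l<..<n}. 3 * (4 / s i * decay (i + 1) v) +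
      (\<Sum>u\<in>{l..<n}. 4 / s i * (pr i * decay (i + c) (max u v))))"
      by (intro sum_mono add_left_mono sum_mono2 nn finite_atLeastLessThan Diff_subset)
    also have "\<dots> \<le> (\<Sum>v\<in>{l..<n}. 3 * (4 / s i * decay (i + 1) v) +
      (\<Sum>u\<in>{l..<n}. 4 / s i * (pr i * decay (i + c) (max u v))))"
      by (intro sum_mono2 add_nonneg_nonneg sum_nonneg nn) auto
    finally show "(\<Sum>v\<in>{l<..<n}. 3 * (4 / s i * decay (i + 1) v) +
      (\<Sum>u\<in>{l..<n} - near v. 4 / s i * (pr i * decay (i + c) (max u v)))) \<le> \<dots>" .
  qed
  also have "\<dots> = 3 + pr i * (\<Sum>u\<in>{l..<n}. decay (i + c) u) + 12 / s i * (\<Sum>v\<in>{l..<n}. decay (i + 1) v) +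
      4 / s i * pr i * (\<Sum>v\<in>{l..<n}. \<Sum>u\<in>{l..<n}. decay (i + c) (max u v))"
    by (simp add: sum.distrib sum_distrib_left mult.assoc)
  also have "\<dots> \<le> 3 + 2 / s i * (80 * s (i + c)) + 12 / s i * (80 * s (i + 1)) + 4 / s i * (2 / s i) * (3200 * (s (i + c))\<^sup>2)"
    using s_pos[of i] pr_le_s[of i] pr_range[OF assms(1)] decay_nonneg
    by (intro add_mono mult_mono sum_decay sum_decay_max order_refl) (auto intro!: sum_nonneg)
  also have "\<dots> = 1923 + 160 * 2 ^ c + 25600 * (2 ^ c)\<^sup>2"
    using s_pos[of i] by (simp add: s_add s_Suc power2_eq_square)
  also have "\<dots> \<le> 30000 * (2 ^ c)\<^sup>2"
  proof -
    have "1 \<le> (2::real) ^ c" by simp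
    moreover have "(2::real) ^ c \<le> (2 ^ c)\<^sup>2" unfolding power2_eq_square by simp
    ultimately show ?thesis by linarith
  qed
  also have "(2 ^ c)\<^sup>2 = (4::real) ^ c" by (simp add: power2_eq_square power_mult_distrib[symmetric])
  finally show ?thesis .
qed


section \<open>Expected cost of the search for the next vertex\<close>

lemma labelled_deterministic:
  assumes "Y \<in> set_pmf P" "Suc m < n"
  shows "labelled q (Y (m, Suc m))"
proof -
  have "(m, Suc m) \<in> position_pairs n" using assms(2) by (simp add: position_pairs_def)
  then have "Y (m, Suc m) \<in> set_pmf (label_pmf p q)"
    using assms(1) unfolding position_law_def set_Pi_pmf[OF finite_position_pairs] PiE_dflt_def by force
  then show ?thesis by (rule set_label_pmf)
qed

text \<open>
  A robust vertex is in the current level, so a candidate w that survives a round of the search has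
  no edge to an earlier robust vertex.
\<close>

definition shield :: "nat \<Rightarrow> nat \<Rightarrow> nat set \<Rightarrow> (nat \<times> nat \<Rightarrow> nat \<Rightarrow> bool) \<Rightarrow> bool" where
  "shield h w K Y \<longleftrightarrow> (\<forall>k\<in>K. \<not> (labelled q (Y (k, w)) \<and> robust q (rel Y) h l k))"

definition shield_pairs :: "nat \<Rightarrow> nat set \<Rightarrow> (nat \<times> nat) set" where
  "shield_pairs w K = (\<Union>k\<in>K. insert (k, w) {(m, k) |m. l \<le> m \<and> m < k})"

lemma shield_bounds:
  assumes "finite K" "w < n" "\<And>k. k \<in> K \<Longrightarrow> Suc k < w"
    "\<And>k. k \<in> K \<Longrightarrow> prob (\<lambda>Y. \<not> robust q (rel Y) h l k) \<le> 1 / 2"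
  shows "prob (shield h w K) \<le> (1 - p / 2) ^ card K" "depends_on (shield_pairs w K) (shield h w K)"
proof -
  note pu = prob_unblocked[where I = K and K = id and G = "\<lambda>_ X. labelled q X" and g = "\<lambda>_. p"
     and h = "\<lambda>_. h" and t = "\<lambda>_. l", OF assms(1) inj_on_id assms(2)]
  have "prob (shield h w K) \<le> (\<Prod>k\<in>K. 1 - p / 2)"
    using pu(1) assms prob_independent_labelled unfolding shield_def by simp
  then show "prob (shield h w K) \<le> (1 - p / 2) ^ card K" by simp
  show "depends_on (shield_pairs w K) (shield h w K)"
    using pu(2) assms prob_independent_labelled unfolding shield_def shield_pairs_def by simp
qed

abbreviation "surv Y i w \<equiv> w \<in> position_survivors n q c (rel Y) (\<lambda>a b. edge Y a b) l T i"

lemma survD: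
  assumes "surv Y i w" "1 \<le> l" "l < w" "1 \<le> i"
  shows "labelled q (Y (l - 1, w))" "w \<in> cands Y i"
    "2 \<le> i \<Longrightarrow> K \<subseteq> {l..<w} \<Longrightarrow> shield (i - 1) w K Y"
proof -
  have "l - 1 < w" using assms by simp
  then show "labelled q (Y (l - 1, w))"
    using assms(1) rel_less(1)[of "l - 1" w Y] unfolding position_survivors_def by simp
  have "cands Y 1 \<subseteq> cands Y i" by (rule candidates_mono_level[OF assms(4)])
  then show "w \<in> cands Y i" using assms(1) unfolding position_survivors_def by blast
  assume K: "2 \<le> i" "K \<subseteq> {l..<w}"
  show "shield (i - 1) w K Y" unfolding shield_def
  proof (intro ballI notI)
    fix k assume "k \<in> K" and *: "labelled q (Y (k, w)) \<and> robust q (rel Y) (i - 1) l k"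
    then have k: "l \<le> k" "k < w" using K by auto
    then have "edge Y k w" using * rel_less(1)[of k w Y] by simp
    then show False using assms(1) K(1) k * unfolding position_survivors_def by auto
  qed
qed

text \<open>The direct predecessor of w always has an edge to w, so survival forces it not to be
  robust. Position l is robust from time l on, hence l + 1 never survives.\<close>

lemma surv_last_not_robust:
  assumes "surv Y i w" "Y \<in> set_pmf P" "1 \<le> l" "l < w" "w < n" "2 \<le> i"
  shows "\<not> robust q (rel Y) (i - 1) l (w - 1)" "l + 1 < w"
proof -
  have "labelled q (Y (w - 1, w))" using labelled_deterministic[OF assms(2), of "w - 1"] assms by simp
  moreover have "shield (i - 1) w {w - 1} Y" using survD(3)[OF assms(1,3,4), of "{w - 1}"] assms by auto
  ultimately show *: "\<not> robust q (rel Y) (i - 1) l (w - 1)" unfolding shield_def by simp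
  have "robust q (rel Y) (i - 1) l l" unfolding robust_def by auto
  then have "w - 1 \<noteq> l" using * by metis
  then show "l + 1 < w" using assms by auto
qed

text \<open>Four events about disjoint sets of pairs: the edge (l - 1, w), the edge between u and
  \<zeta>, the shield, and the unblocked later one of u and w. The shield stays within 8 *
  \<open>s i\<close> of l, below everything that \<open>zone\<close> contains, and omits u, whose
  pairs with w and l may carry the second event.\<close>

lemma prob_survivor_pair:
  assumes l: "1 \<le> l" and i: "1 \<le> i" and w: "l < w" "w < n" and u: "u \<in> {l..<n} - (near w \<union> near l)"
    and \<zeta>: "\<zeta> = w \<or> \<zeta> = l" and K: "finite K" "u \<notin> K" "\<And>k. k \<in> K \<Longrightarrow> l \<le> k \<and> Suc k < w \<and> real k \<le> real l + 8 * s i"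
    and rob: "\<And>k. k \<in> K \<Longrightarrow> prob (\<lambda>Y. \<not> robust q (rel Y) (i - 1) l k) \<le> 1 / 2"
  shows "prob (\<lambda>Y. labelled q (Y (l - 1, w)) \<and> (labelled q (Y (min u \<zeta>, max u \<zeta>)) \<and>
     (shield (i - 1) w K Y \<and> unblocked i (max u w) (min u w) Y))) \<le>
     p * (p * ((1 - p / 2) ^ card K * decay i (max u w)))"
proof -
  have u': "l + 1 < u" "u < n" "u \<noteq> w" "u \<notin> near w" "u \<notin> near l" using u unfolding near_def by auto
  have far: "Suc (min u \<zeta>) < max u \<zeta>" using \<zeta> not_near u' by auto
  have y: "l \<le> max u w" "max u w < n" using w u' by auto
  have zy: "min u w < max u w" using u' by auto
  have sh: "prob (shield (i - 1) w K) \<le> (1 - p / 2) ^ card K" "depends_on (shield_pairs w K) (shield (i - 1) w K)"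
    using shield_bounds[OF K(1) w(2) _ rob] K(3) by auto
  note ub = unblocked_bounds[OF i y, of "min u w"]
  have d34: "shield_pairs w K \<inter> zone i (max u w) (min u w) = {}"
  proof -
    have "(k, w) \<notin> zone i (max u w) (min u w)" "(m, k) \<notin> zone i (max u w) (min u w)" if "k \<in> K" for k m
      using K(3)[OF that] u' unfolding zone_def by (auto simp: max_def min_def)
    then show ?thesis unfolding shield_pairs_def by auto
  qed
  have dep34: "depends_on (shield_pairs w K \<union> zone i (max u w) (min u w))
     (\<lambda>Y. shield (i - 1) w K Y \<and> unblocked i (max u w) (min u w) Y)"
    by (rule depends_on_conj[OF sh(2) ub(2)])
  have b34: "prob (\<lambda>Y. shield (i - 1) w K Y \<and> unblocked i (max u w) (min u w) Y) \<le>
    (1 - p / 2) ^ card K * decay i (max u w)"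
    by (rule prob_conj_le[OF sh(2) ub(2) d34 sh(1) ub(1)])
  have d2: "{(min u \<zeta>, max u \<zeta>)} \<inter> (shield_pairs w K \<union> zone i (max u w) (min u w)) = {}"
  proof -
    have "(min u \<zeta>, max u \<zeta>) \<notin> zone i (max u w) (min u w)"
      using \<zeta> not_in_zone(1)[of "min u w" "max u w" i] not_in_zone(2)[of l u "max u w" "min u w" i] zy u'
      by (auto simp: max_def min_def split: if_splits)
    moreover have "(min u \<zeta>, max u \<zeta>) \<notin> shield_pairs w K"
      using \<zeta> u' K(2,3) w unfolding shield_pairs_def by (fastforce simp: max_def min_def split: if_splits)
    ultimately show ?thesis by auto
  qed
  have b234: "prob (\<lambda>Y. labelled q (Y (min u \<zeta>, max u \<zeta>)) \<and>
     (shield (i - 1) w K Y \<and> unblocked i (max u w) (min u w) Y)) \<le> p * ((1 - p / 2) ^ card K * decay i (max u w))"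
  proof (rule prob_conj_le[OF depends_on_component dep34 d2 _ b34])
    have "max u \<zeta> < n" using u' w \<zeta> by auto
    then show "prob (\<lambda>Y. labelled q (Y (min u \<zeta>, max u \<zeta>))) \<le> p" using prob_edge[OF far] by simp
  qed
  have dep234: "depends_on ({(min u \<zeta>, max u \<zeta>)} \<union> (shield_pairs w K \<union> zone i (max u w) (min u w)))
     (\<lambda>Y. labelled q (Y (min u \<zeta>, max u \<zeta>)) \<and> (shield (i - 1) w K Y \<and> unblocked i (max u w) (min u w) Y))"
    by (rule depends_on_conj[OF depends_on_component dep34])
  have d1: "{(l - 1, w)} \<inter> ({(min u \<zeta>, max u \<zeta>)} \<union> (shield_pairs w K \<union> zone i (max u w) (min u w))) = {}"
  proof -
    have "(l - 1, w) \<notin> zone i (max u w) (min u w)"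
      using not_in_zone(2)[of "l - 1" w "max u w" "min u w" i] zy by (auto simp: max_def min_def split: if_splits)
    moreover have "(l - 1, w) \<notin> shield_pairs w K"
      using K(3) l unfolding shield_pairs_def by fastforce
    moreover have "(l - 1, w) \<noteq> (min u \<zeta>, max u \<zeta>)" using \<zeta> u' w l by (auto simp: min_def)
    ultimately show ?thesis by auto
  qed
  show ?thesis
  proof (rule prob_conj_le[OF depends_on_component dep234 d1 _ b234])
    show "prob (\<lambda>Y. labelled q (Y (l - 1, w))) \<le> p" using prob_edge[of "l - 1" w] w l by simp
  qed
qed

lemma prob_survivor:
  assumes l: "1 \<le> l" and i: "1 \<le> i" and w: "l < w" "w < n"
    and K: "finite K" "\<And>k. k \<in> K \<Longrightarrow> l \<le> k \<and> Suc k < w \<and> real k \<le> real l + 8 * s i"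
    and rob: "\<And>k. k \<in> K \<Longrightarrow> prob (\<lambda>Y. \<not> robust q (rel Y) (i - 1) l k) \<le> 1 / 2"
  shows "prob (\<lambda>Y. labelled q (Y (l - 1, w)) \<and> (shield (i - 1) w K Y \<and> unblocked i w w Y)) \<le>
     p * ((1 - p / 2) ^ card K * decay i w)"
proof -
  have sh: "prob (shield (i - 1) w K) \<le> (1 - p / 2) ^ card K" "depends_on (shield_pairs w K) (shield (i - 1) w K)"
    using shield_bounds[OF K(1) w(2) _ rob] K(2) by auto
  have lw: "l \<le> w" using w by simp
  note ub = unblocked_bounds[OF i lw w(2), of w]
  have d34: "shield_pairs w K \<inter> zone i w w = {}"
  proof -
    have "(k, w) \<notin> zone i w w" "(m, k) \<notin> zone i w w" if "k \<in> K" for k m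
      using K(2)[OF that] unfolding zone_def by auto
    then show ?thesis unfolding shield_pairs_def by auto
  qed
  have b34: "prob (\<lambda>Y. shield (i - 1) w K Y \<and> unblocked i w w Y) \<le> (1 - p / 2) ^ card K * decay i w"
    by (rule prob_conj_le[OF sh(2) ub(2) d34 sh(1) ub(1)])
  have d1: "{(l - 1, w)} \<inter> (shield_pairs w K \<union> zone i w w) = {}"
    using K(2) l s_pos[of i] unfolding shield_pairs_def zone_def by fastforce
  show ?thesis
  proof (rule prob_conj_le[OF depends_on_component depends_on_conj[OF sh(2) ub(2)] d1 _ b34])
    show "prob (\<lambda>Y. labelled q (Y (l - 1, w))) \<le> p" using prob_edge[of "l - 1" w] w l by simp
  qed
qed

lemma surv_pair_event:
  assumes "surv Y i w" "u \<in> cands Y i" "edge Y u \<zeta>" "1 \<le> l" "l < w" "1 \<le> i" "2 \<le> i \<or> K = {}" "K \<subseteq> {l..<w}"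
  shows "labelled q (Y (l - 1, w)) \<and> (labelled q (Y (min u \<zeta>, max u \<zeta>)) \<and>
     (shield (i - 1) w K Y \<and> unblocked i (max u w) (min u w) Y))"
proof -
  have "shield (i - 1) w K Y" using survD(3)[OF assms(1,4,5,6)] assms(7,8) by (auto simp: shield_def)
  moreover have "max u w \<in> cands Y i" using assms(2) survD(2)[OF assms(1,4,5,6)] by (simp add: max_def)
  ultimately show ?thesis using survD(1)[OF assms(1,4,5,6)] assms(3) unblocked_cand unfolding rel_def by blast
qed

text \<open>Bounds the expected cost that w causes in round i. At most 6 vertices are near w or l,
  each with possible edges to w and to l; this gives the 12.\<close>

definition survivor_weight :: "nat \<Rightarrow> nat \<Rightarrow> real" where
  "survivor_weight i w = 12 * prob (\<lambda>Y. surv Y i w) + (\<Sum>u\<in>{l..<n} - (near w \<union> near l).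
     prob (\<lambda>Y. surv Y i w \<and> u \<in> cands Y i \<and> edge Y u w) + prob (\<lambda>Y. surv Y i w \<and> u \<in> cands Y i \<and> edge Y u l))"

lemma expected_round_cost_weight:
  assumes "l < n"
  shows "expect (\<lambda>Y. real (position_round_cost n q c (rel Y) (\<lambda>a b. edge Y a b) l T i)) \<le>
    (\<Sum>w\<in>{l<..<n}. survivor_weight i w)"
proof -
  let ?f = "\<lambda>Y w. 12 * of_bool (surv Y i w) + (\<Sum>u\<in>{l..<n} - (near w \<union> near l).
     of_bool (surv Y i w \<and> u \<in> cands Y i \<and> edge Y u w) + of_bool (surv Y i w \<and> u \<in> cands Y i \<and> edge Y u l)) :: real"
  have nn: "0 \<le> ?f Y w" for Y w by (intro add_nonneg_nonneg sum_nonneg) auto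
  have pt: "real (position_round_cost n q c (rel Y) (\<lambda>a b. edge Y a b) l T i) \<le> (\<Sum>w\<in>{l<..<n}. ?f Y w)" for Y
  proof -
    let ?S = "position_survivors n q c (rel Y) (\<lambda>a b. edge Y a b) l T i"
    have sub: "?S \<subseteq> {l<..<n}" unfolding position_survivors_def using cands_subset[of Y 1] by force
    have "real (position_round_cost n q c (rel Y) (\<lambda>a b. edge Y a b) l T i) \<le> (\<Sum>w\<in>?S. ?f Y w)"
      unfolding position_round_cost_def of_nat_sum of_nat_add
    proof (rule sum_mono)
      fix w assume w: "w \<in> ?S"
      let ?F = "near w \<union> near l"
      have F: "real (card ?F) \<le> 6" using card_Un_le[of "near w" "near l"] card_near[of w] card_near[of l] by simp
      have "real (card {u \<in> cands Y i. edge Y u \<zeta>}) \<le> real (card ?F) + (\<Sum>u\<in>{l..<n} - ?F. of_bool (u \<in> cands Y i \<and> edge Y u \<zeta>))" for \<zeta>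
        by (rule card_le_far[OF cands_subset]) simp
      from this[of w] this[of l]
      show "real (card {u \<in> cands Y i. edge Y u w}) + real (card {u \<in> cands Y i. edge Y u l}) \<le> ?f Y w"
        using w F by (simp add: sum.distrib del: sum_of_bool_eq)
    qed
    also have "\<dots> \<le> (\<Sum>w\<in>{l<..<n}. ?f Y w)" by (rule sum_mono2[OF _ sub nn]) simp
    finally show ?thesis .
  qed
  have "expect (\<lambda>Y. real (position_round_cost n q c (rel Y) (\<lambda>a b. edge Y a b) l T i)) \<le> expect (\<lambda>Y. \<Sum>w\<in>{l<..<n}. ?f Y w)"
    by (rule expect_mono) (rule pt)
  also have "\<dots> = (\<Sum>w\<in>{l<..<n}. survivor_weight i w)"
    unfolding survivor_weight_def
    by (simp add: Bochner_Integration.integral_sum Bochner_Integration.integral_add del: sum_of_bool_eq)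
  finally show ?thesis .
qed

text \<open>L bounds the shield probability uniformly over the one position u that may have to be
  left out.\<close>

lemma survivor_weight_le:
  assumes l: "1 \<le> l" and i: "1 \<le> i" and w: "l < w" "w < n"
    and K: "finite K" "\<And>k. k \<in> K \<Longrightarrow> l \<le> k \<and> Suc k < w \<and> real k \<le> real l + 8 * s i"
    and rob: "\<And>k. k \<in> K \<Longrightarrow> prob (\<lambda>Y. \<not> robust q (rel Y) (i - 1) l k) \<le> 1 / 2"
    and i2: "2 \<le> i \<or> K = {}" and L: "\<And>u. (1 - p / 2) ^ card (K - {u}) \<le> L"
  shows "survivor_weight i w \<le> 12 * (p * (L * decay i w)) + (\<Sum>u\<in>{l..<n}. 2 * (p * (p * (L * decay i (max u w)))))"
proof -
  have p2: "0 \<le> 1 - p / 2" using p_le_1 by simp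
  have L0: "0 \<le> L" using L[of 0] zero_le_power[OF p2, of "card (K - {0})"] by linarith
  have KL: "K \<subseteq> {l..<w}" using K(2) by fastforce
  have cardK: "(1 - p / 2) ^ card K \<le> L"
  proof -
    have "(1 - p / 2) ^ card K \<le> (1 - p / 2) ^ card (K - {0})"
      using p2 p_pos K(1) by (intro power_decreasing card_mono) auto
    then show ?thesis using L[of 0] by simp
  qed
  have mono: "p * (x * d) \<le> p * (L * d)" if "x \<le> L" "0 \<le> d" for x d
    using that p_pos by (intro mult_left_mono mult_right_mono) auto
  have "prob (\<lambda>Y. surv Y i w) \<le> prob (\<lambda>Y. labelled q (Y (l - 1, w)) \<and> (shield (i - 1) w K Y \<and> unblocked i w w Y))"
  proof (rule prob_mono)
    fix Y assume s: "surv Y i w"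
    have "shield (i - 1) w K Y" using survD(3)[OF s l w(1) i] i2 KL by (auto simp: shield_def)
    then show "labelled q (Y (l - 1, w)) \<and> (shield (i - 1) w K Y \<and> unblocked i w w Y)"
      using survD(1,2)[OF s l w(1) i] unblocked_cand by blast
  qed
  also have "\<dots> \<le> p * ((1 - p / 2) ^ card K * decay i w)" by (rule prob_survivor[OF l i w K rob])
  also have "\<dots> \<le> p * (L * decay i w)" by (rule mono[OF cardK decay_nonneg])
  finally have 1: "prob (\<lambda>Y. surv Y i w) \<le> p * (L * decay i w)" .
  have 2: "prob (\<lambda>Y. surv Y i w \<and> u \<in> cands Y i \<and> edge Y u \<zeta>) \<le> p * (p * (L * decay i (max u w)))"
    if u: "u \<in> {l..<n} - (near w \<union> near l)" and \<zeta>: "\<zeta> = w \<or> \<zeta> = l" for u \<zeta>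
  proof -
    let ?K = "K - {u}"
    have "prob (\<lambda>Y. surv Y i w \<and> u \<in> cands Y i \<and> edge Y u \<zeta>) \<le>
      prob (\<lambda>Y. labelled q (Y (l - 1, w)) \<and> (labelled q (Y (min u \<zeta>, max u \<zeta>)) \<and>
        (shield (i - 1) w ?K Y \<and> unblocked i (max u w) (min u w) Y)))"
    proof (rule prob_mono)
      fix Y assume *: "surv Y i w \<and> u \<in> cands Y i \<and> edge Y u \<zeta>"
      show "labelled q (Y (l - 1, w)) \<and> (labelled q (Y (min u \<zeta>, max u \<zeta>)) \<and>
        (shield (i - 1) w ?K Y \<and> unblocked i (max u w) (min u w) Y))"
        by (rule surv_pair_event) (use * l w(1) i i2 KL in auto)
    qed
    also have "\<dots> \<le> p * (p * ((1 - p / 2) ^ card ?K * decay i (max u w)))"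
      by (rule prob_survivor_pair[OF l i w u \<zeta>]) (use K rob in auto)
    also have "\<dots> \<le> p * (p * (L * decay i (max u w)))"
      using p_pos mono[OF L decay_nonneg] by (intro mult_left_mono) auto
    finally show ?thesis .
  qed
  have "survivor_weight i w \<le> 12 * (p * (L * decay i w)) +
     (\<Sum>u\<in>{l..<n} - (near w \<union> near l). p * (p * (L * decay i (max u w))) + p * (p * (L * decay i (max u w))))"
    unfolding survivor_weight_def by (intro add_mono mult_left_mono 1 sum_mono 2) auto
  also have "\<dots> = 12 * (p * (L * decay i w)) + (\<Sum>u\<in>{l..<n} - (near w \<union> near l). 2 * (p * (p * (L * decay i (max u w)))))"
    by (simp only: mult_2)
  also have "\<dots> \<le> 12 * (p * (L * decay i w)) + (\<Sum>u\<in>{l..<n}. 2 * (p * (p * (L * decay i (max u w)))))"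
    using L0 p_pos decay_nonneg by (intro add_left_mono sum_mono2) auto
  finally show ?thesis .
qed

lemma sum_survivor_weight:
  assumes "0 \<le> L"
  shows "(\<Sum>w\<in>{l<..<n}. 12 * (p * (L * decay i w)) + (\<Sum>u\<in>{l..<n}. 2 * (p * (p * (L * decay i (max u w)))))) \<le> 7360 * 4 ^ i * L"
proof -
  have ps: "p * s i = 2 ^ i" using p_pos by (simp add: s_def)
  have "(\<Sum>w\<in>{l<..<n}. 12 * (p * (L * decay i w)) + (\<Sum>u\<in>{l..<n}. 2 * (p * (p * (L * decay i (max u w)))))) \<le>
    (\<Sum>w\<in>{l..<n}. 12 * (p * (L * decay i w)) + (\<Sum>u\<in>{l..<n}. 2 * (p * (p * (L * decay i (max u w))))))"
    using assms p_pos decay_nonneg by (intro sum_mono2 add_nonneg_nonneg sum_nonneg) auto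
  also have "\<dots> = L * (12 * (p * (\<Sum>w\<in>{l..<n}. decay i w)) + 2 * (p * p) * (\<Sum>w\<in>{l..<n}. \<Sum>u\<in>{l..<n}. decay i (max u w)))"
    by (simp add: sum.distrib sum_distrib_left distrib_left mult_ac)
  also have "\<dots> \<le> L * (12 * (p * (80 * s i)) + 2 * (p * p) * (3200 * (s i)\<^sup>2))"
    using assms p_pos by (intro mult_left_mono add_mono sum_decay sum_decay_max) auto
  also have "12 * (p * (80 * s i)) + 2 * (p * p) * (3200 * (s i)\<^sup>2) = 960 * (p * s i) + 6400 * (p * s i)\<^sup>2"
    by (simp add: power2_eq_square algebra_simps)
  also have "\<dots> = 960 * 2 ^ i + 6400 * (2 ^ i)\<^sup>2" unfolding ps ..
  also have "(2 ^ i)\<^sup>2 = (4::real) ^ i" by (simp add: power2_eq_square power_mult_distrib[symmetric])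
  also have "L * (960 * 2 ^ i + 6400 * 4 ^ i) \<le> L * (960 * 4 ^ i + 6400 * 4 ^ i)"
    using assms by (intro mult_left_mono add_mono power_mono) auto
  finally show ?thesis by (simp add: algebra_simps)
qed

lemma prob_not_robust_recent:
  assumes "2 \<le> i" "l \<le> k" "k < n"
  shows "prob (\<lambda>Y. \<not> robust q (rel Y) (i - 1) l k) \<le> 8 / 2 ^ i * (p * real (k - l) + 1)"
proof -
  have "prob (\<lambda>Y. \<not> robust q (rel Y) (i - 1) l k) \<le> real (k - l) * (4 / s (i - 1)) + 4 / 2 ^ (i - 1)"
    by (rule prob_not_robust) (use assms in auto)
  moreover have "(2::real) ^ i = 2 * 2 ^ (i - 1)" using assms by (cases i) auto
  ultimately show ?thesis by (simp add: s_def field_simps)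
qed

text \<open>Within distance \<open>s i / 32\<close> the union bound is 1/4 + 8 / 2 ^ i, and i at
  least 5 makes the second term at most 1/4.\<close>

lemma prob_not_robust_half:
  assumes "5 \<le> i" "l \<le> k" "k < n" "real (k - l) \<le> s i / 32"
  shows "prob (\<lambda>Y. \<not> robust q (rel Y) (i - 1) l k) \<le> 1 / 2"
proof -
  have x: "(2::real) ^ 5 \<le> 2 ^ i" by (rule power_increasing) (use assms in auto)
  have "p * real (k - l) \<le> p * (s i / 32)" using assms p_pos by (intro mult_left_mono) auto
  also have "\<dots> = 2 ^ i / 32" using p_pos by (simp add: s_def)
  finally have "8 / 2 ^ i * (p * real (k - l) + 1) \<le> 8 / 2 ^ i * (2 ^ i / 32 + 1)" by (intro mult_left_mono) auto
  also have "\<dots> = 1 / 4 + 8 / 2 ^ i" by (simp add: field_simps)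
  also have "\<dots> \<le> 1 / 4 + 8 / 2 ^ 5" using x by (intro add_left_mono divide_left_mono) auto
  finally have "8 / 2 ^ i * (p * real (k - l) + 1) \<le> 1 / 2" by simp
  moreover have "prob (\<lambda>Y. \<not> robust q (rel Y) (i - 1) l k) \<le> 8 / 2 ^ i * (p * real (k - l) + 1)"
    by (rule prob_not_robust_recent) (use assms in auto)
  ultimately show ?thesis by linarith
qed

text \<open>About \<open>s i / 32\<close> positions after l lie before w, and each has an edge to w
  and is robust with probability at least p / 2. None doing so has probability of order exp (- (2 ^
  i / 64)), small enough to absorb the factor 4 ^ i of \<open>sum_survivor_weight\<close>.\<close>

lemma survivor_weight_far:
  assumes l: "1 \<le> l" and i: "5 \<le> i" and w: "l < w" "w < n" and far: "s i / 32 < real (w - l)"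
  defines "L \<equiv> 3 * exp (- (2 ^ i / 64))"
  shows "survivor_weight i w \<le> 12 * (p * (L * decay i w)) + (\<Sum>u\<in>{l..<n}. 2 * (p * (p * (L * decay i (max u w)))))"
proof (rule survivor_weight_le[OF l _ w])
  let ?R = "s i / 32"
  define m where "m = nat \<lfloor>?R\<rfloor>"
  let ?K = "{l..<l + m}"
  have R0: "0 \<le> ?R" using s_pos[of i] by simp
  have m: "real m \<le> ?R" "?R - 1 \<le> real m" using R0 unfolding m_def by linarith+
  show "finite ?K" "1 \<le> i" "2 \<le> i \<or> ?K = {}" using i by auto
  have K: "l \<le> k \<and> Suc k < w \<and> real (k - l) \<le> ?R" if "k \<in> ?K" for k
  proof -
    have "real (Suc k - l) \<le> real m" using that by auto
    then have "real (Suc k - l) < real (w - l)" using m(1) far by linarith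
    then have "Suc k < w" using that w by auto
    moreover have "real (k - l) \<le> real m" using that by auto
    ultimately show ?thesis using that m(1) by auto
  qed
  show "l \<le> k \<and> Suc k < w \<and> real k \<le> real l + 8 * s i" if "k \<in> ?K" for k
  proof -
    have "real k \<le> real l + ?R" using K[OF that] by linarith
    then show ?thesis using K[OF that] s_pos[of i] by auto
  qed
  show "prob (\<lambda>Y. \<not> robust q (rel Y) (i - 1) l k) \<le> 1 / 2" if "k \<in> ?K" for k
    using K[OF that] w by (intro prob_not_robust_half[OF i]) auto
  show "(1 - p / 2) ^ card (?K - {u}) \<le> L" for u
  proof -
    have "m - 1 \<le> card (?K - {u})" using diff_card_le_card_Diff[of "{u}" ?K] by simp
    then have "?R - 2 \<le> real (card (?K - {u}))" using m(2) by linarith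
    then have "p / 2 * (?R - 2) \<le> p / 2 * real (card (?K - {u}))" using p_pos by (intro mult_left_mono) auto
    moreover have "p / 2 * (?R - 2) = 2 ^ i / 64 - p" using p_pos by (simp add: s_def field_simps)
    \<comment> \<open>Rounding and leaving out u cost two positions, i.e. a factor of at most exp p,
      bounded by 3 as p is at most 1.\<close>
    ultimately have e: "- (p / 2 * real (card (?K - {u}))) \<le> 1 + - (2 ^ i / 64)" using p_le_1 by linarith
    have "(1 - p / 2) ^ card (?K - {u}) \<le> exp (- (p / 2 * real (card (?K - {u}))))"
      using p_pos p_le_1 by (intro power_le_exp) auto
    also have "\<dots> \<le> exp (1 + - (2 ^ i / 64))" using e by simp
    also have "\<dots> = exp 1 * exp (- (2 ^ i / 64))" by (simp only: exp_add)
    also have "\<dots> \<le> L" unfolding L_def using exp_le by (intro mult_right_mono) auto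
    finally show ?thesis .
  qed
qed

text \<open>The shield now covers the positions from l up to w - 2, and failure of robustness at w -
  1 is a fifth independent event. As w is within \<open>s i / 32\<close> of l, the pairs used have
  their later element at most w or are (a, u) with a at most w; none of these is in the zone of u,
  so the decay may be taken in u itself.\<close>

lemma prob_survivor_pair_close:
  assumes l: "1 \<le> l" and i: "5 \<le> i" and w: "l + 1 < w" "w < n" and close: "real (w - l) \<le> s i / 32"
    and u: "u \<in> {l..<n} - (near w \<union> near l)" and \<zeta>: "\<zeta> = w \<or> \<zeta> = l"
  defines "K \<equiv> {l..<w - 1} - {u}"
  shows "prob (\<lambda>Y. labelled q (Y (l - 1, w)) \<and> (labelled q (Y (min u \<zeta>, max u \<zeta>)) \<and>
     (\<not> robust q (rel Y) (i - 1) l (w - 1) \<and> (shield (i - 1) w K Y \<and> unblocked i u u Y)))) \<le>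
     p * (p * (8 / 2 ^ i * (p * real (w - l) + 1) * ((1 - p / 2) ^ (w - l - 2) * decay i u)))"
proof -
  have u': "l + 1 < u" "u < n" "u \<noteq> w" "u \<noteq> w - 1" "u \<notin> near w" "u \<notin> near l" using u unfolding near_def by auto
  have far: "Suc (min u \<zeta>) < max u \<zeta>" using \<zeta> not_near u' by auto
  have K: "finite K" "\<And>k. k \<in> K \<Longrightarrow> l \<le> k \<and> k < w - 1 \<and> k \<noteq> u" unfolding K_def by auto
  have low: "real b \<le> real l + 8 * s i" if "b \<le> w" for b
  proof -
    have "real b \<le> real l + s i / 32" using close that w by linarith
    then show ?thesis using s_pos[of i] by linarith
  qed
  have rob: "prob (\<lambda>Y. \<not> robust q (rel Y) (i - 1) l k) \<le> 1 / 2" if "k \<in> K" for k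
  proof (rule prob_not_robust_half[OF i])
    show "l \<le> k" "k < n" using K(2)[OF that] w by auto
    have "real (k - l) \<le> real (w - l)" using K(2)[OF that] by auto
    then show "real (k - l) \<le> s i / 32" using close by linarith
  qed
  have sh: "prob (shield (i - 1) w K) \<le> (1 - p / 2) ^ card K" "depends_on (shield_pairs w K) (shield (i - 1) w K)"
    using shield_bounds[OF K(1) w(2) _ rob] K(2) by fastforce+
  have card: "prob (shield (i - 1) w K) \<le> (1 - p / 2) ^ (w - l - 2)"
  proof -
    have "w - l - 2 \<le> card K" unfolding K_def using diff_card_le_card_Diff[of "{u}" "{l..<w - 1}"] by simp
    then have "(1 - p / 2) ^ card K \<le> (1 - p / 2) ^ (w - l - 2)"
      using p_pos p_le_1 by (intro power_decreasing) auto
    then show ?thesis using sh(1) by simp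
  qed
  have i1: "1 \<le> i" and lu: "l \<le> u" using i u' by auto
  note ub = unblocked_bounds[OF i1 lu u'(2), of u]
  have zone: "(a, b) \<notin> zone i u u" if "b \<le> w" "b \<noteq> u" for a b
    using low[OF that(1)] that(2) unfolding zone_def by auto
  have zone': "(a, u) \<notin> zone i u u" if "a \<le> w" for a
    using low[OF that] unfolding zone_def by auto
  let ?D3 = "{(m, w - 1) |m. l \<le> m \<and> m < w - 1}"
  have d45: "shield_pairs w K \<inter> zone i u u = {}"
    using zone K(2) u'(3) unfolding shield_pairs_def by fastforce
  have b45: "prob (\<lambda>Y. shield (i - 1) w K Y \<and> unblocked i u u Y) \<le> (1 - p / 2) ^ (w - l - 2) * decay i u"
    by (rule prob_conj_le[OF sh(2) ub(2) d45 card ub(1)])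
  note dep45 = depends_on_conj[OF sh(2) ub(2)]
  have d3: "?D3 \<inter> (shield_pairs w K \<union> zone i u u) = {}"
    using zone[of "w - 1"] u' K(2) w unfolding shield_pairs_def by fastforce
  note dep3 = depends_on_not[OF depends_on_robust[of "w - 1" l "i - 1"]]
  have nr: "prob (\<lambda>Y. \<not> robust q (rel Y) (i - 1) l (w - 1)) \<le> 8 / 2 ^ i * (p * real (w - l) + 1)"
  proof -
    have "prob (\<lambda>Y. \<not> robust q (rel Y) (i - 1) l (w - 1)) \<le> 8 / 2 ^ i * (p * real (w - 1 - l) + 1)"
      by (rule prob_not_robust_recent) (use i w in auto)
    also have "\<dots> \<le> 8 / 2 ^ i * (p * real (w - l) + 1)"
      using p_pos by (intro mult_left_mono add_right_mono) auto
    finally show ?thesis .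
  qed
  note b345 = prob_conj_le[OF dep3 dep45 d3 nr b45]
  note dep345 = depends_on_conj[OF dep3 dep45]
  have d2: "{(min u \<zeta>, max u \<zeta>)} \<inter> (?D3 \<union> (shield_pairs w K \<union> zone i u u)) = {}"
  proof -
    have "(min u \<zeta>, max u \<zeta>) \<notin> zone i u u"
      using \<zeta> zone[of w u] zone'[of w] zone'[of l] u' w by (auto simp: max_def min_def split: if_splits)
    moreover have "(min u \<zeta>, max u \<zeta>) \<notin> shield_pairs w K"
      using \<zeta> u' K(2) w unfolding shield_pairs_def by (fastforce simp: max_def min_def split: if_splits)
    moreover have "(min u \<zeta>, max u \<zeta>) \<notin> ?D3" using \<zeta> u' w by (auto simp: max_def min_def split: if_splits)
    ultimately show ?thesis by auto
  qed
  have e2: "prob (\<lambda>Y. labelled q (Y (min u \<zeta>, max u \<zeta>))) \<le> p"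
  proof -
    have "max u \<zeta> < n" using u' w \<zeta> by auto
    then show ?thesis using prob_edge[OF far] by simp
  qed
  note b2345 = prob_conj_le[OF depends_on_component dep345 d2 e2 b345]
  have d1: "{(l - 1, w)} \<inter> ({(min u \<zeta>, max u \<zeta>)} \<union> (?D3 \<union> (shield_pairs w K \<union> zone i u u))) = {}"
  proof -
    have "(l - 1, w) \<notin> zone i u u" using zone[of w] u' by auto
    moreover have "(l - 1, w) \<notin> shield_pairs w K" using K(2) l unfolding shield_pairs_def by fastforce
    moreover have "(l - 1, w) \<noteq> (min u \<zeta>, max u \<zeta>)" using \<zeta> u' w l by (auto simp: min_def)
    ultimately show ?thesis using w by auto
  qed
  have e1: "prob (\<lambda>Y. labelled q (Y (l - 1, w))) \<le> p" using prob_edge[of "l - 1" w] w l by simp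
  show ?thesis by (rule prob_conj_le[OF depends_on_component depends_on_conj[OF depends_on_component dep345] d1 e1 b2345])
qed

lemma prob_survivor_close:
  assumes l: "1 \<le> l" and i: "5 \<le> i" and w: "l + 1 < w" "w < n" and close: "real (w - l) \<le> s i / 32"
  shows "prob (\<lambda>Y. labelled q (Y (l - 1, w)) \<and>
     (\<not> robust q (rel Y) (i - 1) l (w - 1) \<and> shield (i - 1) w {l..<w - 1} Y)) \<le>
     p * (8 / 2 ^ i * (p * real (w - l) + 1) * (1 - p / 2) ^ (w - l - 2))"
proof -
  let ?K = "{l..<w - 1}"
  have rob: "prob (\<lambda>Y. \<not> robust q (rel Y) (i - 1) l k) \<le> 1 / 2" if "k \<in> ?K" for k
  proof (rule prob_not_robust_half[OF i])
    show "l \<le> k" "k < n" using that w by auto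
    have "real (k - l) \<le> real (w - l)" using that by auto
    then show "real (k - l) \<le> s i / 32" using close by linarith
  qed
  have sh: "prob (shield (i - 1) w ?K) \<le> (1 - p / 2) ^ card ?K" "depends_on (shield_pairs w ?K) (shield (i - 1) w ?K)"
    using shield_bounds[OF finite_atLeastLessThan w(2) _ rob, of l "w - 1"] by fastforce+
  have "(1 - p / 2) ^ card ?K \<le> (1 - p / 2) ^ (w - l - 2)"
    using p_pos p_le_1 by (intro power_decreasing) auto
  then have card: "prob (shield (i - 1) w ?K) \<le> (1 - p / 2) ^ (w - l - 2)" using sh(1) by linarith
  let ?D3 = "{(m, w - 1) |m. l \<le> m \<and> m < w - 1}"
  have d3: "?D3 \<inter> shield_pairs w ?K = {}" using w unfolding shield_pairs_def by auto
  note dep3 = depends_on_not[OF depends_on_robust[of "w - 1" l "i - 1"]]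
  have nr: "prob (\<lambda>Y. \<not> robust q (rel Y) (i - 1) l (w - 1)) \<le> 8 / 2 ^ i * (p * real (w - l) + 1)"
  proof -
    have "prob (\<lambda>Y. \<not> robust q (rel Y) (i - 1) l (w - 1)) \<le> 8 / 2 ^ i * (p * real (w - 1 - l) + 1)"
      by (rule prob_not_robust_recent) (use i w in auto)
    also have "\<dots> \<le> 8 / 2 ^ i * (p * real (w - l) + 1)"
      using p_pos by (intro mult_left_mono add_right_mono) auto
    finally show ?thesis .
  qed
  have d1: "{(l - 1, w)} \<inter> (?D3 \<union> shield_pairs w ?K) = {}" using l w unfolding shield_pairs_def by auto
  have e1: "prob (\<lambda>Y. labelled q (Y (l - 1, w))) \<le> p" using prob_edge[of "l - 1" w] w l by simp
  show ?thesis
    by (rule prob_conj_le[OF depends_on_component depends_on_conj[OF dep3 sh(2)] d1 e1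
        prob_conj_le[OF dep3 sh(2) d3 nr card]])
qed

text \<open>Summing the decay over u and multiplying by p gives 80 * 2 ^ i, which cancels against 8
  / 2 ^ i from the failing predecessor: 8 * (12 + 160) = 1376. The weight vanishes at w = l + 1,
  where there is no survivor.\<close>

lemma survivor_weight_close:
  assumes l: "1 \<le> l" and i: "5 \<le> i" and w: "l < w" "w < n" and close: "real (w - l) \<le> s i / 32"
  shows "survivor_weight i w \<le> (if l + 1 < w then 1376 * (p * ((p * real (w - l) + 1) * (1 - p / 2) ^ (w - l - 2))) else 0)"
proof (cases "l + 1 < w")
  case False
  have "prob (\<lambda>Y. surv Y i w \<and> Q Y) = 0" for Q
  proof -
    have "\<not> surv Y i w" if "Y \<in> set_pmf P" for Y
      using surv_last_not_robust(2)[OF _ that l w, of i] i False by auto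
    then have "prob (\<lambda>Y. surv Y i w \<and> Q Y) \<le> prob (\<lambda>_. False)" by (intro prob_mono) auto
    then show ?thesis using measure_nonneg[of P "{Y. surv Y i w \<and> Q Y}"] by simp
  qed
  from this[of "\<lambda>_. True"] this show ?thesis using False unfolding survivor_weight_def by simp
next
  case True
  define v where "v = 8 / 2 ^ i * (p * real (w - l) + 1)"
  define b where "b = (1 - p / 2) ^ (w - l - 2)"
  have v0: "0 \<le> v" "0 \<le> b" using p_pos p_le_1 unfolding v_def b_def by auto
  have i': "1 \<le> i" "2 \<le> i" using i by auto
  have 1: "prob (\<lambda>Y. surv Y i w) \<le> p * (v * b)"
  proof -
    have "prob (\<lambda>Y. surv Y i w) \<le> prob (\<lambda>Y. labelled q (Y (l - 1, w)) \<and>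
     (\<not> robust q (rel Y) (i - 1) l (w - 1) \<and> shield (i - 1) w {l..<w - 1} Y))"
    proof (rule prob_mono)
      fix Y assume Y: "Y \<in> set_pmf P" "surv Y i w"
      have "{l..<w - 1} \<subseteq> {l..<w}" by auto
      then show "labelled q (Y (l - 1, w)) \<and>
         (\<not> robust q (rel Y) (i - 1) l (w - 1) \<and> shield (i - 1) w {l..<w - 1} Y)"
        using survD(1,3)[OF Y(2) l w(1) i'(1)] surv_last_not_robust(1)[OF Y(2,1) l w] i' by blast
    qed
    then show ?thesis using prob_survivor_close[OF l i True w(2) close] unfolding v_def b_def by linarith
  qed
  have 2: "prob (\<lambda>Y. surv Y i w \<and> u \<in> cands Y i \<and> edge Y u \<zeta>) \<le> p * (p * (v * (b * decay i u)))"
    if u: "u \<in> {l..<n} - (near w \<union> near l)" and \<zeta>: "\<zeta> = w \<or> \<zeta> = l" for u \<zeta>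
  proof -
    let ?K = "{l..<w - 1} - {u}"
    have "prob (\<lambda>Y. surv Y i w \<and> u \<in> cands Y i \<and> edge Y u \<zeta>) \<le>
      prob (\<lambda>Y. labelled q (Y (l - 1, w)) \<and> (labelled q (Y (min u \<zeta>, max u \<zeta>)) \<and>
     (\<not> robust q (rel Y) (i - 1) l (w - 1) \<and> (shield (i - 1) w ?K Y \<and> unblocked i u u Y))))"
    proof (rule prob_mono)
      fix Y assume Y: "Y \<in> set_pmf P" and *: "surv Y i w \<and> u \<in> cands Y i \<and> edge Y u \<zeta>"
      have "shield (i - 1) w ?K Y" by (rule survD(3)[OF conjunct1[OF *] l w(1) i']) auto
      moreover have "labelled q (Y (l - 1, w))" by (rule survD(1)[OF conjunct1[OF *] l w(1) i'(1)])
      moreover have "\<not> robust q (rel Y) (i - 1) l (w - 1)" using surv_last_not_robust(1)[OF _ Y l w] * i' by blast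
      moreover have "unblocked i u u Y" using unblocked_cand * by blast
      ultimately show "labelled q (Y (l - 1, w)) \<and> (labelled q (Y (min u \<zeta>, max u \<zeta>)) \<and>
       (\<not> robust q (rel Y) (i - 1) l (w - 1) \<and> (shield (i - 1) w ?K Y \<and> unblocked i u u Y)))"
        using * unfolding rel_def by blast
    qed
    then show ?thesis using prob_survivor_pair_close[OF l i True w(2) close u \<zeta>] unfolding v_def b_def by linarith
  qed
  have "survivor_weight i w \<le> 12 * (p * (v * b)) +
    (\<Sum>u\<in>{l..<n} - (near w \<union> near l). p * (p * (v * (b * decay i u))) + p * (p * (v * (b * decay i u))))"
    unfolding survivor_weight_def by (intro add_mono mult_left_mono 1 sum_mono 2) auto
  also have "\<dots> = 12 * (p * (v * b)) + (\<Sum>u\<in>{l..<n} - (near w \<union> near l). 2 * (p * (p * (v * (b * decay i u)))))"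
    by (simp only: mult_2)
  also have "\<dots> \<le> 12 * (p * (v * b)) + (\<Sum>u\<in>{l..<n}. 2 * (p * (p * (v * (b * decay i u)))))"
    using v0 p_pos decay_nonneg by (intro add_left_mono sum_mono2) auto
  also have "\<dots> = p * (v * b) * (12 + 2 * (p * (\<Sum>u\<in>{l..<n}. decay i u)))"
    by (simp add: sum_distrib_left distrib_left mult_ac)
  also have "\<dots> \<le> p * (v * b) * (12 + 2 * (p * (80 * s i)))"
    using v0 p_pos by (intro mult_left_mono add_left_mono sum_decay) auto
  also have "p * (80 * s i) = 80 * 2 ^ i" using p_pos by (simp add: s_def)
  also have "p * (v * b) * (12 + 2 * (80 * 2 ^ i)) \<le> p * (v * b) * (172 * 2 ^ i)"
  proof (rule mult_left_mono)
    have "1 \<le> (2::real) ^ i" by simp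
    then show "12 + 2 * (80 * 2 ^ i) \<le> 172 * (2::real) ^ i" by linarith
    show "0 \<le> p * (v * b)" using v0 p_pos by simp
  qed
  also have "\<dots> = 1376 * (p * ((p * real (w - l) + 1) * b))" unfolding v_def by simp
  finally show ?thesis using True unfolding b_def by simp
qed

text \<open>The linear factor is absorbed by Bernoulli's inequality into (1 + p / 4) ^ d, and (1 + p
  / 4) * (1 - p / 2) is at most 1 - p / 4. What remains is p times a geometric series of sum at most
  4 / p.\<close>

lemma sum_close_weights:
  "(\<Sum>w\<in>{l<..<n}. if l + 1 < w then 1376 * (p * ((p * real (w - l) + 1) * (1 - p / 2) ^ (w - l - 2))) else 0) \<le> 66048"
proof -
  let ?g = "\<lambda>d. 1376 * (p * ((p * real (d + 2) + 1) * (1 - p / 2) ^ d))"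
  have g: "?g d \<le> 16512 * p * (1 - p / 4) ^ d" for d
  proof -
    have "1 + real d * (p / 4) \<le> (1 + p / 4) ^ d" using p_pos by (intro Bernoulli_inequality) auto
    then have "12 * (1 + real d * (p / 4)) \<le> 12 * (1 + p / 4) ^ d" by (rule mult_left_mono) simp
    moreover have "p * real (d + 2) + 1 \<le> 12 * (1 + real d * (p / 4))"
    proof -
      have "0 \<le> p * real d" using p_pos by simp
      then show ?thesis using p_le_1 by (simp add: algebra_simps)
    qed
    ultimately have "(p * real (d + 2) + 1) * (1 - p / 2) ^ d \<le> 12 * (1 + p / 4) ^ d * (1 - p / 2) ^ d"
      using p_le_1 by (intro mult_right_mono) auto
    also have "\<dots> = 12 * ((1 + p / 4) * (1 - p / 2)) ^ d" by (simp add: power_mult_distrib)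
    also have "\<dots> \<le> 12 * (1 - p / 4) ^ d"
    proof (intro mult_left_mono power_mono)
      have "0 \<le> p * p" by simp
      then show "(1 + p / 4) * (1 - p / 2) \<le> 1 - p / 4" by (simp add: field_simps)
      show "0 \<le> (1 + p / 4) * (1 - p / 2)" using p_pos p_le_1 by simp
    qed simp
    finally have "1376 * p * ((p * real (d + 2) + 1) * (1 - p / 2) ^ d) \<le> 1376 * p * (12 * (1 - p / 4) ^ d)"
      using p_pos by (intro mult_left_mono) auto
    then show ?thesis by simp
  qed
  have "(\<Sum>w\<in>{l<..<n}. if l + 1 < w then 1376 * (p * ((p * real (w - l) + 1) * (1 - p / 2) ^ (w - l - 2))) else 0) =
    (\<Sum>w\<in>{l + 2..<n}. 1376 * (p * ((p * real (w - l) + 1) * (1 - p / 2) ^ (w - l - 2))))"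
    by (rule sum.mono_neutral_cong_right) auto
  also have "\<dots> = (\<Sum>d<n - l - 2. ?g d)"
    by (rule sum.reindex_bij_witness[of _ "\<lambda>d. d + l + 2" "\<lambda>w. w - l - 2"]) auto
  also have "\<dots> \<le> (\<Sum>d<n - l - 2. 16512 * p * (1 - p / 4) ^ d)" by (intro sum_mono g)
  also have "\<dots> = 16512 * (p * (\<Sum>d<n - l - 2. (1 - p / 4) ^ d))" by (simp add: sum_distrib_left mult.assoc)
  also have "p * (\<Sum>d<n - l - 2. (1 - p / 4) ^ d) = 4 * (1 - (1 - p / 4) ^ (n - l - 2))"
  proof -
    have "(p / 4) * (\<Sum>d<m. (1 - p / 4) ^ d) = 1 - (1 - p / 4) ^ m" for m
      using one_diff_power_eq[of "1 - p / 4" m] by simp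
    from this[of "n - l - 2"] show ?thesis by simp
  qed
  also have "16512 * (4 * (1 - (1 - p / 4) ^ (n - l - 2))) \<le> 66048"
    using p_le_1 zero_le_power[of "1 - p / 4" "n - l - 2"] by simp
  finally show ?thesis .
qed

text \<open>For i below 5 the second moment with the trivial shield bound 1 is already a constant.
  From i = 5 on each rival is either far or close, and both totals are bounded uniformly in
  i.\<close>

lemma expected_round_cost:
  assumes l: "1 \<le> l" "l < n" and i: "1 \<le> i"
  shows "expect (\<lambda>Y. real (position_round_cost n q c (rel Y) (\<lambda>a b. edge Y a b) l T i)) \<le> 10 ^ 9"
proof (cases "5 \<le> i")
  case False
  have "(\<Sum>w\<in>{l<..<n}. survivor_weight i w) \<le>
    (\<Sum>w\<in>{l<..<n}. 12 * (p * (1 * decay i w)) + (\<Sum>u\<in>{l..<n}. 2 * (p * (p * (1 * decay i (max u w))))))"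
    by (intro sum_mono survivor_weight_le[where K = "{}"]) (use l i in auto)
  also have "\<dots> \<le> 7360 * 4 ^ i * 1" by (rule sum_survivor_weight) simp
  also have "\<dots> \<le> 7360 * 4 ^ 4 * 1" using False by (intro mult_mono power_increasing) auto
  finally show ?thesis using expected_round_cost_weight[OF l(2), of i] by simp
next
  case True
  define L where "L = 3 * exp (- (2 ^ i / 64 :: real))"
  let ?A = "\<lambda>w. 12 * (p * (L * decay i w)) + (\<Sum>u\<in>{l..<n}. 2 * (p * (p * (L * decay i (max u w)))))"
  let ?B = "\<lambda>w. if l + 1 < w then 1376 * (p * ((p * real (w - l) + 1) * (1 - p / 2) ^ (w - l - 2))) else 0"
  have L0: "0 \<le> L" unfolding L_def by simp
  have A0: "0 \<le> ?A w" for w using L0 p_pos decay_nonneg by (intro add_nonneg_nonneg sum_nonneg) auto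
  have B0: "0 \<le> ?B w" for w using p_pos p_le_1 by auto
  have "survivor_weight i w \<le> ?A w + ?B w" if w: "w \<in> {l<..<n}" for w
  proof (cases "s i / 32 < real (w - l)")
    case far: True
    have "survivor_weight i w \<le> ?A w" unfolding L_def
      by (rule survivor_weight_far[OF l(1) True _ _ far]) (use w in auto)
    then show ?thesis using B0[of w] by linarith
  next
    case False
    have "survivor_weight i w \<le> ?B w"
      by (rule survivor_weight_close[OF l(1) True]) (use w False in auto)
    then show ?thesis using A0[of w] by linarith
  qed
  then have "(\<Sum>w\<in>{l<..<n}. survivor_weight i w) \<le> (\<Sum>w\<in>{l<..<n}. ?A w + ?B w)" by (rule sum_mono)
  also have "\<dots> = (\<Sum>w\<in>{l<..<n}. ?A w) + (\<Sum>w\<in>{l<..<n}. ?B w)" by (rule sum.distrib)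
  also have "\<dots> \<le> 7360 * 4 ^ i * L + 66048" by (rule add_mono[OF sum_survivor_weight[OF L0] sum_close_weights])
  also have "\<dots> \<le> 10 ^ 9"
  proof -
    define x where "x = (2::real) ^ i"
    have x0: "x > 0" unfolding x_def by simp
    \<comment> \<open>Gives \<open>x\<^sup>2 * exp (- x / 64)\<close> at most 2 * 64 * 64 = 8192, so
      the exponential beats 4 ^ i.\<close>
    have "(x / 64)\<^sup>2 / 2 \<le> exp (x / 64)" using exp_lower_Taylor_quadratic[of "x / 64"] x0 by simp
    then have "x\<^sup>2 \<le> 8192 * exp (x / 64)" by (simp add: power_divide)
    then have "x\<^sup>2 * exp (- (x / 64)) \<le> 8192 * exp (x / 64) * exp (- (x / 64))" by (intro mult_right_mono) auto
    also have "\<dots> = 8192" by (simp add: exp_minus)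
    finally have "x\<^sup>2 * exp (- (x / 64)) \<le> 8192" .
    moreover have "(4::real) ^ i = x\<^sup>2" unfolding x_def by (simp add: power2_eq_square power_mult_distrib[symmetric])
    ultimately have "4 ^ i * L \<le> 24576" unfolding L_def x_def by simp
    moreover have "(10::real) ^ 9 = 1000000000" by simp
    ultimately have "7360 * (4 ^ i * L) + 66048 \<le> 10 ^ 9" by linarith
    then show ?thesis by (simp only: mult.assoc)
  qed
  finally show ?thesis using expected_round_cost_weight[OF l(2), of i] by simp
qed

end

section \<open>The total cost\<close>

definition position_step_cost ::
    "real \<Rightarrow> nat \<Rightarrow> nat \<Rightarrow> nat \<Rightarrow> (nat \<times> nat \<Rightarrow> nat \<Rightarrow> bool) \<Rightarrow> nat \<Rightarrow> nat" where
  "position_step_cost p n q c Y l = (let T = last_rebuild p (l - 1) in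
     (\<Sum>i=1..q. position_update_cost n q c (rel Y) l T i) +
     (\<Sum>i=1..q. if rebuild_due p l i then \<Sum>j=1..i. position_build_cost n q c (rel Y) l T j else 0) +
     (\<Sum>i=1..q + c. position_round_cost n q c (rel Y) (\<lambda>a b. labelled q (rel Y a b)) l T i))"

definition position_cost ::
    "real \<Rightarrow> nat \<Rightarrow> nat \<Rightarrow> nat \<Rightarrow> nat \<Rightarrow> (nat \<times> nat \<Rightarrow> nat \<Rightarrow> bool) \<Rightarrow> nat" where
  "position_cost p n q c m Y =
     (\<Sum>j=1..q. position_build_cost n q c (rel Y) 0 (\<lambda>_. 0) j) + (n + 1) +
     (\<Sum>l=1..<m. position_step_cost p n q c Y l)"

text \<open>Different steps l own disjoint intervals (l - 1, l], so choosing a multiple in each is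
  injective.\<close>

lemma card_rebuild_due:
  assumes "0 < p"
  shows "real (card {l \<in> {1..<m}. rebuild_due p l i}) \<le> 32 * real m / s_param p i"
proof -
  let ?s = "s_param p i / 32" and ?A = "{l \<in> {1..<m}. rebuild_due p l i}"
  have s: "0 < ?s" using assms by (simp add: s_param_def)
  define f where "f l = (SOME k::nat. real l - 1 < real k * ?s \<and> real k * ?s \<le> real l)" for l
  have f: "real l - 1 < real (f l) * ?s \<and> real (f l) * ?s \<le> real l" if "l \<in> ?A" for l
  proof -
    have "\<exists>k::nat. real l - 1 < real k * ?s \<and> real k * ?s \<le> real l"
      using that unfolding rebuild_due_def by blast
    from someI_ex[OF this] show ?thesis unfolding f_def .
  qed
  have "inj_on f ?A"
  proof (rule inj_onI)
    fix l l' assume l: "l \<in> ?A" "l' \<in> ?A" "f l = f l'"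
    then have "real l - 1 < real l'" "real l' - 1 < real l" using f[OF l(1)] f[OF l(2)] by auto
    then show "l = l'" by linarith
  qed
  then have "card ?A = card (f ` ?A)" by (simp add: card_image)
  also have "\<dots> \<le> card {1..nat \<lfloor>real m / ?s\<rfloor>}"
  proof (rule card_mono)
    show "f ` ?A \<subseteq> {1..nat \<lfloor>real m / ?s\<rfloor>}"
    proof
      fix k assume "k \<in> f ` ?A"
      then obtain l where l: "l \<in> ?A" "k = f l" by auto
      then have "1 \<le> real l" "real l \<le> real m" by auto
      moreover have "real l - 1 < real k * ?s" "real k * ?s \<le> real l" using f[OF l(1)] l(2) by auto
      ultimately have "0 < real k * ?s" "real k * ?s \<le> real m" by linarith+
      then have "0 < k" "real k \<le> real m / ?s" using s by (auto simp: pos_le_divide_eq zero_less_mult_iff)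
      then show "k \<in> {1..nat \<lfloor>real m / ?s\<rfloor>}" by (auto simp: le_nat_iff le_floor_iff)
    qed
  qed simp
  finally have "real (card ?A) \<le> real (nat \<lfloor>real m / ?s\<rfloor>)" by simp
  also have "\<dots> \<le> real m / ?s" using s by (simp add: of_nat_nat)
  finally show ?thesis by (simp add: mult.commute)
qed

lemma sum_s_param:
  fixes p :: real
  assumes "0 < p"
  shows "(\<Sum>j=1..i. 2 ^ j / p) \<le> 2 * (2 ^ i / p)"
proof -
  have "(\<Sum>j=1..i. 2 ^ j / p) = 2 * (2 ^ i / p) - 2 / p"
    using assms by (induction i) (auto simp: field_simps)
  then show ?thesis using assms by simp
qed

definition cost_constant :: "nat \<Rightarrow> real" where
  "cost_constant c = 1000000 * 4 ^ c + 10 ^ 9 * (1 + real c)"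

lemma cost_constant_pos: "0 < cost_constant c"
  unfolding cost_constant_def by (intro add_pos_nonneg) auto

context label_parameters
begin

text \<open>Per index i the total is O(n): the initial build once, a constant per step for updates
  and for each search round, and rebuilds of cost O(\<open>s i\<close>) every
  \<open>s i / 32\<close> steps. The c search rounds beyond q are absorbed by the factor 1 +
  c.\<close>

lemma expected_position_cost:
  assumes n: "real n \<le> 2 ^ q / p" and c: "8 \<le> c" and m: "m \<le> n" "1 \<le> n"
  shows "measure_pmf.expectation (position_law p q n) (\<lambda>Y. real (position_cost p n q c m Y)) \<le>
    cost_constant c * real n * real q"
proof -
  let ?P = "position_law p q n"
  let ?E = "\<lambda>f. measure_pmf.expectation ?P f"
  let ?T = "\<lambda>l. last_rebuild p (l - 1)"
  have int [simp]: "integrable (measure_pmf ?P) (f :: _ \<Rightarrow> real)" for f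
    by (rule integrable_measure_pmf_finite[OF finite_set_position_law])
  have sa0: "sorting_analysis p q n c 0 (\<lambda>_. 0)"
    by unfold_locales (use n c p_pos in auto)
  have sa: "sorting_analysis p q n c l (?T l)" for l
  proof (unfold_locales, rule n, rule c)
    fix j :: nat assume "1 \<le> j"
    \<comment> \<open>The true age of the last rebuild is below \<open>s_j / 32\<close> + 1; as
      \<open>s_j\<close> is at least 2, this is at most \<open>s_j\<close>.\<close>
    have "(2::real) \<le> 2 ^ j" using power_increasing[OF \<open>1 \<le> j\<close>, of "2::real"] by simp
    moreover have "2 ^ j \<le> 2 ^ j / p" using p_pos p_le_1 by (simp add: pos_le_divide_eq mult_left_le)
    ultimately have "2 \<le> 2 ^ j / p" by linarith
    moreover have "real (l - 1) < real (last_rebuild p (l - 1) j) + (2 ^ j / p) / 32"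
      using last_rebuild_recent[OF p_pos, of "l - 1" j] by (simp add: s_param_def)
    moreover have "real l \<le> real (l - 1) + 1" by linarith
    ultimately show "real l \<le> real (last_rebuild p (l - 1) j) + 2 ^ j / p" by argo
  qed
  let ?B = "\<lambda>l j. ?E (\<lambda>Y. real (position_build_cost n q c (rel Y) l (?T l) j))"
  let ?U = "\<lambda>l i. ?E (\<lambda>Y. real (position_update_cost n q c (rel Y) l (?T l) i))"
  let ?F = "\<lambda>l i. ?E (\<lambda>Y. real (position_round_cost n q c (rel Y) (\<lambda>a b. labelled q (rel Y a b)) l (?T l) i))"
  have B0: "?E (\<lambda>Y. real (position_build_cost n q c (rel Y) 0 (\<lambda>_. 0) j)) \<le> 7000 * 4 ^ c * real n" if "j \<in> {1..q}" for j
    by (rule sorting_analysis.expected_build_cost_le(2)[OF sa0]) (use that in auto)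
  have B: "?B l j \<le> 7000 * 4 ^ c * (2 ^ j / p)" if "j \<in> {1..q}" for l j
    using sorting_analysis.expected_build_cost_le(1)[OF sa, of j l] sorting_analysis.s_def[OF sa] that by auto
  have U: "?U l i \<le> 30000 * 4 ^ c" if "i \<in> {1..q}" "l \<in> {1..<m}" for l i
    by (rule sorting_analysis.expected_update_cost[OF sa]) (use that m in auto)
  have F: "?F l i \<le> 10 ^ 9" if "i \<in> {1..q + c}" "l \<in> {1..<m}" for l i
    by (rule sorting_analysis.expected_round_cost[OF sa]) (use that m in auto)
  have "?E (\<lambda>Y. real (position_cost p n q c m Y)) =
    (\<Sum>j=1..q. ?E (\<lambda>Y. real (position_build_cost n q c (rel Y) 0 (\<lambda>_. 0) j))) + (real n + 1) +
    (\<Sum>l=1..<m. (\<Sum>i=1..q. ?U l i) + (\<Sum>i=1..q. if rebuild_due p l i then \<Sum>j=1..i. ?B l j else 0) +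
       (\<Sum>i=1..q + c. ?F l i))"
  proof -
    have if_E: "?E (\<lambda>Y. real (if b then \<Sum>j=1..i. f Y j else 0)) = (if b then \<Sum>j=1..i. ?E (\<lambda>Y. real (f Y j)) else 0)"
      for b and i :: nat and f :: "_ \<Rightarrow> nat \<Rightarrow> nat"
      by (cases b) (simp_all add: Bochner_Integration.integral_sum)
    show ?thesis unfolding position_cost_def position_step_cost_def Let_def of_nat_add of_nat_sum
      by (simp add: Bochner_Integration.integral_sum Bochner_Integration.integral_add if_E del: of_nat_sum)
  qed
  also have "\<dots> \<le> (\<Sum>j=1..q. 7000 * 4 ^ c * real n) + (real n + 1) +
    (\<Sum>l=1..<m. (\<Sum>i=1..q. 30000 * 4 ^ c) + (\<Sum>i=1..q. if rebuild_due p l i then 14000 * 4 ^ c * (2 ^ i / p) else 0) +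
       (\<Sum>i=1..q + c. 10 ^ 9))"
  proof (intro add_mono sum_mono B0 U F order_refl)
    fix l i assume i: "i \<in> {1..q}"
    have "(\<Sum>j=1..i. ?B l j) \<le> (\<Sum>j=1..i. 7000 * 4 ^ c * (2 ^ j / p))"
      by (intro sum_mono B) (use i in auto)
    also have "\<dots> = 7000 * 4 ^ c * (\<Sum>j=1..i. 2 ^ j / p)" by (simp add: sum_distrib_left)
    also have "\<dots> \<le> 7000 * 4 ^ c * (2 * (2 ^ i / p))" by (intro mult_left_mono sum_s_param p_pos) simp
    finally show "(if rebuild_due p l i then \<Sum>j=1..i. ?B l j else 0) \<le>
      (if rebuild_due p l i then 14000 * 4 ^ c * (2 ^ i / p) else 0)" by simp
  qed auto
  also have "\<dots> = real q * (7000 * 4 ^ c * real n) + (real n + 1) +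
     (real (m - 1) * (real q * (30000 * 4 ^ c)) +
      (\<Sum>i=1..q. \<Sum>l=1..<m. if rebuild_due p l i then 14000 * 4 ^ c * (2 ^ i / p) else 0) +
      real (m - 1) * (real (q + c) * 10 ^ 9))"
  proof -
    have "(\<Sum>l=1..<m. \<Sum>i=1..q. if rebuild_due p l i then 14000 * 4 ^ c * (2 ^ i / p) else 0) =
      (\<Sum>i=1..q. \<Sum>l=1..<m. if rebuild_due p l i then 14000 * 4 ^ c * (2 ^ i / p) else 0)"
      by (rule sum.swap)
    then show ?thesis by (simp only: sum.distrib sum_constant card_atLeastAtMost card_atLeastLessThan) simp
  qed
  also have "(\<Sum>i=1..q. \<Sum>l=1..<m. if rebuild_due p l i then 14000 * 4 ^ c * (2 ^ i / p) else 0) \<le>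
     real q * (448000 * 4 ^ c * real n)"
  proof -
    have "(\<Sum>l=1..<m. if rebuild_due p l i then 14000 * 4 ^ c * (2 ^ i / p) else 0) \<le> 448000 * 4 ^ c * real n" for i
    proof -
      have "(\<Sum>l=1..<m. if rebuild_due p l i then 14000 * 4 ^ c * (2 ^ i / p) else 0) =
        real (card {l \<in> {1..<m}. rebuild_due p l i}) * (14000 * 4 ^ c * (2 ^ i / p))"
        by (simp add: sum.If_cases Int_def)
      \<comment> \<open>The rebuild count and the rebuild cost cancel in \<open>s_i\<close>: 32 *
        14000 = 448000.\<close>
      also have "\<dots> \<le> 32 * real m / s_param p i * (14000 * 4 ^ c * (2 ^ i / p))"
        by (intro mult_right_mono card_rebuild_due p_pos) (use p_pos in auto)
      also have "\<dots> = 448000 * 4 ^ c * real m" using p_pos by (simp add: s_param_def)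
      also have "\<dots> \<le> 448000 * 4 ^ c * real n" using m by (intro mult_left_mono) auto
      finally show ?thesis .
    qed
    then have "(\<Sum>i=1..q. \<Sum>l=1..<m. if rebuild_due p l i then 14000 * 4 ^ c * (2 ^ i / p) else 0) \<le>
       (\<Sum>i=1..q. 448000 * 4 ^ c * real n)" by (intro sum_mono)
    then show ?thesis by simp
  qed
  also have "real q * (7000 * 4 ^ c * real n) + (real n + 1) +
     (real (m - 1) * (real q * (30000 * 4 ^ c)) + real q * (448000 * 4 ^ c * real n) +
      real (m - 1) * (real (q + c) * 10 ^ 9)) \<le> 
     real q * (7000 * 4 ^ c * real n) + 2 * (4 ^ c * (real n * real q)) +
     (real n * (real q * (30000 * 4 ^ c)) + real q * (448000 * 4 ^ c * real n) +
      real n * (real q * (1 + real c) * 10 ^ 9))"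
  proof (intro add_mono order_refl)
    have "real n * 1 \<le> real n * real q" using q_ge_1 by (intro mult_left_mono) auto
    moreover have "1 \<le> real n" using m by simp
    ultimately have "real n + 1 \<le> 2 * (1 * (real n * real q))" by linarith
    also have "\<dots> \<le> 2 * (4 ^ c * (real n * real q))" by (intro mult_left_mono mult_right_mono) auto
    finally show "real n + 1 \<le> 2 * (4 ^ c * (real n * real q))" .
    show "real (m - 1) * (real q * (30000 * 4 ^ c)) \<le> real n * (real q * (30000 * 4 ^ c))"
      using m by (intro mult_right_mono) auto
    have "real (q + c) \<le> real q * (1 + real c)"
    proof -
      have "1 * real c \<le> real q * real c" using q_ge_1 by (intro mult_right_mono) auto
      then show ?thesis by (simp add: algebra_simps)
    qed
    then show "real (m - 1) * (real (q + c) * 10 ^ 9) \<le> real n * (real q * (1 + real c) * 10 ^ 9)"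
      using m by (intro mult_mono) auto
  qed
  also have "\<dots> = (485002 * 4 ^ c + 10 ^ 9 * (1 + real c)) * real n * real q" by (simp add: algebra_simps)
  also have "\<dots> \<le> cost_constant c * real n * real q"
    unfolding cost_constant_def by (intro mult_right_mono add_right_mono) auto
  finally show ?thesis by simp
qed

section \<open>From positions back to the algorithm\<close>

lemma edge_law_label_range:
  assumes "X \<in> set_pmf (edge_law p q xs)" "X a j"
  shows "j \<in> {1..q}"
proof -
  have "X a \<noteq> (\<lambda>_. False)" using assms(2) by auto
  then have "a \<in> all_pairs xs"
    using subsetD[OF set_Pi_pmf_subset[OF finite_all_pairs] assms(1)[unfolded edge_law_def]] by auto
  then have "X a \<in> set_pmf (label_pmf p q) \<union> set_pmf (independent_label_pmf p q)"
    using assms(1) unfolding edge_law_def set_Pi_pmf[OF finite_all_pairs] PiE_dflt_def by (auto split: if_splits)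
  moreover have "set_pmf (label_pmf p q) \<subseteq> set_pmf (independent_label_pmf p q)"
    by (auto simp: set_pmf_iff pmf_label split: if_splits)
  ultimately have "X a \<in> set_pmf (independent_label_pmf p q)" by blast
  from subsetD[OF set_Pi_pmf_subset this[unfolded independent_label_pmf_def]] show ?thesis
    using assms(2) by auto
qed

lemma discover_correct:
  assumes xs: "distinct xs" "set xs = {..<n}" and X: "X \<in> set_pmf (edge_law p q xs)"
    and c: "1 \<le> c" and n: "2 \<le> n" and pick: "\<And>F. F \<noteq> {} \<Longrightarrow> pick F \<in> F" and m: "1 \<le> m" "m \<le> n"
  defines "A \<equiv> discover pick n p q c (edges_of q xs X) (\<lambda>i. {a \<in> edges_of q xs X. X a i}) m"
  shows "result (answer xs (edges_of q xs X)) A = take m xs"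
    "cost (answer xs (edges_of q xs X)) A \<le> position_cost p n q c m (at_positions xs X)"
proof -
  let ?E = "edges_of q xs X" and ?Es = "\<lambda>i. {a \<in> edges_of q xs X. X a i}" and ?Y = "at_positions xs X"
  interpret I: sorting_instance xs n q c ?E ?Es
  proof
    show "deterministic_pairs xs \<subseteq> ?E" by (rule set_edge_law[OF xs(1) X])
    show "?E \<subseteq> {e. e \<subseteq> {..<n} \<and> card e = 2}" unfolding edges_of_def all_pairs_def xs(2) by auto
  qed (use xs c q_ge_1 n in auto)
  have pair: "{xs ! a, xs ! b} \<in> all_pairs xs \<longleftrightarrow> a \<noteq> b" if "a < n" "b < n" for a b
    using that I.length_xs I.nth_eq[of a b] by (auto simp: all_pairs_def card_insert_if)
  have Y: "rel ?Y a b = (if a < n \<and> b < n \<and> a \<noteq> b then X {xs ! a, xs ! b} else (\<lambda>_. False))" for a b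
  proof -
    have "{xs ! min a b, xs ! max a b} = {xs ! a, xs ! b}" by (auto simp: min_def max_def)
    then show ?thesis
      unfolding rel_def at_positions_def position_pairs_def I.length_xs by (auto simp: min_def max_def)
  qed
  have e: "I.e = (\<lambda>a b. labelled q (rel ?Y a b))"
  proof (intro ext)
    fix a b
    have "{xs ! a, xs ! b} \<in> ?E \<longleftrightarrow> {xs ! a, xs ! b} \<in> all_pairs xs \<and> labelled q (X {xs ! a, xs ! b})"
      by (simp add: edges_of_def)
    moreover have "\<not> labelled q (\<lambda>_. False)" by (simp add: labelled_def)
    ultimately show "I.e a b = labelled q (rel ?Y a b)" unfolding I.e_def Y using pair[of a b] by auto
  qed
  have r: "I.r = rel ?Y"
  proof (intro ext)
    fix a b j
    have "X {xs ! a, xs ! b} j \<Longrightarrow> labelled q (X {xs ! a, xs ! b})"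
      using edge_law_label_range[OF X] unfolding labelled_def by blast
    moreover have "{xs ! a, xs ! b} \<in> ?E \<longleftrightarrow> {xs ! a, xs ! b} \<in> all_pairs xs \<and> labelled q (X {xs ! a, xs ! b})"
      by (simp add: edges_of_def)
    ultimately show "I.r a b j = rel ?Y a b j" unfolding I.r_def Y using pair[of a b] by auto
  qed
  have step: "I.step_cost p l = position_step_cost p n q c ?Y l" if "l \<in> {1..<m}" for l
  proof -
    have l: "1 \<le> l" "l < n" using that m by auto
    show ?thesis
      unfolding I.step_cost_def position_step_cost_def Let_def I.promote_cost_positions[OF l]
        I.build_cost_positions I.round_cost_positions[OF l] r e ..
  qed
  have total: "(\<Sum>j=1..q. I.build_cost 0 (\<lambda>_. 0) j) + (n + 1) + (\<Sum>l=1..<m. I.step_cost p l) =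
    position_cost p n q c m ?Y"
    unfolding position_cost_def I.build_cost_positions r using step by simp
  show "result (answer xs ?E) A = take m xs" "cost (answer xs ?E) A \<le> position_cost p n q c m ?Y"
    using I.run_discover[OF pick m, of p] unfolding A_def total by auto
qed

lemma precedes_rev: "precedes (rev xs) u v \<longleftrightarrow> precedes xs v u"
proof -
  have "precedes xs v u" if rev: "precedes (rev xs) u v" for xs :: "nat list" and u v
  proof -
    obtain i j where ij: "i < j" "j < length xs" "rev xs ! i = u" "rev xs ! j = v"
      using rev unfolding precedes_def length_rev by blast
    then have "xs ! (length xs - Suc i) = u" "xs ! (length xs - Suc j) = v" by (auto simp: rev_nth)
    moreover have "length xs - Suc j < length xs - Suc i" "length xs - Suc i < length xs" using ij by auto
    ultimately show ?thesis unfolding precedes_def by blast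
  qed
  from this[of xs u v] this[of "rev xs" v u] show ?thesis by auto
qed

lemma answer_rev: "(\<lambda>u v. answer xs E v u) = answer (rev xs) E"
  by (auto simp: fun_eq_iff answer_def precedes_rev insert_commute)

text \<open>The reversed second run is a run on \<open>rev xs\<close> with the same graph and
  labels; it returns the last n - n div 2 vertices in reversed order.\<close>

lemma sort_with_correct:
  assumes xs: "distinct xs" "set xs = {..<n}" and X: "X \<in> set_pmf (edge_law p q xs)"
    and c: "1 \<le> c" and n: "2 \<le> n" and pick: "\<And>F. F \<noteq> {} \<Longrightarrow> pick F \<in> F"
  defines "R \<equiv> run (answer xs (edges_of q xs X))
       (sort_with pick n p q c (edges_of q xs X) (\<lambda>i. {a \<in> edges_of q xs X. X a i}))"
  shows "fst R = xs"
    "snd R \<le> position_cost p n q c (n div 2) (at_positions xs X) +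
       position_cost p n q c (n - n div 2) (at_positions (rev xs) X)"
proof -
  have len: "length xs = n" using distinct_card[OF xs(1)] xs(2) by simp
  have xs': "distinct (rev xs)" "set (rev xs) = {..<n}" using xs by auto
  have X': "X \<in> set_pmf (edge_law p q (rev xs))" using X by (simp add: edge_law_rev)
  have m: "1 \<le> n div 2" "n div 2 \<le> n" "1 \<le> n - n div 2" "n - n div 2 \<le> n" using n by auto
  note 1 = discover_correct[OF xs X c n pick m(1,2)]
  note 2 = discover_correct[OF xs' X' c n pick m(3,4), unfolded edges_of_rev]
  have "rev (take (n - n div 2) (rev xs)) = drop (n div 2) xs"
    using len m by (simp add: take_rev)
  then show "fst R = xs" "snd R \<le> position_cost p n q c (n div 2) (at_positions xs X) +
       position_cost p n q c (n - n div 2) (at_positions (rev xs) X)"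
    using 1 2 unfolding R_def sort_with_def by (auto simp: run_bind run_reversed answer_rev)
qed

end

lemma sorting_experiment_bounds:
  fixes n q c :: nat and p b :: real
  assumes c: "8 \<le> c" and b: "0 < b" and p: "0 < p" "p \<le> 1" and q: "1 \<le> q"
    and lo: "2 * ln (p * real n) \<le> real q" and hi: "real q \<le> b * ln (p * real n)"
    and pick: "\<forall>F. F \<noteq> {} \<longrightarrow> pick F \<in> F" and xs: "distinct xs" "set xs = {..<n}"
  defines "K \<equiv> 2 * cost_constant c * b"
  shows "(\<forall>(ys, k) \<in> set_pmf (sorting_experiment pick p q c xs). ys = xs) \<and>
    measure_pmf.expectation (sorting_experiment pick p q c xs) (\<lambda>(ys, k). real k)
      \<le> K * real n * ln (p * real n)"
proof -
  interpret label_parameters p q by unfold_locales (rule p q)+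
  have len: "length xs = n" using distinct_card[OF xs(1)] xs(2) by simp
  have "0 < b * ln (p * real n)" using hi q by linarith
  then have ln: "0 < ln (p * real n)" using b by (simp add: zero_less_mult_iff)
  have "n \<noteq> 0" using ln by (intro notI) simp
  then have pn0: "0 < p * real n" using p by simp
  then have pn: "1 < p * real n" using ln by (simp add: ln_gt_zero_iff)
  have n2: "2 \<le> n"
  proof (rule ccontr)
    assume "\<not> 2 \<le> n"
    then have "real n \<le> 1" by simp
    then have "p * real n \<le> 1 * 1" using p by (intro mult_mono) auto
    then show False using pn by simp
  qed
  \<comment> \<open>The lower bound on q enters here: 2 * ln 2 is at least 1, so q at least 2 * ln
    (p * n) makes 2 ^ q at least p * n.\<close>
  have nq: "real n \<le> 2 ^ q / p"
  proof -
    have ln2: "1 / 2 \<le> ln (2::real)" using ln_le_minus_one[of "1 / 2 :: real"] by (simp add: ln_div)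
    have "ln (p * real n) = (2 * ln (p * real n)) * (1 / 2)" by simp
    also have "\<dots> \<le> real q * ln 2" using lo ln ln2 by (intro mult_mono) auto
    also have "\<dots> = ln (2 ^ q)" by (simp add: ln_realpow)
    finally have "p * real n \<le> 2 ^ q" using pn0 by simp
    then show ?thesis using p by (simp add: pos_le_divide_eq mult.commute)
  qed
  let ?R = "\<lambda>X. run (answer xs (edges_of q xs X))
    (sort_with pick n p q c (edges_of q xs X) (\<lambda>i. {a \<in> edges_of q xs X. X a i}))"
  have exp: "sorting_experiment pick p q c xs = map_pmf ?R (edge_law p q xs)"
    using sorting_experiment_edge_law[OF xs(1), of pick c] unfolding len .
  have c1: "1 \<le> c" using c by simp
  have pick': "pick F \<in> F" if "F \<noteq> {}" for F using pick that by blast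
  have R1: "fst (?R X) = xs" if "X \<in> set_pmf (edge_law p q xs)" for X
    by (rule sort_with_correct(1)[OF xs that c1 n2 pick'])
  have R2: "snd (?R X) \<le> position_cost p n q c (n div 2) (at_positions xs X) +
      position_cost p n q c (n - n div 2) (at_positions (rev xs) X)" if "X \<in> set_pmf (edge_law p q xs)" for X
    by (rule sort_with_correct(2)[OF xs that c1 n2 pick'])
  have "\<forall>(ys, k) \<in> set_pmf (sorting_experiment pick p q c xs). ys = xs"
  proof (intro ballI, unfold case_prod_beta)
    fix yk assume "yk \<in> set_pmf (sorting_experiment pick p q c xs)"
    then obtain X where "X \<in> set_pmf (edge_law p q xs)" "yk = ?R X" unfolding exp set_map_pmf by blast
    then show "fst yk = xs" using R1 by blast
  qed
  moreover have "measure_pmf.expectation (sorting_experiment pick p q c xs) (\<lambda>(ys, k). real k)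
    \<le> K * real n * ln (p * real n)"
  proof -
    let ?X = "edge_law p q xs" and ?C = "\<lambda>m Y. real (position_cost p n q c m Y)"
    have int: "integrable (measure_pmf ?X) (f :: _ \<Rightarrow> real)" for f
      by (rule integrable_measure_pmf_finite[OF finite_set_edge_law])
    \<comment> \<open>The position law is the same for both orders, so one estimate serves both
      halves.\<close>
    have half: "measure_pmf.expectation ?X (\<lambda>X. ?C m (at_positions ys X)) \<le> cost_constant c * real n * real q"
      if "ys = xs \<or> ys = rev xs" "m \<le> n" for m ys
    proof -
      have ys1: "distinct ys" using that(1) xs(1) by (elim disjE) simp_all
      have ys2: "length ys = n" using that(1) len by (elim disjE) simp_all
      have ys3: "edge_law p q ys = ?X" using that(1) by (elim disjE) (simp_all add: edge_law_rev)
      have "measure_pmf.expectation ?X (\<lambda>X. ?C m (at_positions ys X)) =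
        measure_pmf.expectation (map_pmf (at_positions ys) ?X) (?C m)"
        by (rule integral_map_pmf[symmetric])
      also have "map_pmf (at_positions ys) ?X = position_law p q n"
        using map_at_positions[OF ys1, of p q] unfolding ys2 ys3 .
      also have "measure_pmf.expectation (position_law p q n) (?C m) \<le> cost_constant c * real n * real q"
        by (rule expected_position_cost[OF nq c that(2)]) (use n2 in simp)
      finally show ?thesis .
    qed
    have "measure_pmf.expectation (sorting_experiment pick p q c xs) (\<lambda>(ys, k). real k) =
      measure_pmf.expectation ?X (\<lambda>X. real (snd (?R X)))"
      unfolding exp by (simp add: case_prod_beta)
    also have "\<dots> \<le> measure_pmf.expectation ?X
        (\<lambda>X. ?C (n div 2) (at_positions xs X) + ?C (n - n div 2) (at_positions (rev xs) X))"
    proof (rule integral_mono_AE[OF int int])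
      show "AE X in ?X. real (snd (?R X)) \<le>
        ?C (n div 2) (at_positions xs X) + ?C (n - n div 2) (at_positions (rev xs) X)"
        using R2 unfolding AE_measure_pmf_iff of_nat_add[symmetric] of_nat_le_iff by blast
    qed
    also have "\<dots> = measure_pmf.expectation ?X (\<lambda>X. ?C (n div 2) (at_positions xs X)) +
       measure_pmf.expectation ?X (\<lambda>X. ?C (n - n div 2) (at_positions (rev xs) X))"
      by (rule Bochner_Integration.integral_add[OF int int])
    also have "\<dots> \<le> cost_constant c * real n * real q + cost_constant c * real n * real q"
      by (intro add_mono half) auto
    also have "\<dots> = (2 * cost_constant c * real n) * real q" by simp
    also have "\<dots> \<le> (2 * cost_constant c * real n) * (b * ln (p * real n))"
      using hi cost_constant_pos[of c] by (intro mult_left_mono) auto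
    finally show ?thesis by (simp add: K_def mult_ac)
  qed
  ultimately show ?thesis ..
qed

theorem theorem1:
  shows "\<exists>a>0. \<exists>c0::nat. \<forall>c\<ge>c0. \<forall>b>0. \<exists>K>0.
    \<forall>(n::nat) (p::real) (q::nat) (pick :: (nat \<times> nat) set \<Rightarrow> nat \<times> nat) (xs :: nat list).
      0 < p \<and> p \<le> 1 \<and> 1 \<le> q \<and>
      a * ln (p * real n) \<le> real q \<and> real q \<le> b * ln (p * real n) \<and>
      (\<forall>F. F \<noteq> {} \<longrightarrow> pick F \<in> F) \<and> distinct xs \<and> set xs = {..<n} \<longrightarrow>
      (\<forall>(ys, k) \<in> set_pmf (sorting_experiment pick p q c xs). ys = xs) \<and>
      measure_pmf.expectation (sorting_experiment pick p q c xs) (\<lambda>(ys, k). real k)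
        \<le> K * real n * ln (p * real n)"
  \<comment> \<open>The witness 2 makes the top scale reach n, and 8 makes window positions robust
    with probability at least 1/2; K contains b because the cost was bounded by a multiple of n *
    q.\<close>
  apply (rule exI[of _ 2], rule conjI, simp, rule exI[of _ 8], intro allI impI)
  subgoal for c b
    by (rule exI[of _ "2 * cost_constant c * b"], rule conjI, simp add: cost_constant_pos,
        intro allI impI, elim conjE, rule sorting_experiment_bounds)
  done

end
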